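(* Let $\lambda>1$ and let $a_1<b_1<0$ with $\lambda b_1<a_1$. Put $$E=(-\infty,0]\setminus\bigcup_{n\in\mathbb Z}(\lambda^na_1,\lambda^nb_1),\qquad \Omega=\mathbb C\setminus E,$$ let $M$ be a symmetric Martin function of $\Omega$ at infinity and let $\pi:\mathbb C_+\to\Omega$ be a universal covering. Then the representing measure of the positive harmonic function $M\circ\pi$ on $\mathbb C_+$ is a purely continuous singular measure; that is, it is singular and has no atoms in $\mathbb R\cup\{\infty\}$.
   Context: A symmetric Martin function of $\Omega$ at infinity is a non-zero positive harmonic function $M$ in $\Omega$ that extends continuously by $0$ to $E$ and satisfies $M(\bar z)=M(z)$; since $E\subset(-\infty,0]$ it is unique up to a positive factor. Every positive harmonic function on $\mathbb C_+$ has a unique representation $p(\xi+i\eta)=b\eta+\int_{\mathbb R}\frac{\eta}{(\xi-t)^2+\eta^2}\,d\mu(t)$ with $b\ge0$, $\mu\ge0$; its representing measure is $b\delta_\infty+\mu$ on $\mathbb R\cup\{\infty\}$. It is called singular if $\mu$ is singular with respect to Lebesgue measure. *)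

theory Defs
  imports "HOL-Complex_Analysis.Complex_Analysis"
begin

definition upper_half_plane :: "complex set" where
  "upper_half_plane = {z. 0 < Im z}"

text \<open>The functions \<open>ux, uy\<close> are the first and \<open>uxx, uxy, uyx, uyy\<close> the second
  partial derivatives; the definition says that \<open>u\<close> is twice continuously differentiable
  on the open set \<open>S\<close> with vanishing Laplacian.\<close>

definition harmonic_on :: "(complex \<Rightarrow> real) \<Rightarrow> complex set \<Rightarrow> bool" where
  "harmonic_on u S \<longleftrightarrow> open S \<and>
     (\<exists>ux uy uxx uxy uyx uyy :: complex \<Rightarrow> real.
        continuous_on S uxx \<and> continuous_on S uxy \<and>
        continuous_on S uyx \<and> continuous_on S uyy \<and>
        (\<forall>z\<in>S. (u has_derivative (\<lambda>h. ux z * Re h + uy z * Im h)) (at z) \<and>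
               (ux has_derivative (\<lambda>h. uxx z * Re h + uxy z * Im h)) (at z) \<and>
               (uy has_derivative (\<lambda>h. uyx z * Re h + uyy z * Im h)) (at z) \<and>
               uxx z + uyy z = 0))"

text \<open>``Positive'' is read as nonnegative, non-vanishing being required separately.\<close>

definition symmetric_martin_function :: "(complex \<Rightarrow> real) \<Rightarrow> complex set \<Rightarrow> bool" where
  "symmetric_martin_function M E \<longleftrightarrow>
     harmonic_on M (- E) \<and>
     (\<forall>z\<in>- E. 0 \<le> M z) \<and> (\<exists>z\<in>- E. M z \<noteq> 0) \<and>
     continuous_on UNIV (\<lambda>z. if z \<in> E then 0 else M z) \<and>
     (\<forall>z\<in>- E. M (cnj z) = M z)"

text \<open>Coverings of plane domains are understood to be holomorphic.\<close>

definition universal_covering :: "complex set \<Rightarrow> (complex \<Rightarrow> complex) \<Rightarrow> complex set \<Rightarrow> bool" where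
  "universal_covering c p S \<longleftrightarrow>
     simply_connected c \<and> p holomorphic_on c \<and> covering_space c p S"

text \<open>The set \<open>E\<close>, as a subset of the complex plane.\<close>

definition gap_set :: "real \<Rightarrow> real \<Rightarrow> real \<Rightarrow> complex set" where
  "gap_set l a b = complex_of_real ` ({..0} - (\<Union>n::int. {l powi n * a <..< l powi n * b}))"

definition half_plane_representation ::
    "(complex \<Rightarrow> real) \<Rightarrow> real \<Rightarrow> real measure \<Rightarrow> bool" where
  "half_plane_representation p b \<mu> \<longleftrightarrow> 0 \<le> b \<and> sets \<mu> = sets borel \<and>
     (\<forall>\<xi> \<eta>. 0 < \<eta> \<longrightarrow>
        integrable \<mu> (\<lambda>t. \<eta> / ((\<xi> - t)\<^sup>2 + \<eta>\<^sup>2)) \<and>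
        p (Complex \<xi> \<eta>) = b * \<eta> + (LINT t|\<mu>. \<eta> / ((\<xi> - t)\<^sup>2 + \<eta>\<^sup>2)))"

text \<open>The measure \<open>b \<delta>\<^sub>\<infinity> + \<mu>\<close> on the one-point compactification of the real line, modelled by
  the type \<open>real option\<close> with \<open>None\<close> as the point at infinity.\<close>

definition boundary_measure :: "real \<Rightarrow> real measure \<Rightarrow> real option measure" where
  "boundary_measure b \<mu> =
     measure_of UNIV {A. Some -` A \<in> sets borel}
       (\<lambda>A. ennreal b * indicator A None + emeasure \<mu> (Some -` A))"

definition mutually_singular :: "'a measure \<Rightarrow> 'a measure \<Rightarrow> bool" where
  "mutually_singular \<mu> \<nu> \<longleftrightarrow> sets \<mu> = sets \<nu> \<and>
     (\<exists>A\<in>sets \<mu>. emeasure \<mu> A = 0 \<and> emeasure \<nu> (space \<nu> - A) = 0)"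

lemma sigma_algebra_boundary:
  "sigma_algebra UNIV {A. Some -` A \<in> sets (borel :: real measure)}"
  unfolding sigma_algebra_iff2
proof (intro conjI ballI allI impI)
  fix s :: "real option set" assume "s \<in> {A. Some -` A \<in> sets (borel :: real measure)}"
  moreover have "Some -` (UNIV - s) = UNIV - Some -` s" by auto
  ultimately show "UNIV - s \<in> {A. Some -` A \<in> sets (borel :: real measure)}"
    using sets.compl_sets[of "Some -` s" borel] by simp
qed (auto simp: vimage_UN)

lemma sets_boundary_measure:
  "sets (boundary_measure b \<mu>) = {A. Some -` A \<in> sets borel}"
  unfolding boundary_measure_def
  by (simp add: sigma_algebra.sets_measure_of_eq[OF sigma_algebra_boundary])

lemma emeasure_boundary_measure:
  assumes "sets \<mu> = sets borel" and "Some -` A \<in> sets borel"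
  shows "emeasure (boundary_measure b \<mu>) A =
           ennreal b * indicator A None + emeasure \<mu> (Some -` A)"
  unfolding boundary_measure_def
proof (rule emeasure_measure_of_sigma[OF sigma_algebra_boundary])
  show "countably_additive {A. Some -` A \<in> sets borel}
          (\<lambda>A. ennreal b * indicator A None + emeasure \<mu> (Some -` A))"
  proof (rule countably_additiveI)
    fix F :: "nat \<Rightarrow> real option set"
    assume F: "range F \<subseteq> {A. Some -` A \<in> sets borel}" "disjoint_family F"
    have d: "disjoint_family (\<lambda>i. Some -` F i)"
      using F(2) by (fastforce simp: disjoint_family_on_def)
    have r: "range (\<lambda>i. Some -` F i) \<subseteq> sets \<mu>" using F(1) assms(1) by auto
    show "(\<Sum>i. ennreal b * indicator (F i) None + emeasure \<mu> (Some -` F i)) =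
          ennreal b * indicator (\<Union>i. F i) None + emeasure \<mu> (Some -` (\<Union>i. F i))"
      using suminf_emeasure[OF r d] suminf_indicator[OF F(2), of None]
      by (simp add: suminf_add[symmetric] vimage_UN)
  qed
qed (use assms in \<open>auto simp: positive_def\<close>)

lemma emeasure_boundary_measure_singleton:
  assumes "sets \<mu> = sets borel"
  shows "emeasure (boundary_measure b \<mu>) {None} = ennreal b"
    and "emeasure (boundary_measure b \<mu>) {Some t} = emeasure \<mu> {t}"
proof -
  have *: "Some -` {Some t} = {t}" "Some -` {None :: real option} = {}" by auto
  show "emeasure (boundary_measure b \<mu>) {None} = ennreal b"
    using emeasure_boundary_measure[OF assms, of "{None}"] * by simp
  show "emeasure (boundary_measure b \<mu>) {Some t} = emeasure \<mu> {t}"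
    using emeasure_boundary_measure[OF assms, of "{Some t}"] * by simp
qed

end

theory Submission
  imports Defs "HOL-Probability.Helly_Selection"
begin

text \<open>
  Existence of the representation is the Riesz--Herglotz theorem, obtained on the disc from Poisson's
  formula on smaller circles and Helly's selection theorem.

  Singularity: if the representing measure had an absolutely continuous part, then \<open>M \<circ> \<pi>\<close>
  would have a bounded non-zero harmonic minorant. Its supremum over the fibres of \<open>\<pi>\<close> is a
  bounded subharmonic function on \<open>\<Omega>\<close> below \<open>M\<close>; extended by \<open>0\<close> to \<open>E\<close> it is a bounded
  continuous subharmonic function on the plane, hence constant by Liouville, hence \<open>0\<close>.

  Absence of atoms: precomposing \<open>\<pi>\<close> with a Moebius map, it is enough to exclude mass \<open>b > 0\<close>
  at \<open>\<infinity>\<close>. In that case \<open>M \<circ> \<pi>\<close> and its gradient are, near \<open>\<i> y\<close> and up to a bounded hyperbolic distance,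
  asymptotic to those of \<open>b y\<close> as \<open>y \<rightarrow> \<infinity>\<close>, so there are no critical points there. On the other hand
  \<open>\<pi> (\<i> y)\<close> tends to \<open>\<infinity>\<close> and so crosses circles \<open>\<bar>w\<bar> = \<lambda>\<^sup>n R\<close> through the gaps for arbitrarily large
  \<open>y\<close>. By symmetry \<open>M\<close> has a critical point in each gap, where its restriction to the gap is maximal,
  and by scale invariance of \<open>\<Omega>\<close> and Harnack's inequality its hyperbolic distance from that circle is
  bounded independently of \<open>n\<close>.
\<close>

section \<open>Harmonic functions as real parts\<close>

text \<open>Hyperbolic distance never appears as such. It is replaced by Harnack chains of discs
  lifted through \<open>p\<close>: the endpoint of a lifted chain serves all positive harmonic
  functions at once. Among them is the height \<open>Im z\<close>, which is what makes
  \<open>y\<close> comparable to the height of the critical point.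

  Subharmonicity is defined by holomorphic functions whose real parts lie below \<open>u\<close> and
  nearly touch it. A supremum over fibres fits this form directly, and Harnack's inequality yields
  the maximum principle without integration.

  The delicate point in the gap argument is uniformity in \<open>n\<close>: the maximum over a gap
  must stay away from the ends by an amount proportional to the gap's length. Both ends border a
  band of \<open>E\<close>, and \<open>l * b < a\<close> gives these bands positive length; a
  fourth-root barrier on the slit then pushes the Martin function near the ends below its value at
  the midpoint.

  Singularity is read off from Hahn decompositions against small multiples of Lebesgue measure on
  growing intervals.\<close>

lemma mixed_partials_eq:
  fixes u ux uy :: "complex \<Rightarrow> real"
  assumes "open S" "z \<in> S"
    and u: "\<And>w. w \<in> S \<Longrightarrow> (u has_derivative (\<lambda>h. ux w * Re h + uy w * Im h)) (at w)"
    and ux: "(ux has_derivative (\<lambda>h. a * Re h + b * Im h)) (at z)"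
    and uy: "(uy has_derivative (\<lambda>h. c * Re h + d * Im h)) (at z)"
  shows "b = c"
proof -
  have "\<bar>b - c\<bar> \<le> e" if "0 < e" for e
  proof -
    \<comment> \<open>Error budget: points of the square have norm at most \<open>2 * t\<close>,
      edge points at most \<open>t\<close>, so each mean value costs
      \<open>e / 3 * t + e / 6 * t\<close>, which is half of \<open>e * t\<close>.\<close>
    have e6: "0 < e / 6" using that by simp
    obtain d1 where d1: "0 < d1"
      "\<And>y. norm (y - z) < d1 \<Longrightarrow>
         norm (ux y - ux z - (a * Re (y - z) + b * Im (y - z))) \<le> e / 6 * norm (y - z)"
      using ux e6 unfolding has_derivative_at_alt by blast
    obtain d2 where d2: "0 < d2"
      "\<And>y. norm (y - z) < d2 \<Longrightarrow>
         norm (uy y - uy z - (c * Re (y - z) + d * Im (y - z))) \<le> e / 6 * norm (y - z)"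
      using uy e6 unfolding has_derivative_at_alt by blast
    obtain d3 where d3: "0 < d3" "ball z d3 \<subseteq> S"
      using assms(1,2) by (meson openE)
    define t where "t = min d1 (min d2 d3) / 3"
    have t: "0 < t" "2 * t < d1" "2 * t < d2" "2 * t < d3"
      using d1(1) d2(1) d3(1) by (auto simp: t_def min_def)
    have nrm: "norm (Complex x y) \<le> 2 * t" if "0 \<le> x" "x \<le> t" "0 \<le> y" "y \<le> t" for x y
    proof -
      have "norm (Complex x y) \<le> \<bar>x\<bar> + \<bar>y\<bar>"
        using complex_norm[of x y] sqrt_sum_squares_le_sum_abs[of x y] by simp
      then show ?thesis using that by simp
    qed
    have inS: "z + Complex x y \<in> S" if "0 \<le> x" "x \<le> t" "0 \<le> y" "y \<le> t" for x y
      using nrm[OF that] t(4) d3(2) by (auto simp: dist_norm)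
    \<comment> \<open>Second difference of \<open>u\<close> over a square of side \<open>t\<close>.
      Grouped in two ways, the mean value theorem turns it into an increment of \<open>ux\<close> or
      of \<open>uy\<close>; divided by \<open>t^2\<close> these approach \<open>b\<close> and
      \<open>c\<close>.\<close>
    define \<Delta> where "\<Delta> = u (z + Complex t t) - u (z + Complex t 0) - u (z + Complex 0 t) + u z"
    have zero: "z + Complex 0 0 = z" by (simp add: complex_eq_iff)
    have Delta:
      "(u (z + Complex t t) - u (z + Complex t 0)) - (u (z + Complex 0 t) - u (z + Complex 0 0)) = \<Delta>"
      "(u (z + Complex t t) - u (z + Complex 0 t)) - (u (z + Complex t 0) - u (z + Complex 0 0)) = \<Delta>"
      unfolding zero by (simp_all add: \<Delta>_def)
    have gx: "((\<lambda>s. u (z + Complex s y)) has_real_derivative ux (z + Complex s y)) (at s)"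
      if "0 \<le> s" "s \<le> t" "0 \<le> y" "y \<le> t" for s y
    proof -
      have "((\<lambda>s. z + of_real s + Complex 0 y) has_derivative (\<lambda>s. of_real s)) (at s)"
        by (auto intro!: derivative_eq_intros)
      moreover have "(\<lambda>s. z + of_real s + Complex 0 y) = (\<lambda>s. z + Complex s y)"
        by (auto simp: complex_eq_iff)
      ultimately have "((\<lambda>s. z + Complex s y) has_derivative (\<lambda>s. of_real s)) (at s)" by simp
      from has_derivative_compose[OF this u[OF inS[OF that]]]
      show ?thesis by (simp add: has_field_derivative_def)
    qed
    have gy: "((\<lambda>s. u (z + Complex x s)) has_real_derivative uy (z + Complex x s)) (at s)"
      if "0 \<le> x" "x \<le> t" "0 \<le> s" "s \<le> t" for s x
    proof -
      have "((\<lambda>s. z + of_real s * \<i> + Complex x 0) has_derivative (\<lambda>s. of_real s * \<i>)) (at s)"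
        by (auto intro!: derivative_eq_intros)
      moreover have "(\<lambda>s. z + of_real s * \<i> + Complex x 0) = (\<lambda>s. z + Complex x s)"
        by (auto simp: complex_eq_iff)
      ultimately have "((\<lambda>s. z + Complex x s) has_derivative (\<lambda>s. of_real s * \<i>)) (at s)" by simp
      from has_derivative_compose[OF this u[OF inS[OF that]]]
      show ?thesis by (simp add: has_field_derivative_def)
    qed
    have "\<exists>s. 0 < s \<and> s < t \<and>
       (u (z + Complex t t) - u (z + Complex t 0)) - (u (z + Complex 0 t) - u (z + Complex 0 0))
         = (t - 0) * (ux (z + Complex s t) - ux (z + Complex s 0))"
      by (rule MVT2) (use t in \<open>auto intro!: derivative_eq_intros gx\<close>)
    then obtain s where s: "0 < s" "s < t" "\<Delta> = t * (ux (z + Complex s t) - ux (z + Complex s 0))"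
      using Delta by auto
    have "\<exists>s. 0 < s \<and> s < t \<and>
       (u (z + Complex t t) - u (z + Complex 0 t)) - (u (z + Complex t 0) - u (z + Complex 0 0))
         = (t - 0) * (uy (z + Complex t s) - uy (z + Complex 0 s))"
      by (rule MVT2) (use t in \<open>auto intro!: derivative_eq_intros gy\<close>)
    then obtain s' where s': "0 < s'" "s' < t" "\<Delta> = t * (uy (z + Complex t s') - uy (z + Complex 0 s'))"
      using Delta by auto
    have A: "\<bar>ux (z + Complex x y) - ux z - (a * x + b * y)\<bar> \<le> e / 6 * norm (Complex x y)"
      if "0 \<le> x" "x \<le> t" "0 \<le> y" "y \<le> t" for x y
      using d1(2)[of "z + Complex x y"] nrm[OF that] t by simp
    have B: "\<bar>uy (z + Complex x y) - uy z - (c * x + d * y)\<bar> \<le> e / 6 * norm (Complex x y)"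
      if "0 \<le> x" "x \<le> t" "0 \<le> y" "y \<le> t" for x y
      using d2(2)[of "z + Complex x y"] nrm[OF that] t by simp
    have n1: "norm (Complex x 0) \<le> t" "norm (Complex 0 x) \<le> t" if "0 \<le> x" "x \<le> t" for x
      using that by (simp_all add: complex_norm)
    have "\<bar>ux (z + Complex s t) - ux z - (a * s + b * t)\<bar> \<le> e / 6 * (2 * t)"
      by (rule order_trans[OF A mult_left_mono[OF nrm]]) (use s t e6 in auto)
    moreover have "\<bar>ux (z + Complex s 0) - ux z - (a * s + b * 0)\<bar> \<le> e / 6 * t"
      by (rule order_trans[OF A mult_left_mono[OF order_trans[OF n1(1)]]]) (use s t e6 in auto)
    ultimately have 1: "\<bar>(ux (z + Complex s t) - ux (z + Complex s 0)) - b * t\<bar> \<le> e / 2 * t"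
      by linarith
    have "\<bar>uy (z + Complex t s') - uy z - (c * t + d * s')\<bar> \<le> e / 6 * (2 * t)"
      by (rule order_trans[OF B mult_left_mono[OF nrm]]) (use s' t e6 in auto)
    moreover have "\<bar>uy (z + Complex 0 s') - uy z - (c * 0 + d * s')\<bar> \<le> e / 6 * t"
      by (rule order_trans[OF B mult_left_mono[OF order_trans[OF n1(2)]]]) (use s' t e6 in auto)
    ultimately have 2: "\<bar>(uy (z + Complex t s') - uy (z + Complex 0 s')) - c * t\<bar> \<le> e / 2 * t"
      by linarith
    have "ux (z + Complex s t) - ux (z + Complex s 0) = uy (z + Complex t s') - uy (z + Complex 0 s')"
      using s(3) s'(3) t(1) by simp
    with 1 2 have "\<bar>b * t - c * t\<bar> \<le> e * t" by linarith
    then have "\<bar>b - c\<bar> * t \<le> e * t" using t(1) by (simp add: abs_mult flip: left_diff_distrib)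
    then show ?thesis using t(1) by simp
  qed
  then have "\<bar>b - c\<bar> \<le> 0 + e" if "0 < e" for e using that by simp
  then have "\<bar>b - c\<bar> \<le> 0" by (rule field_le_epsilon)
  then show ?thesis by simp
qed

text \<open>\<open>g = ux - \<i> * uy\<close> is single valued even where \<open>u\<close> is not
  globally a real part. Its Cauchy-Riemann equations are the symmetry of the mixed partials and the
  Laplace equation.\<close>

lemma harmonic_holomorphic_gradient:
  assumes "harmonic_on u S"
  obtains g where "g holomorphic_on S"
    and "\<And>z. z \<in> S \<Longrightarrow> (u has_derivative (\<lambda>h. Re (g z * h))) (at z)"
proof -
  have "open S" using assms by (simp add: harmonic_on_def)
  obtain ux uy uxx uxy uyx uyy :: "complex \<Rightarrow> real" where
    D: "\<forall>z\<in>S. (u has_derivative (\<lambda>h. ux z * Re h + uy z * Im h)) (at z) \<and>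
       (ux has_derivative (\<lambda>h. uxx z * Re h + uxy z * Im h)) (at z) \<and>
       (uy has_derivative (\<lambda>h. uyx z * Re h + uyy z * Im h)) (at z) \<and> uxx z + uyy z = 0"
    using assms unfolding harmonic_on_def by (elim conjE exE) (rule that)
  note D = D[rule_format, THEN conjunct1] D[rule_format, THEN conjunct2, THEN conjunct1]
    D[rule_format, THEN conjunct2, THEN conjunct2, THEN conjunct1]
    D[rule_format, THEN conjunct2, THEN conjunct2, THEN conjunct2]
  have sym: "uxy z = uyx z" if "z \<in> S" for z
    by (rule mixed_partials_eq[OF \<open>open S\<close> that D(1) D(2)[OF that] D(3)[OF that]])
  have yy: "uyy z = - uxx z" if "z \<in> S" for z
    using D(4)[OF that] by simp
  define g where "g z = of_real (ux z) - \<i> * of_real (uy z)" for z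
  have "(g has_field_derivative (of_real (uxx z) - \<i> * of_real (uxy z))) (at z)" if "z \<in> S" for z
    unfolding has_field_derivative_def g_def
    by (rule derivative_eq_intros D(2)[OF that] D(3)[OF that] refl)+
       (use sym[OF that] in \<open>auto simp: complex_eq_iff fun_eq_iff yy[OF that] algebra_simps\<close>)
  then have "g holomorphic_on S"
    using \<open>open S\<close> holomorphic_on_open by blast
  moreover have "(u has_derivative (\<lambda>h. Re (g z * h))) (at z)" if "z \<in> S" for z
    using D(1)[OF that] by (simp add: g_def)
  ultimately show ?thesis using that by blast
qed

lemma real_part_primitive:
  fixes u :: "complex \<Rightarrow> real"
  assumes "open S" "convex S" "g holomorphic_on S"
    and u: "\<And>z. z \<in> S \<Longrightarrow> (u has_derivative (\<lambda>h. Re (g z * h))) (at z)"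
  obtains F where "\<And>z. z \<in> S \<Longrightarrow> (F has_field_derivative g z) (at z)"
    and "\<And>z. z \<in> S \<Longrightarrow> u z = Re (F z)"
proof -
  obtain G where G: "\<And>z. z \<in> S \<Longrightarrow> (G has_field_derivative g z) (at z)"
    using holomorphic_convex_primitive'[OF assms(2,1,3)] assms(1)
    by (metis at_within_open)
  have d0: "((\<lambda>z. u z - Re (G z)) has_derivative (\<lambda>h. 0)) (at z within S)" if "z \<in> S" for z
  proof -
    have "((\<lambda>z. Re (G z)) has_derivative (\<lambda>h. Re (g z * h))) (at z)"
      using G[OF that] unfolding has_field_derivative_def
      by (rule has_derivative_Re)
    then have "((\<lambda>z. u z - Re (G z)) has_derivative (\<lambda>h. Re (g z * h) - Re (g z * h))) (at z)"
      using u[OF that] by (intro has_derivative_diff)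
    then show ?thesis using has_derivative_at_withinI by fastforce
  qed
  obtain c where c: "\<And>z. z \<in> S \<Longrightarrow> u z - Re (G z) = c"
    using has_derivative_zero_constant[OF assms(2) d0] by metis
  show ?thesis
  proof (rule that[of "\<lambda>z. G z + of_real c"])
    show "((\<lambda>z. G z + of_real c) has_field_derivative g z) (at z)" if "z \<in> S" for z
      using G[OF that] by (auto intro!: derivative_eq_intros)
  qed (use c in force)
qed

section \<open>Harnack inequalities on discs via the Schwarz lemma\<close>

lemma harnack_ball:
  assumes F: "F holomorphic_on ball a r" and pos: "\<And>w. w \<in> ball a r \<Longrightarrow> 0 \<le> Re (F w)"
    and w: "w \<in> ball a r"
  shows "norm (F w - F a) * (1 - dist a w / r) \<le> 2 * (dist a w / r) * Re (F a)"
proof -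
  have r: "0 < r" using w by (metis dist_not_less_zero mem_ball le_less_trans not_le)
  define \<rho> where "\<rho> = dist a w / r"
  have \<rho>: "0 \<le> \<rho>" "\<rho> < 1" using w r by (auto simp: \<rho>_def)
  have "norm (F w - F a) * (1 - \<rho>) \<le> 2 * \<rho> * Re (F a) + e" if "0 < e" for e
  proof -
    \<comment> \<open>The shift makes the real part strictly positive, so the denominator of
      \<open>\<phi>\<close> below cannot vanish; \<open>e\<close> disappears at the end through
      \<open>field_le_epsilon\<close>.\<close>
    define G where "G w = F w + of_real (e / 2)" for w
    have G0: "0 < Re (G w)" if "w \<in> ball a r" for w
      using pos[OF that] \<open>0 < e\<close> by (simp add: G_def)
    have a: "a \<in> ball a r" using r by simp
    have img: "a + of_real r * x \<in> ball a r" if "x \<in> ball 0 1" for x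
      using that r by (simp add: dist_norm norm_mult)
    have ne: "G x + cnj (G a) \<noteq> 0" if "x \<in> ball a r" for x
      using G0[OF that] G0[OF a] by (auto simp: complex_eq_iff)
    \<comment> \<open>A Cayley transform of the right half-plane centred at \<open>G a\<close>, with
      the ball rescaled to the unit disc: \<open>\<phi>\<close> fixes 0 and maps the disc into
      itself, as Schwarz's lemma requires.\<close>
    define \<phi> where "\<phi> x = (G (a + of_real r * x) - G a) / (G (a + of_real r * x) + cnj (G a))" for x
    have "(\<lambda>x. F (a + of_real r * x)) holomorphic_on ball 0 1"
      by (rule holomorphic_on_compose_gen[of "\<lambda>x. a + of_real r * x" _ F "ball a r", unfolded o_def])
         (use F img in \<open>auto intro!: holomorphic_intros\<close>)
    then have "\<phi> holomorphic_on ball 0 1"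
      unfolding \<phi>_def using ne img by (auto intro!: holomorphic_intros simp: G_def)
    moreover have "\<phi> 0 = 0" by (simp add: \<phi>_def)
    moreover have "norm (\<phi> x) < 1" if "norm x < 1" for x
    proof -
      define A where "A = G (a + of_real r * x)"
      have x: "a + of_real r * x \<in> ball a r" using img that by simp
      have "(norm (A - G a))\<^sup>2 < (norm (A + cnj (G a)))\<^sup>2"
        using G0[OF x] G0[OF a] mult_pos_pos[OF G0[OF x] G0[OF a]]
        unfolding A_def[symmetric] cmod_power2 by (simp add: power2_eq_square algebra_simps)
      then have "norm (A - G a) < norm (A + cnj (G a))"
        using power2_less_imp_less norm_ge_zero by blast
      then show ?thesis using ne[OF x] by (simp add: \<phi>_def A_def norm_divide)
    qed
    moreover have "norm ((w - a) / of_real r) < 1"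
      using w r by (simp add: norm_divide dist_norm norm_minus_commute)
    ultimately have "norm (\<phi> ((w - a) / of_real r)) \<le> norm ((w - a) / of_real r)"
      by (rule Schwarz_Lemma(1))
    then have "norm ((G w - G a) / (G w + cnj (G a))) \<le> \<rho>"
      using r by (simp add: \<phi>_def \<rho>_def norm_divide dist_norm norm_minus_commute)
    then have "norm (G w - G a) \<le> \<rho> * norm (G w + cnj (G a))"
      using ne[OF w] by (simp add: norm_divide divide_simps)
    also have "G w + cnj (G a) = (G w - G a) + of_real (2 * Re (G a))"
      by (simp add: complex_eq_iff)
    also have "norm \<dots> \<le> norm (G w - G a) + 2 * Re (G a)"
      using norm_triangle_ineq[of "G w - G a" "of_real (2 * Re (G a))"] G0[OF a] by simp
    finally have "norm (G w - G a) \<le> \<rho> * (norm (G w - G a) + 2 * Re (G a))"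
      using \<rho> mult_left_mono by fastforce
    moreover have "G w - G a = F w - F a" by (simp add: G_def)
    ultimately have "norm (F w - F a) * (1 - \<rho>) \<le> \<rho> * (2 * Re (G a))"
      by (simp add: algebra_simps)
    also have "\<dots> = 2 * \<rho> * Re (F a) + \<rho> * e" by (simp add: G_def algebra_simps)
    also have "\<dots> \<le> 2 * \<rho> * Re (F a) + e" using \<rho> \<open>0 < e\<close> by simp
    finally show ?thesis .
  qed
  then show ?thesis unfolding \<rho>_def[symmetric] by (rule field_le_epsilon)
qed

text \<open>At the radius fraction 1/5 the factor \<open>2 * \<rho> / (1 - \<rho>)\<close> is 1/2,
  so the real part changes by at most half. This is one link of a Harnack chain.\<close>

lemma harnack_ball_le:
  assumes F: "F holomorphic_on ball a r" and pos: "\<And>w. w \<in> ball a r \<Longrightarrow> 0 \<le> Re (F w)"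
    and "0 < r" and w: "dist a w \<le> r / 5"
  shows "Re (F w) \<le> 2 * Re (F a)" "Re (F a) \<le> 2 * Re (F w)"
proof -
  define \<rho> where "\<rho> = dist a w / r"
  have wb: "w \<in> ball a r" using w \<open>0 < r\<close> by simp
  have \<rho>: "0 \<le> \<rho>" "\<rho> \<le> 1/5" using w \<open>0 < r\<close> by (auto simp: \<rho>_def field_simps)
  have "norm (F w - F a) * (1 - \<rho>) \<le> 2 * \<rho> * Re (F a)"
    unfolding \<rho>_def by (rule harnack_ball[OF F pos wb])
  moreover have "norm (F w - F a) * (4/5) \<le> norm (F w - F a) * (1 - \<rho>)"
    by (rule mult_left_mono) (use \<rho> in auto)
  moreover have "2 * \<rho> * Re (F a) \<le> 2 * (1/5) * Re (F a)"
    by (rule mult_right_mono) (use \<rho> pos[of a] \<open>0 < r\<close> in auto)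
  ultimately have "norm (F w - F a) \<le> Re (F a) / 2" by simp
  then have "\<bar>Re (F w) - Re (F a)\<bar> \<le> Re (F a) / 2"
    using abs_Re_le_cmod[of "F w - F a"] by simp
  then show "Re (F w) \<le> 2 * Re (F a)" "Re (F a) \<le> 2 * Re (F w)" by linarith+
qed

lemma harnack_ball_diff:
  assumes F: "F holomorphic_on ball a r" and pos: "\<And>w. w \<in> ball a r \<Longrightarrow> 0 \<le> Re (F w)"
    and "0 < r" and w: "dist a w \<le> r / 2"
  shows "norm (F w - F a) \<le> 4 * (dist a w / r) * Re (F a)"
proof -
  define \<rho> where "\<rho> = dist a w / r"
  have wb: "w \<in> ball a r" using w \<open>0 < r\<close> by simp
  have \<rho>: "0 \<le> \<rho>" "\<rho> \<le> 1/2" using w \<open>0 < r\<close> by (auto simp: \<rho>_def field_simps)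
  have "norm (F w - F a) * (1 - \<rho>) \<le> 2 * \<rho> * Re (F a)"
    unfolding \<rho>_def by (rule harnack_ball[OF F pos wb])
  moreover have "norm (F w - F a) * (1/2) \<le> norm (F w - F a) * (1 - \<rho>)"
    by (rule mult_left_mono) (use \<rho> in auto)
  ultimately show ?thesis unfolding \<rho>_def[symmetric] by simp
qed

text \<open>Gradient bound for positive harmonic functions, obtained by letting \<open>w\<close>
  tend to \<open>a\<close> in \<open>harnack_ball_diff\<close>. It makes a small value of
  \<open>Re F\<close> incompatible with a large derivative.\<close>

lemma harnack_deriv:
  assumes F: "F holomorphic_on ball a r" and pos: "\<And>w. w \<in> ball a r \<Longrightarrow> 0 \<le> Re (F w)"
    and "0 < r" and D: "(F has_field_derivative D) (at a)"
  shows "norm D \<le> 4 * Re (F a) / r"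
proof -
  have lim: "((\<lambda>w. norm ((F w - F a) / (w - a))) \<longlongrightarrow> norm D) (at a)"
    using D by (intro tendsto_norm) (simp add: has_field_derivative_iff)
  have "eventually (\<lambda>w. w \<in> ball a (r/2)) (at a)"
    by (rule eventually_at_in_open') (use \<open>0 < r\<close> in auto)
  moreover have "eventually (\<lambda>w. w \<noteq> a) (at a)"
    by (simp add: eventually_neq_at_within)
  ultimately have ev: "eventually (\<lambda>w. norm ((F w - F a) / (w - a)) \<le> 4 * Re (F a) / r) (at a)"
  proof eventually_elim
    case (elim w)
    have "norm (F w - F a) \<le> 4 * (dist a w / r) * Re (F a)"
      by (rule harnack_ball_diff[OF F pos \<open>0 < r\<close>]) (use elim in auto)
    then show ?case using elim \<open>0 < r\<close>
      by (simp add: norm_divide dist_norm norm_minus_commute field_simps)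
  qed
  show ?thesis by (rule tendsto_upperbound[OF lim ev]) simp
qed

section \<open>Subharmonic functions\<close>

text \<open>The radius \<open>r\<close> is common to all \<open>d\<close>: this lets Harnack's
  inequality act on a fixed ball while \<open>d\<close> tends to 0.\<close>

definition subharmonic_at :: "(complex \<Rightarrow> real) \<Rightarrow> complex \<Rightarrow> bool" where
  "subharmonic_at u a \<longleftrightarrow> (\<exists>r>0. \<forall>d>0. \<exists>F. F holomorphic_on ball a r \<and>
     (\<forall>w\<in>ball a r. Re (F w) \<le> u w) \<and> u a - d \<le> Re (F a))"

lemma subharmonic_at_diff:
  assumes "subharmonic_at u a" and "0 < s" and L: "L holomorphic_on ball a s"
    and k: "\<And>w. w \<in> ball a s \<Longrightarrow> k w = Re (L w)"
  shows "subharmonic_at (\<lambda>w. u w - k w) a"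
proof -
  obtain r where r: "0 < r" and F: "\<And>d. 0 < d \<Longrightarrow> \<exists>F. F holomorphic_on ball a r \<and>
     (\<forall>w\<in>ball a r. Re (F w) \<le> u w) \<and> u a - d \<le> Re (F a)"
    using assms(1) unfolding subharmonic_at_def by blast
  have sub: "ball a (min r s) \<subseteq> ball a r" "ball a (min r s) \<subseteq> ball a s" by auto
  show ?thesis unfolding subharmonic_at_def
  proof (intro exI[of _ "min r s"] conjI allI impI)
    show "0 < min r s" using r \<open>0 < s\<close> by simp
    fix d :: real assume "0 < d"
    then obtain F where F: "F holomorphic_on ball a r" "\<forall>w\<in>ball a r. Re (F w) \<le> u w"
      "u a - d \<le> Re (F a)" using F by blast
    show "\<exists>F. F holomorphic_on ball a (min r s) \<and>
      (\<forall>w\<in>ball a (min r s). Re (F w) \<le> u w - k w) \<and> u a - k a - d \<le> Re (F a)"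
    proof (intro exI[of _ "\<lambda>w. F w - L w"] conjI ballI)
      show "(\<lambda>w. F w - L w) holomorphic_on ball a (min r s)"
        using F(1) L sub by (intro holomorphic_intros) (auto intro: holomorphic_on_subset)
      show "Re (F w - L w) \<le> u w - k w" if "w \<in> ball a (min r s)" for w
        using F(2) k[of w] that by auto
      show "u a - k a - d \<le> Re (F a - L a)" using F(3) k[of a] \<open>0 < s\<close> by simp
    qed
  qed
qed

lemma subharmonic_at_zero:
  assumes "u a = 0" "\<And>w. 0 \<le> u w"
  shows "subharmonic_at u a"
  unfolding subharmonic_at_def
  by (intro exI[of _ 1] conjI allI impI exI[of _ "\<lambda>_. 0"]) (use assms in auto)

text \<open>The bound \<open>u \<le> u a\<close> makes \<open>u a - Re F\<close> a positive harmonic function that is small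
  at \<open>a\<close>, so Harnack's inequality replaces the mean value property.\<close>

lemma subharmonic_at_local_max:
  assumes "subharmonic_at u a" "0 < s" and max: "\<And>w. w \<in> ball a s \<Longrightarrow> u w \<le> u a"
  shows "\<exists>r>0. \<forall>w\<in>ball a r. u w = u a"
proof -
  obtain r where r: "0 < r" and F: "\<And>d. 0 < d \<Longrightarrow> \<exists>F. F holomorphic_on ball a r \<and>
     (\<forall>w\<in>ball a r. Re (F w) \<le> u w) \<and> u a - d \<le> Re (F a)"
    using assms(1) unfolding subharmonic_at_def by blast
  define t where "t = min r s"
  have t: "0 < t" using r \<open>0 < s\<close> by (simp add: t_def)
  have const: "u w = u a" if w: "w \<in> ball a (t / 5)" for w
  proof -
    have "u a \<le> u w + d" if "0 < d" for d
    proof -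
      obtain F where F: "F holomorphic_on ball a r" "\<forall>w\<in>ball a r. Re (F w) \<le> u w"
        "u a - d / 2 \<le> Re (F a)" using F[of "d/2"] \<open>0 < d\<close> by auto
      have "Re (of_real (u a) - F w) \<le> 2 * Re (of_real (u a) - F a)"
      proof (rule harnack_ball_le(1)[OF _ _ t, where F = "\<lambda>w. of_real (u a) - F w"])
        show "(\<lambda>w. of_real (u a) - F w) holomorphic_on ball a t"
          by (intro holomorphic_intros holomorphic_on_subset[OF F(1)]) (auto simp: t_def)
        show "0 \<le> Re (of_real (u a) - F w)" if "w \<in> ball a t" for w
          using F(2) max[of w] that by (force simp: t_def)
      qed (use w in auto)
      moreover have "Re (F w) \<le> u w"
        using F(2) w t by (force simp: t_def)
      ultimately show ?thesis using F(3) by simp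
    qed
    then have "u a \<le> u w" by (rule field_le_epsilon)
    moreover have "u w \<le> u a" using max[of w] w t by (auto simp: t_def)
    ultimately show ?thesis by simp
  qed
  have "0 < t / 5" using t by simp
  with const show ?thesis by blast
qed

text \<open>If the maximum exceeded \<open>m\<close>, the points attaining it would avoid the
  frontier; they form a closed set that is open by \<open>subharmonic_at_local_max\<close>, and a
  bounded non-empty set is never clopen in the plane.\<close>

lemma subharmonic_max_principle:
  assumes U: "open U" "bounded U" and u: "continuous_on (closure U) u"
    and sub: "\<And>w. w \<in> U \<Longrightarrow> subharmonic_at u w"
    and fr: "\<And>w. w \<in> frontier U \<Longrightarrow> u w \<le> m"
    and "w \<in> U"
  shows "u w \<le> m"
proof (rule ccontr)
  assume "\<not> u w \<le> m"
  have cpt: "compact (closure U)" using U(2) by (simp add: compact_closure)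
  have "closure U \<noteq> {}" using \<open>w \<in> U\<close> closure_subset by auto
  then obtain x where x: "x \<in> closure U" "\<And>y. y \<in> closure U \<Longrightarrow> u y \<le> u x"
    using continuous_attains_sup[OF cpt _ u] by blast
  have big: "m < u x" using x(2)[of w] \<open>w \<in> U\<close> \<open>\<not> u w \<le> m\<close> closure_subset by fastforce
  define K where "K = {y \<in> closure U. u y = u x}"
  have clU: "closure U = U \<union> frontier U"
    using U(1) by (simp add: closure_Un_frontier)
  have KU: "K \<subseteq> U" using fr big by (force simp: K_def clU)
  have "closed K"
    unfolding K_def by (rule continuous_closed_preimage_constant[OF u]) simp
  moreover have "open K"
    unfolding open_contains_ball
  proof
    fix y assume y: "y \<in> K"
    then have yU: "y \<in> U" using KU by auto
    then obtain s where s: "0 < s" "ball y s \<subseteq> U" using U(1) by (meson openE)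
    have "\<exists>r>0. \<forall>w\<in>ball y r. u w = u y"
    proof (rule subharmonic_at_local_max[OF sub[OF yU] s(1)])
      show "u w \<le> u y" if "w \<in> ball y s" for w
      proof -
        have "w \<in> closure U" using that s(2) closure_subset by blast
        then show ?thesis using x(2)[of w] y by (simp add: K_def)
      qed
    qed
    then obtain r where r: "0 < r" "\<And>w. w \<in> ball y r \<Longrightarrow> u w = u y" by blast
    have "ball y (min r s) \<subseteq> K"
    proof
      fix w assume w: "w \<in> ball y (min r s)"
      then have "w \<in> U" using s(2) by auto
      then have "w \<in> closure U" using closure_subset by blast
      then show "w \<in> K" using r(2)[of w] w y by (simp add: K_def)
    qed
    then show "\<exists>e>0. ball y e \<subseteq> K" using r(1) s(1) by (intro exI[of _ "min r s"]) auto
  qed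
  moreover have "x \<in> K" using x(1) by (simp add: K_def)
  ultimately have "K = UNIV" using clopen by blast
  then show False using KU U(2) not_bounded_UNIV bounded_subset by blast
qed

text \<open>Near \<open>a\<close> the logarithm is the real part of
  \<open>Ln (w / a) + Ln a\<close>: division by \<open>a\<close> moves the ball of radius
  \<open>norm a\<close> to the unit ball about 1, which misses the branch cut.\<close>

lemma subharmonic_at_diff_ln:
  assumes "subharmonic_at u a" "a \<noteq> 0"
  shows "subharmonic_at (\<lambda>w. u w - e * ln (norm w)) a"
proof (rule subharmonic_at_diff[OF assms(1), of "norm a" "\<lambda>w. of_real e * (Ln (w / a) + Ln a)"])
  have pos: "0 < Re (w / a)" if "w \<in> ball a (norm a)" for w
  proof -
    have "norm (w / a - 1) < 1"
    proof -
      have "w / a - 1 = (w - a) / a" using assms(2) by (simp add: field_simps)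
      then show ?thesis using that assms(2) by (simp add: norm_divide dist_norm norm_minus_commute)
    qed
    then have "\<bar>Re (w / a - 1)\<bar> < 1" using abs_Re_le_cmod le_less_trans by blast
    then show ?thesis by simp
  qed
  then show "(\<lambda>w. of_real e * (Ln (w / a) + Ln a)) holomorphic_on ball a (norm a)"
    by (intro holomorphic_intros) (use assms(2) in \<open>auto simp: complex_nonpos_Reals_iff not_le dest: pos\<close>)
  show "e * ln (norm w) = Re (of_real e * (Ln (w / a) + Ln a))" if "w \<in> ball a (norm a)" for w
  proof -
    have "w / a \<noteq> 0" using pos[OF that] by auto
    then have w: "w \<noteq> 0" by auto
    have "Re (Ln (w / a) + Ln a) = ln (norm w)"
      using w assms(2) by (simp add: norm_divide ln_div)
    then show ?thesis by simp
  qed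
qed (use assms in auto)

text \<open>Any small multiple of the harmonic function \<open>ln (norm w)\<close> beats the bound
  \<open>B\<close> on large circles. Letting the multiple tend to 0 makes the maximum over the unit
  disc global, and an attained global maximum spreads by the clopen argument.\<close>

lemma subharmonic_liouville:
  assumes u: "continuous_on UNIV u" and sub: "\<And>w. subharmonic_at u w"
    and bdd: "\<And>w. u w \<le> B"
  shows "u w = u v"
proof -
  have "continuous_on (cball 0 1) u" using u continuous_on_subset by blast
  then obtain x where x: "x \<in> cball 0 1" "\<And>y. y \<in> cball 0 1 \<Longrightarrow> u y \<le> u x"
    using continuous_attains_sup[of "cball (0::complex) 1" u] by auto
  have le: "u w \<le> u x" for w
  proof (cases "norm w \<le> 1")
    case True then show ?thesis using x(2) by simp
  next
    case False
    have step: "u w \<le> u x + e * ln (norm w)" if "0 < e" for e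
    proof -
      \<comment> \<open>Large enough that \<open>e * ln R\<close> is at least \<open>B - u x\<close>
        on the outer circle; on the inner circle the logarithm vanishes.\<close>
      define R where "R = max (norm w + 1) (exp ((B - u x) / e))"
      have R: "norm w < R" "exp ((B - u x) / e) \<le> R" by (auto simp: R_def)
      have R1: "1 < R" using R(1) False by simp
      define U where "U = ball (0::complex) R - cball 0 1"
      have "open U" by (simp add: U_def open_Diff)
      have cl: "closure U \<subseteq> cball 0 R - ball 0 1"
        by (rule closure_minimal) (auto simp: U_def closed_Diff)
      have fr: "frontier U \<subseteq> sphere 0 R \<union> sphere 0 1"
        using cl interior_open[OF \<open>open U\<close>] by (auto simp: frontier_def U_def)
      have "u w - e * ln (norm w) \<le> u x"
      proof (rule subharmonic_max_principle[OF \<open>open U\<close>, where u = "\<lambda>w. u w - e * ln (norm w)"])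
        show "bounded U" by (simp add: U_def bounded_diff)
        show "continuous_on (closure U) (\<lambda>w. u w - e * ln (norm w))"
          using cl by (intro continuous_intros continuous_on_subset[OF u]) auto
        show "subharmonic_at (\<lambda>w. u w - e * ln (norm w)) w" if "w \<in> U" for w
          by (rule subharmonic_at_diff_ln[OF sub]) (use that in \<open>auto simp: U_def\<close>)
        show "w \<in> U" using R(1) False by (simp add: U_def)
        show "u y - e * ln (norm y) \<le> u x" if "y \<in> frontier U" for y
        proof (cases "norm y = 1")
          case True then show ?thesis using x(2)[of y] by simp
        next
          case False
          then have y: "norm y = R" using that fr by auto
          have "(B - u x) / e \<le> ln R"
            using R(2) R1 by (simp add: ln_ge_iff)
          then have "B - u x \<le> e * ln R" using \<open>0 < e\<close> by (simp add: field_simps)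
          then show ?thesis using y bdd[of y] by simp
        qed
      qed
      then show ?thesis by simp
    qed
    have lnw: "0 < ln (norm w)" using False using ln_gt_zero[of "norm w"] by simp
    show ?thesis
    proof (rule field_le_epsilon)
      fix e :: real assume "0 < e"
      then show "u w \<le> u x + e" using step[of "e / ln (norm w)"] lnw by simp
    qed
  qed
  define K where "K = {y. u y = u x}"
  have "closed K"
    using continuous_closed_preimage_constant[OF u, of "u x"] by (simp add: K_def)
  moreover have "open K"
    unfolding open_contains_ball
  proof
    fix y assume "y \<in> K"
    then have y: "u y = u x" by (simp add: K_def)
    have "\<exists>r>0. \<forall>w\<in>ball y r. u w = u y"
      by (rule subharmonic_at_local_max[OF sub, of 1]) (simp_all add: y le)
    then obtain r where "0 < r" "\<forall>w\<in>ball y r. u w = u y" by blast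
    then show "\<exists>e>0. ball y e \<subseteq> K" using y by (intro exI[of _ r]) (auto simp: K_def)
  qed
  moreover have "x \<in> K" by (simp add: K_def)
  ultimately have "K = UNIV" using clopen by blast
  then show ?thesis unfolding K_def by (metis (mono_tags) UNIV_I mem_Collect_eq)
qed

section \<open>Lifting discs through a covering\<close>

lemma open_upper_half_plane: "open upper_half_plane"
  unfolding upper_half_plane_def by (rule open_halfspace_Im_gt)

lemma convex_upper_half_plane: "convex upper_half_plane"
  unfolding upper_half_plane_def by (rule convex_halfspace_Im_gt)

lemma holomorphic_on_comp:
  assumes "f holomorphic_on A" "g holomorphic_on B" "\<And>x. x \<in> A \<Longrightarrow> f x \<in> B"
  shows "(\<lambda>x. g (f x)) holomorphic_on A"
proof -
  have "f ` A \<subseteq> B" using assms(3) by blast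
  from holomorphic_on_compose_gen[OF assms(1,2) this] show ?thesis by (simp add: o_def)
qed

text \<open>Keeps of the covering property what the analysis uses, in a form preserved by
  automorphisms of the half-plane: sections over discs through any prescribed preimage of the
  centre. \<open>r\<close> may be nonpositive; then \<open>\<sigma>\<close> only has to send
  \<open>p z\<close> to \<open>z\<close>.\<close>

definition disc_lifting :: "(complex \<Rightarrow> complex) \<Rightarrow> complex set \<Rightarrow> bool" where
  "disc_lifting p S \<longleftrightarrow> p holomorphic_on upper_half_plane \<and> p ` upper_half_plane = S \<and>
     (\<forall>z\<in>upper_half_plane. \<forall>r. ball (p z) r \<subseteq> S \<longrightarrow>
        (\<exists>\<sigma>. \<sigma> holomorphic_on ball (p z) r \<and> \<sigma> (p z) = z \<and>
           (\<forall>w\<in>ball (p z) r. \<sigma> w \<in> upper_half_plane \<and> p (\<sigma> w) = w)))"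

lemma disc_liftingE:
  assumes "disc_lifting p S" "z \<in> upper_half_plane" "p z = w0" "ball w0 r \<subseteq> S"
  obtains \<sigma> where "\<sigma> holomorphic_on ball w0 r" "\<sigma> w0 = z"
    "\<And>w. w \<in> ball w0 r \<Longrightarrow> \<sigma> w \<in> upper_half_plane"
    "\<And>w. w \<in> ball w0 r \<Longrightarrow> p (\<sigma> w) = w"
proof -
  have "ball (p z) r \<subseteq> S" using assms(3,4) by simp
  then have "\<exists>\<sigma>. \<sigma> holomorphic_on ball (p z) r \<and> \<sigma> (p z) = z \<and>
           (\<forall>w\<in>ball (p z) r. \<sigma> w \<in> upper_half_plane \<and> p (\<sigma> w) = w)"
    using assms(1,2) unfolding disc_lifting_def by simp
  then obtain \<sigma> where "\<sigma> holomorphic_on ball (p z) r" "\<sigma> (p z) = z"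
    "\<forall>w\<in>ball (p z) r. \<sigma> w \<in> upper_half_plane \<and> p (\<sigma> w) = w" by (elim exE conjE)
  with that[of \<sigma>] assms(3) show ?thesis by simp
qed

lemma covering_deriv_nonzero:
  assumes cov: "covering_space T p S" and T: "open T" and p: "p holomorphic_on T" and z: "z \<in> T"
  shows "deriv p z \<noteq> 0"
proof -
  obtain V u q where V: "z \<in> V" "openin (top_of_set T) V" "p z \<in> u" "openin (top_of_set S) u"
    "homeomorphism V u p q"
    by (rule covering_space_local_homeomorphism[OF cov z])
  have "open V" using V(2) T by (metis openin_open_eq)
  moreover have "V \<subseteq> T" using V(2) openin_imp_subset by blast
  moreover have "inj_on p V"
    using V(5) by (metis homeomorphism_def inj_on_inverseI)
  ultimately show ?thesis
    using holomorphic_injective_imp_regular[of p V z] V(1) p holomorphic_on_subset by blast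
qed

text \<open>A disc is simply connected, so its inclusion into \<open>S\<close> lifts continuously;
  the lift inverts \<open>p\<close>, whose derivative does not vanish, and is therefore
  holomorphic.\<close>

lemma covering_disc_lifting:
  assumes "universal_covering upper_half_plane p S"
  shows "disc_lifting p S"
proof -
  have cov: "covering_space upper_half_plane p S" and hol: "p holomorphic_on upper_half_plane"
    using assms by (auto simp: universal_covering_def)
  have img: "p ` upper_half_plane = S" using cov by (simp add: covering_space_def)
  have "\<exists>\<sigma>. \<sigma> holomorphic_on ball (p z) r \<and> \<sigma> (p z) = z \<and>
           (\<forall>w\<in>ball (p z) r. \<sigma> w \<in> upper_half_plane \<and> p (\<sigma> w) = w)"
    if z: "z \<in> upper_half_plane" and r: "ball (p z) r \<subseteq> S" for z r
  proof (cases "0 < r")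
    case False
    then have "ball (p z) r = {}" by simp
    then show ?thesis unfolding \<open>ball (p z) r = {}\<close> by (intro exI[of _ "\<lambda>_. z"]) simp
  next
    case True
    have "p z \<in> ball (p z) r" using True by simp
    moreover have "simply_connected (ball (p z) r)"
      by (simp add: convex_imp_simply_connected)
    moreover have "locally path_connected (ball (p z) r)"
      by (simp add: open_imp_locally_path_connected)
    moreover have "continuous_on (ball (p z) r) (\<lambda>w. w)" by simp
    moreover have "(\<lambda>w. w) \<in> ball (p z) r \<rightarrow> S" using r by auto
    ultimately obtain \<sigma> where \<sigma>: "continuous_on (ball (p z) r) \<sigma>"
      "\<sigma> \<in> ball (p z) r \<rightarrow> upper_half_plane" "\<sigma> (p z) = z"
      "\<And>y. y \<in> ball (p z) r \<Longrightarrow> p (\<sigma> y) = y"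
      using covering_space_lift_strong[OF cov z, where f = "\<lambda>w. w"] by (metis (no_types, lifting))
    have "\<sigma> field_differentiable (at y)" if y: "y \<in> ball (p z) r" for y
    proof -
      have y': "\<sigma> y \<in> upper_half_plane" using \<sigma>(2) y by auto
      have "(p has_field_derivative deriv p (\<sigma> y)) (at (\<sigma> y))"
        using hol open_upper_half_plane y' by (rule holomorphic_derivI)
      moreover have "deriv p (\<sigma> y) \<noteq> 0"
        by (rule covering_deriv_nonzero[OF cov open_upper_half_plane hol y'])
      moreover have "continuous (at y) \<sigma>"
        using \<sigma>(1) y by (simp add: continuous_on_eq_continuous_at)
      ultimately have "(\<sigma> has_field_derivative inverse (deriv p (\<sigma> y))) (at y)"
        by (rule has_field_derivative_inverse_basic[where t = "ball (p z) r"]) (use y \<sigma>(4) in auto)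
      then show ?thesis by (auto simp: field_differentiable_def)
    qed
    then have "\<sigma> holomorphic_on ball (p z) r"
      by (auto simp: holomorphic_on_def intro: field_differentiable_at_within)
    then show ?thesis using \<sigma> by (intro exI[of _ \<sigma>]) auto
  qed
  then show ?thesis using hol img by (auto simp: disc_lifting_def)
qed

text \<open>The automorphism \<open>z \<mapsto> x - 1/z\<close> sends \<open>\<infinity>\<close> to \<open>x\<close>, which reduces atoms at real points to mass
  at \<open>\<infinity>\<close>.\<close>

lemma disc_lifting_inversion:
  assumes "disc_lifting p S"
  shows "disc_lifting (\<lambda>z. p (of_real x - 1 / z)) S"
proof -
  define \<tau> :: "complex \<Rightarrow> complex" where "\<tau> z = of_real x - 1 / z" for z
  define \<tau>' :: "complex \<Rightarrow> complex" where "\<tau>' w = 1 / (of_real x - w)" for w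
  have \<tau>: "\<tau> z \<in> upper_half_plane" "z \<noteq> 0" "\<tau>' (\<tau> z) = z" if "z \<in> upper_half_plane" for z
  proof -
    have z: "0 < Im z" using that by (simp add: upper_half_plane_def)
    then show "z \<noteq> 0" by auto
    then have "0 < (Re z)\<^sup>2 + (Im z)\<^sup>2" using z by (simp add: sum_power2_gt_zero_iff)
    then show "\<tau> z \<in> upper_half_plane" using z
      by (simp add: \<tau>_def upper_half_plane_def Im_divide)
    show "\<tau>' (\<tau> z) = z" using \<open>z \<noteq> 0\<close> by (simp add: \<tau>_def \<tau>'_def)
  qed
  have \<tau>': "\<tau>' w \<in> upper_half_plane" "of_real x - w \<noteq> 0" "\<tau> (\<tau>' w) = w" if "w \<in> upper_half_plane" for w
  proof -
    have w: "0 < Im w" using that by (simp add: upper_half_plane_def)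
    then show ne: "of_real x - w \<noteq> 0" by (auto simp: complex_eq_iff)
    then have "0 < (x - Re w)\<^sup>2 + (Im w)\<^sup>2" using w by (simp add: sum_power2_gt_zero_iff)
    then show "\<tau>' w \<in> upper_half_plane" using w
      by (simp add: \<tau>'_def upper_half_plane_def Im_divide)
    show "\<tau> (\<tau>' w) = w" using ne by (simp add: \<tau>_def \<tau>'_def)
  qed
  have p: "p holomorphic_on upper_half_plane" "p ` upper_half_plane = S"
    using assms by (auto simp: disc_lifting_def)
  have hol\<tau>: "\<tau> holomorphic_on upper_half_plane"
    unfolding \<tau>_def by (intro holomorphic_intros) (use \<tau>(2) in auto)
  have hol\<tau>': "\<tau>' holomorphic_on upper_half_plane"
    unfolding \<tau>'_def by (intro holomorphic_intros) (use \<tau>'(2) in auto)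
  have "(\<lambda>z. p (\<tau> z)) holomorphic_on upper_half_plane"
    by (rule holomorphic_on_comp[OF hol\<tau> p(1) \<tau>(1)])
  moreover have "(\<lambda>z. p (\<tau> z)) ` upper_half_plane = S"
  proof -
    have "\<tau> ` upper_half_plane = upper_half_plane"
      using \<tau>(1) \<tau>'(1,3) by (metis image_eqI image_subsetI subsetI subset_antisym)
    then show ?thesis using p(2) by (metis image_image)
  qed
  moreover have "\<exists>\<sigma>. \<sigma> holomorphic_on ball (p (\<tau> z)) r \<and> \<sigma> (p (\<tau> z)) = z \<and>
           (\<forall>w\<in>ball (p (\<tau> z)) r. \<sigma> w \<in> upper_half_plane \<and> p (\<tau> (\<sigma> w)) = w)"
    if z: "z \<in> upper_half_plane" and r: "ball (p (\<tau> z)) r \<subseteq> S" for z r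
  proof -
    obtain \<sigma> where \<sigma>: "\<sigma> holomorphic_on ball (p (\<tau> z)) r" "\<sigma> (p (\<tau> z)) = \<tau> z"
      "\<And>w. w \<in> ball (p (\<tau> z)) r \<Longrightarrow> \<sigma> w \<in> upper_half_plane"
      "\<And>w. w \<in> ball (p (\<tau> z)) r \<Longrightarrow> p (\<sigma> w) = w"
      by (rule disc_liftingE[OF assms \<tau>(1)[OF z] refl r]) (rule that)
    have "(\<lambda>w. \<tau>' (\<sigma> w)) holomorphic_on ball (p (\<tau> z)) r"
      by (rule holomorphic_on_comp[OF \<sigma>(1) hol\<tau>' \<sigma>(3)])
    then show ?thesis
      using \<sigma> \<tau> \<tau>' z by (intro exI[of _ "\<lambda>w. \<tau>' (\<sigma> w)"]) auto
  qed
  ultimately have "disc_lifting (\<lambda>z. p (\<tau> z)) S" by (auto simp: disc_lifting_def)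
  then show ?thesis by (simp add: \<tau>_def)
qed

section \<open>Harnack chains lifted through the covering\<close>

lemma compact_connected_chain:
  fixes K :: "'a::metric_space set"
  assumes "compact K" "connected K" "0 < r"
  obtains N where "\<And>w w'. w \<in> K \<Longrightarrow> w' \<in> K \<Longrightarrow>
    \<exists>n\<le>N. (w, w') \<in> {(x, y). x \<in> K \<and> y \<in> K \<and> dist x y < r} ^^ n"
proof -
  define R where "R = {(x, y). x \<in> K \<and> y \<in> K \<and> dist x y < r}"
  have "sym R" by (auto simp: R_def sym_def dist_commute)
  \<comment> \<open>Being joined by a chain is an equivalence relation with open classes, so
    connectedness leaves a single class. Compactness enters below to bound the length.\<close>
  have star: "(x, y) \<in> R\<^sup>*" if "x \<in> K" "y \<in> K" for x y
  proof (rule connected_equivalence_relation[OF assms(2) that, where R = "\<lambda>x y. (x, y) \<in> R\<^sup>*"])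
    show "(y, x) \<in> R\<^sup>*" if "(x, y) \<in> R\<^sup>*" for x y
      using sym_rtrancl[OF \<open>sym R\<close>] that by (meson symD)
    show "(x, z) \<in> R\<^sup>*" if "(x, y) \<in> R\<^sup>*" "(y, z) \<in> R\<^sup>*" for x y z
      using that by (rule rtrancl_trans)
    show "\<exists>T. openin (top_of_set K) T \<and> a \<in> T \<and> (\<forall>x\<in>T. (a, x) \<in> R\<^sup>*)" if "a \<in> K" for a
      by (intro exI[of _ "K \<inter> ball a r"] conjI ballI)
         (use that \<open>0 < r\<close> in \<open>auto simp: R_def openin_open intro!: r_into_rtrancl\<close>)
  qed
  have cover: "K \<subseteq> (\<Union>c\<in>K. ball c r)" using \<open>0 < r\<close> by auto
  obtain F where F: "F \<subseteq> K" "finite F" "K \<subseteq> (\<Union>c\<in>F. ball c r)"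
    by (rule compactE_image[OF assms(1) open_ball cover])
  define m where "m x y = (LEAST n. (x, y) \<in> R ^^ n)" for x y
  have m: "(x, y) \<in> R ^^ m x y" if "x \<in> K" "y \<in> K" for x y
    unfolding m_def using star[OF that] by (metis LeastI rtrancl_imp_relpow)
  define N where "N = Max (insert 0 ((\<lambda>(x, y). m x y) ` (F \<times> F)))"
  have N: "m x y \<le> N" if "x \<in> F" "y \<in> F" for x y
    unfolding N_def using F(2) that by (intro Max_ge) auto
  show ?thesis
  \<comment> \<open>\<open>N\<close> bounds the chains between the finitely many centres; the extra
    2 are the links from \<open>w\<close> and \<open>w'\<close> to nearby centres.\<close>
  proof (rule that[of "N + 2"], fold R_def)
    fix w w' assume w: "w \<in> K" "w' \<in> K"
    obtain c where c: "c \<in> F" "dist c w < r" using F(3) w(1) by auto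
    obtain c' where c': "c' \<in> F" "dist c' w' < r" using F(3) w(2) by auto
    have "(w, c) \<in> R ^^ 1" "(c', w') \<in> R ^^ 1"
      using c c' F(1) w by (auto simp: R_def dist_commute)
    moreover have "(c, c') \<in> R ^^ m c c'" using m c c' F(1) by blast
    ultimately have "(w, w') \<in> R ^^ (1 + m c c' + 1)"
      unfolding relpow_add by blast
    then show "\<exists>n\<le>N + 2. (w, w') \<in> R ^^ n"
      using N[OF c(1) c'(1)] by (intro exI[of _ "1 + m c c' + 1"]) auto
  qed
qed

text \<open>The chain is lifted one disc at a time. Each link is shorter than a fifth of the disc's
  radius, hence \<open>5 * r\<close> and a factor 2 per link. \<open>z'\<close> is chosen before
  \<open>Q\<close>, so one point serves every positive harmonic function. The scale \<open>s\<close>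
  is there to move \<open>K\<close> to distant gaps.\<close>

lemma disc_lifting_harnack_chain:
  assumes p: "disc_lifting p S" and "0 < s" "0 < r"
    and K: "\<And>w. w \<in> K \<Longrightarrow> ball (of_real s * w) (s * (5 * r)) \<subseteq> S"
    and z: "z \<in> upper_half_plane" "p z = of_real s * w"
    and chain: "(w, w') \<in> {(x, y). x \<in> K \<and> y \<in> K \<and> dist x y < r} ^^ n"
  obtains z' where "z' \<in> upper_half_plane" "p z' = of_real s * w'"
    and "\<forall>Q. Q holomorphic_on upper_half_plane \<and> (\<forall>x\<in>upper_half_plane. 0 \<le> Re (Q x)) \<longrightarrow>
          Re (Q z') \<le> 2 ^ n * Re (Q z) \<and> Re (Q z) \<le> 2 ^ n * Re (Q z')"
  using chain
proof (induction n arbitrary: w' thesis)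
  case 0
  then show ?case using z by (intro "0.prems"(1)[of z]) auto
next
  case (Suc n)
  obtain v where v: "(w, v) \<in> {(x, y). x \<in> K \<and> y \<in> K \<and> dist x y < r} ^^ n"
    "v \<in> K" "w' \<in> K" "dist v w' < r" using Suc.prems(2) by auto
  obtain y where y: "y \<in> upper_half_plane" "p y = of_real s * v"
    "\<forall>Q. Q holomorphic_on upper_half_plane \<and> (\<forall>x\<in>upper_half_plane. 0 \<le> Re (Q x)) \<longrightarrow>
          Re (Q y) \<le> 2 ^ n * Re (Q z) \<and> Re (Q z) \<le> 2 ^ n * Re (Q y)"
    by (rule Suc.IH[OF _ v(1)]) (rule that)
  obtain \<sigma> where \<sigma>: "\<sigma> holomorphic_on ball (of_real s * v) (s * (5 * r))" "\<sigma> (of_real s * v) = y"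
    "\<And>x. x \<in> ball (of_real s * v) (s * (5 * r)) \<Longrightarrow> \<sigma> x \<in> upper_half_plane"
    "\<And>x. x \<in> ball (of_real s * v) (s * (5 * r)) \<Longrightarrow> p (\<sigma> x) = x"
    by (rule disc_liftingE[OF p y(1,2) K[OF v(2)]]) (rule that)
  have d: "dist (of_real s * v) (of_real s * w') = s * dist v w'"
    using \<open>0 < s\<close> by (simp add: dist_norm norm_mult flip: right_diff_distrib)
  have "s * dist v w' < s * (5 * r)" using v(4) \<open>0 < s\<close> \<open>0 < r\<close> by simp
  then have w'b: "of_real s * w' \<in> ball (of_real s * v) (s * (5 * r))" using d by simp
  show ?case
  proof (rule Suc.prems(1)[of "\<sigma> (of_real s * w')"])
    show "\<sigma> (of_real s * w') \<in> upper_half_plane" "p (\<sigma> (of_real s * w')) = of_real s * w'"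
      using \<sigma> w'b by auto
    show "\<forall>Q. Q holomorphic_on upper_half_plane \<and> (\<forall>x\<in>upper_half_plane. 0 \<le> Re (Q x)) \<longrightarrow>
      Re (Q (\<sigma> (of_real s * w'))) \<le> 2 ^ Suc n * Re (Q z) \<and>
      Re (Q z) \<le> 2 ^ Suc n * Re (Q (\<sigma> (of_real s * w')))"
    proof (intro allI impI, elim conjE)
    fix Q assume Q: "Q holomorphic_on upper_half_plane" "\<forall>x\<in>upper_half_plane. 0 \<le> Re (Q x)"
    have hol: "(\<lambda>x. Q (\<sigma> x)) holomorphic_on ball (of_real s * v) (s * (5 * r))"
      by (rule holomorphic_on_comp[OF \<sigma>(1) Q(1) \<sigma>(3)])
    have "dist (of_real s * v) (of_real s * w') \<le> s * (5 * r) / 5"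
      using d v(4) \<open>0 < s\<close> by simp
    from harnack_ball_le[OF hol _ _ this] Q(2) \<sigma>(3) \<open>0 < s\<close> \<open>0 < r\<close>
    have "Re (Q (\<sigma> (of_real s * w'))) \<le> 2 * Re (Q y)" "Re (Q y) \<le> 2 * Re (Q (\<sigma> (of_real s * w')))"
      unfolding \<sigma>(2) by auto
    moreover have "Re (Q y) \<le> 2 ^ n * Re (Q z) \<and> Re (Q z) \<le> 2 ^ n * Re (Q y)"
      using y(3) Q by simp
    moreover have "(2::real) ^ n * Re (Q y) \<le> 2 ^ n * (2 * Re (Q (\<sigma> (of_real s * w'))))"
      using calculation(2) by (intro mult_left_mono) auto
    ultimately show "Re (Q (\<sigma> (of_real s * w'))) \<le> 2 ^ Suc n * Re (Q z) \<and>
      Re (Q z) \<le> 2 ^ Suc n * Re (Q (\<sigma> (of_real s * w')))"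
      unfolding power_Suc by (intro conjI; linarith)
    qed
  qed
qed

text \<open>The half-plane is convex, so the pulled-back function is globally a real part even if
  \<open>u\<close> is not. The derivative formula makes points over zeros of \<open>g\<close>
  critical for \<open>P\<close>.\<close>

lemma harmonic_compose_disc_lifting:
  assumes p: "disc_lifting p S" and g: "g holomorphic_on S"
    and u: "\<And>z. z \<in> S \<Longrightarrow> (u has_derivative (\<lambda>h. Re (g z * h))) (at z)"
  obtains P where "P holomorphic_on upper_half_plane"
    and "\<And>z. z \<in> upper_half_plane \<Longrightarrow> u (p z) = Re (P z)"
    and "\<And>z. z \<in> upper_half_plane \<Longrightarrow> (P has_field_derivative g (p z) * deriv p z) (at z)"
proof -
  have pS: "p z \<in> S" if "z \<in> upper_half_plane" for z
    using p that by (auto simp: disc_lifting_def)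
  have hol: "p holomorphic_on upper_half_plane" using p by (auto simp: disc_lifting_def)
  have "(\<lambda>z. g (p z)) holomorphic_on upper_half_plane"
    by (rule holomorphic_on_comp[OF hol g pS])
  moreover have "deriv p holomorphic_on upper_half_plane"
    using hol open_upper_half_plane by (rule holomorphic_deriv)
  ultimately have hol2: "(\<lambda>z. g (p z) * deriv p z) holomorphic_on upper_half_plane"
    by (rule holomorphic_on_mult)
  have D: "((\<lambda>z. u (p z)) has_derivative (\<lambda>h. Re (g (p z) * deriv p z * h))) (at z)"
    if z: "z \<in> upper_half_plane" for z
  proof -
    have "(p has_derivative (\<lambda>h. deriv p z * h)) (at z)"
      using holomorphic_derivI[OF hol open_upper_half_plane z] by (simp add: has_field_derivative_def)
    from has_derivative_compose[OF this u[OF pS[OF z]]] show ?thesis by (simp add: mult.assoc)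
  qed
  note prim = real_part_primitive[OF open_upper_half_plane convex_upper_half_plane hol2, of "\<lambda>z. u (p z)"]
  obtain P where P: "\<And>z. z \<in> upper_half_plane \<Longrightarrow> (P has_field_derivative g (p z) * deriv p z) (at z)"
    "\<And>z. z \<in> upper_half_plane \<Longrightarrow> u (p z) = Re (P z)"
    by (rule prim) (rule D, assumption, rule that)
  moreover have "P holomorphic_on upper_half_plane"
    using P(1) by (auto simp: holomorphic_on_open[OF open_upper_half_plane])
  ultimately show ?thesis using that[of P] by simp
qed

section \<open>A barrier at the end of a slit\<close>

text \<open>The barrier is \<open>2 * C\<close> times the real part of a fourth root. On the slit
  plane its argument is at most \<open>pi / 4\<close> in modulus, so the real part is comparable to
  the modulus. A square root would fail: its real part vanishes on the slit, in particular where the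
  slit meets the circle.\<close>

lemma slit_barrier:
  fixes u :: "complex \<Rightarrow> real" and s d \<rho> :: real
  assumes "0 < \<rho>" and d: "d = 1 \<or> d = -1" and "0 \<le> C"
    and u: "continuous_on UNIV u" and le: "\<And>w. w \<in> cball (of_real s) \<rho> \<Longrightarrow> u w \<le> C"
    and slit: "\<And>t. 0 \<le> t \<Longrightarrow> t < \<rho> \<Longrightarrow> u (of_real (s - d * t)) = 0"
    and sub: "\<And>w. w \<in> ball (of_real s) \<rho> \<Longrightarrow> subharmonic_at u w"
    and w: "w \<in> ball (of_real s) \<rho>"
  shows "u w \<le> 2 * C * sqrt (sqrt (dist (of_real s) w / \<rho>))"
proof -
  \<comment> \<open>Sends the end \<open>s\<close> to 0, the slit into the negative real axis and
    the ball to the unit disc.\<close>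
  define \<zeta> :: "complex \<Rightarrow> complex" where "\<zeta> w = of_real (d / \<rho>) * (w - of_real s)" for w
  have n\<zeta>: "norm (\<zeta> w) = dist (of_real s) w / \<rho>" for w
    using d \<open>0 < \<rho>\<close> by (auto simp: \<zeta>_def norm_mult norm_divide dist_norm norm_minus_commute)
  \<comment> \<open>\<open>csqrt\<close> jumps across its cut, but the real part of its iterate does
    not: written with real square roots it is visibly continuous on the whole plane.\<close>
  define \<beta> where "\<beta> w = sqrt ((sqrt (norm (\<zeta> w)) + sqrt ((norm (\<zeta> w) + Re (\<zeta> w)) / 2)) / 2)" for w
  have \<beta>csqrt: "\<beta> w = Re (csqrt (csqrt (\<zeta> w)))" for w
    by (simp add: \<beta>_def)
  have cont\<zeta>: "continuous_on A \<zeta>" for A unfolding \<zeta>_def by (intro continuous_intros)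
  have cont\<beta>: "continuous_on A \<beta>" for A unfolding \<beta>_def by (intro continuous_intros cont\<zeta>) simp_all
  have Re\<zeta>: "0 \<le> norm (\<zeta> w) + Re (\<zeta> w)" for w
    using abs_Re_le_cmod[of "\<zeta> w"] by linarith
  have \<beta>0: "0 \<le> \<beta> w" for w unfolding \<beta>_def using Re\<zeta>[of w] by simp
  have slit': "u w = 0" if "w \<in> ball (of_real s) \<rho>" "\<zeta> w \<in> \<real>\<^sub>\<le>\<^sub>0" for w
  proof -
    from that(2) obtain r where r: "r \<le> 0" "\<zeta> w = of_real r"
      by (auto elim!: nonpos_Reals_cases)
    have "w = of_real (s - d * (- r * \<rho>))"
    proof -
      have "d * d = 1" using d by auto
      have "of_real (d * \<rho>) * \<zeta> w = of_real (d * \<rho> * (d / \<rho>)) * (w - of_real s)"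
        by (simp add: \<zeta>_def)
      also have "d * \<rho> * (d / \<rho>) = 1" using \<open>d * d = 1\<close> \<open>0 < \<rho>\<close> by simp
      finally show ?thesis using r(2) by (simp add: algebra_simps)
    qed
    moreover have "- r < 1" using that(1) n\<zeta>[of w] r \<open>0 < \<rho>\<close> by simp
    then have "- r * \<rho> < \<rho>" using \<open>0 < \<rho>\<close> mult_strict_right_mono by fastforce
    ultimately show ?thesis using slit[of "- r * \<rho>"] r(1) \<open>0 < \<rho>\<close> by (simp add: mult_nonpos_nonneg)
  qed
  define U where "U = ball (of_real s) \<rho> - \<zeta> -` \<real>\<^sub>\<le>\<^sub>0"
  have "closed (\<zeta> -` \<real>\<^sub>\<le>\<^sub>0)"
    using continuous_closed_vimage[OF closed_nonpos_Reals_complex, of \<zeta>] cont\<zeta>[of UNIV]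
    by (simp add: continuous_on_eq_continuous_at)
  then have "open U" by (auto simp: U_def)
  have bound: "u w - 2 * C * \<beta> w \<le> 0" if "w \<in> U" for w
  proof (rule subharmonic_max_principle[OF \<open>open U\<close>, where u = "\<lambda>w. u w - 2 * C * \<beta> w"])
    show "bounded U" by (simp add: U_def bounded_diff)
    show "continuous_on (closure U) (\<lambda>w. u w - 2 * C * \<beta> w)"
      by (intro continuous_intros cont\<beta> continuous_on_subset[OF u]) auto
    show "w \<in> U" by fact
    show "subharmonic_at (\<lambda>w. u w - 2 * C * \<beta> w) x" if x: "x \<in> U" for x
    proof -
      obtain e where e: "0 < e" "ball x e \<subseteq> U" using x \<open>open U\<close> by (meson openE)
      show ?thesis
      proof (rule subharmonic_at_diff[OF _ e(1)])
        show "subharmonic_at u x" using sub x by (auto simp: U_def)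
        show "(\<lambda>w. of_real (2 * C) * csqrt (csqrt (\<zeta> w))) holomorphic_on ball x e"
        proof (intro holomorphic_intros)
          show "\<zeta> holomorphic_on ball x e" unfolding \<zeta>_def by (intro holomorphic_intros)
          show nr: "\<zeta> z \<notin> \<real>\<^sub>\<le>\<^sub>0" if "z \<in> ball x e" for z
            using e(2) that by (auto simp: U_def)
          show "csqrt (\<zeta> z) \<notin> \<real>\<^sub>\<le>\<^sub>0" if "z \<in> ball x e" for z
          proof -
            have "\<zeta> z \<notin> \<real>\<^sub>\<le>\<^sub>0" by (rule nr[OF that])
            moreover have "Im (\<zeta> z) = 0 \<and> Re (\<zeta> z) \<le> 0" if "norm (\<zeta> z) + Re (\<zeta> z) = 0"
            proof -
              have eq: "norm (\<zeta> z) = - Re (\<zeta> z)" using that by linarith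
              then have "(Re (\<zeta> z))\<^sup>2 + (Im (\<zeta> z))\<^sup>2 = (Re (\<zeta> z))\<^sup>2"
                using cmod_power2[of "\<zeta> z"] by simp
              then show ?thesis using eq norm_ge_zero[of "\<zeta> z"] by simp
            qed
            ultimately have "0 < norm (\<zeta> z) + Re (\<zeta> z)"
              using Re\<zeta>[of z] by (metis complex_nonpos_Reals_iff order_le_less)
            then have "0 < Re (csqrt (\<zeta> z))" by simp
            then show ?thesis by (simp add: complex_nonpos_Reals_iff)
          qed
        qed
      qed (simp add: \<beta>csqrt)
    qed
    show "u y - 2 * C * \<beta> y \<le> 0" if y: "y \<in> frontier U" for y
    proof -
      have ycl: "y \<in> closure U" "y \<notin> U" using y interior_open[OF \<open>open U\<close>] by (auto simp: frontier_def)
      have "closure U \<subseteq> cball (of_real s) \<rho>"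
        by (rule closure_minimal) (auto simp: U_def)
      then have "y \<in> cball (of_real s) \<rho>" using ycl by auto
      show ?thesis
      proof (cases "y \<in> ball (of_real s) \<rho>")
        case True
        then have "u y = 0" using slit' ycl(2) by (auto simp: U_def)
        then show ?thesis using \<beta>0[of y] \<open>0 \<le> C\<close> by simp
      next
        case False
        then have "norm (\<zeta> y) = 1" using \<open>y \<in> cball (of_real s) \<rho>\<close> \<open>0 < \<rho>\<close> by (simp add: n\<zeta>)
        \<comment> \<open>On the unit circle the first summand alone contributes 1/2, so
          \<open>\<beta> y\<close> is at least 1/2 and the barrier at least
          \<open>C\<close>.\<close>
        then have "(1/2)\<^sup>2 \<le> (sqrt (norm (\<zeta> y)) + sqrt ((norm (\<zeta> y) + Re (\<zeta> y)) / 2)) / 2"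
          using Re\<zeta>[of y] by (simp add: power2_eq_square)
        then have "1/2 \<le> \<beta> y" unfolding \<beta>_def by (rule real_le_rsqrt)
        then have "2 * C * (1/2) \<le> 2 * C * \<beta> y" using \<open>0 \<le> C\<close> by (intro mult_left_mono) auto
        then show ?thesis using le[OF \<open>y \<in> cball (of_real s) \<rho>\<close>] by simp
      qed
    qed
  qed
  have "u w \<le> 2 * C * \<beta> w"
  proof (cases "w \<in> U")
    case True then show ?thesis using bound[of w] by simp
  next
    case False
    then have "u w = 0" using slit' w by (auto simp: U_def)
    then show ?thesis using \<beta>0[of w] \<open>0 \<le> C\<close> by simp
  qed
  also have "\<beta> w \<le> sqrt (sqrt (norm (\<zeta> w)))"
  proof -
    have "(norm (\<zeta> w) + Re (\<zeta> w)) / 2 \<le> norm (\<zeta> w)"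
      using complex_Re_le_cmod[of "\<zeta> w"] by simp
    then have "sqrt ((norm (\<zeta> w) + Re (\<zeta> w)) / 2) \<le> sqrt (norm (\<zeta> w))" by simp
    then show ?thesis unfolding \<beta>_def by simp
  qed
  then have "2 * C * \<beta> w \<le> 2 * C * sqrt (sqrt (norm (\<zeta> w)))"
    using \<open>0 \<le> C\<close> by (intro mult_left_mono) auto
  finally show ?thesis by (simp add: n\<zeta>)
qed

section \<open>The homogeneous gap set\<close>

text \<open>\<open>(l * a, l * b)\<close> is the gap next to \<open>(a, b)\<close> on the left.
  \<open>l * b < a\<close> leaves the band \<open>[l * b, a]\<close> between them, and division by
  \<open>l\<close> gives the band \<open>[b, a / l]\<close> on the right; these supply slits at both
  ends of the gap.\<close>

locale homogeneous_gaps =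
  fixes l a b :: real
  assumes l: "1 < l" and ab: "a < b" and b0: "b < 0" and lb: "l * b < a"
begin

abbreviation "E \<equiv> gap_set l a b"

lemma gap_set_iff: "z \<in> E \<longleftrightarrow> Im z = 0 \<and> Re z \<le> 0 \<and> (\<forall>n. \<not> (l powi n * a < Re z \<and> Re z < l powi n * b))"
  by (auto simp: gap_set_def complex_eq_iff image_iff intro!: bexI[of _ "Re z"])

lemma closed_gap_set: "closed E"
proof -
  have "E = {z. Im z = 0} \<inter> {z. Re z \<le> 0} \<inter> (\<Inter>n::int. - ({z. l powi n * a < Re z} \<inter> {z. Re z < l powi n * b}))"
    by (auto simp: gap_set_iff)
  moreover have "closed (- ({z. l powi n * a < Re z} \<inter> {z. Re z < l powi n * b}))" for n :: int
    by (intro closed_Compl open_Int open_halfspace_Re_gt open_halfspace_Re_lt)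
  moreover have "closed {z. Im z = 0}" "closed {z. Re z \<le> 0}"
    by (auto intro: closed_halfspace_Im_eq closed_halfspace_Re_le)
  ultimately show ?thesis by (metis (no_types, lifting) closed_Int closed_INT)
qed

lemma open_gap_complement: "open (- E)"
  using closed_gap_set by auto

text \<open>Multiplication by \<open>l\<close> shifts the index of the gaps by one, a bijection
  because the index runs over all integers.\<close>

lemma gap_set_scale: "of_real (l ^ n) * z \<in> E \<longleftrightarrow> z \<in> E"
proof (induction n)
  case (Suc n)
  have step: "of_real l * z \<in> E \<longleftrightarrow> z \<in> E" for z
  proof -
    have pw: "l powi (m + 1) = l * l powi m" for m
      using l by (simp add: power_int_add)
    have "(l powi (m + 1) * a < l * Re z \<and> l * Re z < l powi (m + 1) * b) \<longleftrightarrow>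
      (l powi m * a < Re z \<and> Re z < l powi m * b)" for m
      using l by (simp add: pw mult.assoc)
    then have "(\<forall>n. \<not> (l powi n * a < l * Re z \<and> l * Re z < l powi n * b)) \<longleftrightarrow>
      (\<forall>n. \<not> (l powi n * a < Re z \<and> Re z < l powi n * b))"
      by (metis diff_add_cancel)
    then show ?thesis using l by (auto simp: gap_set_iff mult_le_0_iff)
  qed
  show ?case using step[of "of_real (l ^ n) * z"] Suc by (simp add: mult.assoc)
qed simp

lemma gap_notin: "a < t \<Longrightarrow> t < b \<Longrightarrow> of_real t \<notin> E"
  by (auto simp: gap_set_iff intro!: exI[of _ 0])

lemma powi_ge: "l \<le> l powi n" if "1 \<le> n"
  using power_int_increasing[of 1 n l] that l by simp

lemma powi_le: "l powi n \<le> 1" if "n \<le> 0"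
  using power_int_increasing[of n 0 l] that l by simp

text \<open>Gaps of index at least 1 end at or before \<open>l * b\<close>, and those of index at
  most 0 start at or after \<open>a\<close>.\<close>

lemma band_left: "of_real t \<in> E" if "l * b \<le> t" "t \<le> a"
proof -
  have "\<not> (l powi n * a < t \<and> t < l powi n * b)" for n
  proof (cases "1 \<le> n")
    case True
    then have "l powi n * b \<le> l * b" using powi_ge[OF True] b0 by (simp add: mult_right_mono_neg)
    then show ?thesis using that by auto
  next
    case False
    then have "1 * a \<le> l powi n * a" using powi_le[of n] b0 ab by (intro mult_right_mono_neg) auto
    then show ?thesis using that by auto
  qed
  then show ?thesis using that ab b0 by (auto simp: gap_set_iff)
qed

lemma band_right: "of_real t \<in> E" if "b \<le> t" "t \<le> a / l"
  using band_left[of "l * t"] gap_set_scale[of 1 "of_real t"] that l by (simp add: field_simps)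

definition "mid = (a + b) / 2"

lemma mid: "a < mid" "mid < b" "mid < 0"
  using ab b0 by (auto simp: mid_def)

lemma sphere_notin: "norm w = l ^ n * (- mid) \<Longrightarrow> w \<notin> E"
proof
  assume w: "norm w = l ^ n * (- mid)" "w \<in> E"
  then have "Im w = 0" "Re w \<le> 0" by (auto simp: gap_set_iff)
  then have "norm w = - Re w" using cmod_eq_Re[of w] by simp
  then have "w = of_real (l ^ n) * of_real mid"
    using w(1) \<open>Im w = 0\<close> by (simp add: complex_eq_iff)
  then have "of_real mid \<in> E" using w(2) gap_set_scale by simp
  then show False using gap_notin mid by blast
qed

section \<open>Martin functions under scaling and their critical points in a gap\<close>

text \<open>A symmetric Martin function together with its holomorphic gradient \<open>g\<close>,
  normalised to vanish on \<open>E\<close>.\<close>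

definition martin_pair :: "(complex \<Rightarrow> real) \<Rightarrow> (complex \<Rightarrow> complex) \<Rightarrow> bool" where
  "martin_pair v g \<longleftrightarrow> g holomorphic_on - E \<and>
     (\<forall>z\<in>- E. (v has_derivative (\<lambda>h. Re (g z * h))) (at z)) \<and> (\<forall>z. 0 \<le> v z) \<and>
     (\<forall>z\<in>E. v z = 0) \<and> continuous_on UNIV v \<and> (\<forall>z. v (cnj z) = v z)"

lemma martin_pairD:
  assumes "martin_pair v g"
  shows "g holomorphic_on - E" "\<And>z. z \<notin> E \<Longrightarrow> (v has_derivative (\<lambda>h. Re (g z * h))) (at z)"
    "\<And>z. 0 \<le> v z" "\<And>z. z \<in> E \<Longrightarrow> v z = 0" "continuous_on UNIV v" "\<And>z. v (cnj z) = v z"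
  using assms unfolding martin_pair_def by auto

lemma cnj_gap_set: "cnj z \<in> E \<longleftrightarrow> z \<in> E"
  by (auto simp: gap_set_iff)

lemma symmetric_martin_pair:
  assumes "symmetric_martin_function M E"
  obtains g where "martin_pair (\<lambda>z. if z \<in> E then 0 else M z) g"
proof -
  have M: "harmonic_on M (- E)" "\<And>z. z \<in> - E \<Longrightarrow> 0 \<le> M z"
    "continuous_on UNIV (\<lambda>z. if z \<in> E then 0 else M z)" "\<And>z. z \<in> - E \<Longrightarrow> M (cnj z) = M z"
    using assms unfolding symmetric_martin_function_def by auto
  obtain g where g: "g holomorphic_on - E"
    "\<And>z. z \<in> - E \<Longrightarrow> (M has_derivative (\<lambda>h. Re (g z * h))) (at z)"
    by (rule harmonic_holomorphic_gradient[OF M(1)]) (rule that)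
  have "((\<lambda>z. if z \<in> E then 0 else M z) has_derivative (\<lambda>h. Re (g z * h))) (at z)" if "z \<in> - E" for z
    by (rule has_derivative_transform_within_open[OF g(2)[OF that] open_gap_complement that]) auto
  then show ?thesis
    using that[of g] g(1) M by (auto simp: martin_pair_def cnj_gap_set)
qed

lemma martin_pair_scale:
  assumes "martin_pair v g"
  shows "martin_pair (\<lambda>z. v (of_real (l ^ n) * z)) (\<lambda>z. of_real (l ^ n) * g (of_real (l ^ n) * z))"
proof -
  note v = martin_pairD[OF assms]
  have "(\<lambda>z. g (of_real (l ^ n) * z)) holomorphic_on - E"
    by (rule holomorphic_on_comp[OF _ v(1)])
       (auto simp: gap_set_scale simp del: of_real_power intro!: holomorphic_intros)
  moreover have "((\<lambda>z. v (of_real (l ^ n) * z)) has_derivative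
      (\<lambda>h. Re (of_real (l ^ n) * g (of_real (l ^ n) * z) * h))) (at z)" if "z \<notin> E" for z
  proof -
    have "((\<lambda>z. of_real (l ^ n) * z) has_derivative (\<lambda>h. of_real (l ^ n) * h)) (at z)"
      by (auto intro!: derivative_eq_intros)
    moreover have "(v has_derivative (\<lambda>h. Re (g (of_real (l ^ n) * z) * h))) (at (of_real (l ^ n) * z))"
      using v(2)[of "of_real (l ^ n) * z"] that gap_set_scale by blast
    ultimately show ?thesis
      using has_derivative_compose by (fastforce simp: mult_ac)
  qed
  moreover have "continuous_on UNIV (\<lambda>z. v (of_real (l ^ n) * z))"
    by (intro continuous_on_compose2[OF v(5)] continuous_intros) auto
  moreover have "v (of_real (l ^ n) * cnj z) = v (of_real (l ^ n) * z)" for z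
    using v(6)[of "of_real (l ^ n) * z"] by simp
  ultimately show ?thesis
    unfolding martin_pair_def using v(3,4) gap_set_scale
    by (auto simp del: of_real_power intro!: holomorphic_intros)
qed

lemma martin_pair_subharmonic:
  assumes "martin_pair v g"
  shows "subharmonic_at v w"
proof (cases "w \<in> E")
  case True
  then show ?thesis using martin_pairD[OF assms] by (intro subharmonic_at_zero) auto
next
  case False
  note v = martin_pairD[OF assms]
  obtain r where r: "0 < r" "ball w r \<subseteq> - E"
    using open_gap_complement False by (metis ComplI openE)
  obtain F where F: "\<And>z. z \<in> ball w r \<Longrightarrow> (F has_field_derivative g z) (at z)"
    "\<And>z. z \<in> ball w r \<Longrightarrow> v z = Re (F z)"
  proof (rule real_part_primitive[of "ball w r" g v])
    show "g holomorphic_on ball w r" using v(1) r(2) holomorphic_on_subset by blast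
    show "(v has_derivative (\<lambda>h. Re (g z * h))) (at z)" if "z \<in> ball w r" for z
      using v(2) r(2) that by blast
  qed (simp, simp, rule that)
  have "F holomorphic_on ball w r"
    unfolding holomorphic_on_open[OF open_ball] using F(1) by blast
  then show ?thesis unfolding subharmonic_at_def
    using r(1) F(2) by (intro exI[of _ r] conjI allI impI exI[of _ F]) auto
qed

text \<open>\<open>v\<close> is subharmonic across \<open>E\<close> as well, so the maximum
  principle applies in the whole disc.\<close>

lemma martin_pair_le_sphere:
  assumes "martin_pair v g" and "\<And>w. norm w = R \<Longrightarrow> v w \<le> C" and "norm w \<le> R"
  shows "v w \<le> C"
proof (cases "norm w = R")
  case False
  show ?thesis
  proof (rule subharmonic_max_principle[of "ball 0 R" v])
    show "continuous_on (closure (ball 0 R)) v"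
      using martin_pairD(5)[OF assms(1)] continuous_on_subset by blast
    show "subharmonic_at v z" for z by (rule martin_pair_subharmonic[OF assms(1)])
    show "v z \<le> C" if "z \<in> frontier (ball 0 R)" for z
    proof -
      have "R \<noteq> 0" using False assms(3) by auto
      then have "0 < R" using assms(3) norm_ge_zero[of w] by linarith
      then have "norm z = R" using that frontier_ball[of R 0] by simp
      then show ?thesis by (rule assms(2))
    qed
  qed (use False assms(3) in auto)
qed (use assms(2) in auto)

lemma sqrt_sqrt_less:
  assumes "0 < C" "0 \<le> x" "x < (1 / C) ^ 4"
  shows "C * sqrt (sqrt x) < 1"
proof -
  have "sqrt (sqrt x) < sqrt (sqrt ((1 / C) ^ 4))" using assms by simp
  also have "(1 / C) ^ 4 = ((1 / C)\<^sup>2)\<^sup>2" unfolding power_mult[symmetric] by simp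
  also have "sqrt (sqrt (((1 / C)\<^sup>2)\<^sup>2)) = 1 / C"
    unfolding real_sqrt_abs using assms(1) by (simp del: power_divide)
  finally show ?thesis using assms(1) by (simp add: field_simps)
qed

text \<open>\<open>\<epsilon>\<close> is fixed before \<open>v\<close>, so it serves all rescalings
  of one Martin function. The bound by \<open>C\<close> on the outer circle feeds the barriers at
  both ends and confines the maximum over the gap to a fixed compact interval; there the derivative
  along the gap vanishes by maximality, the one across it by symmetry.\<close>

lemma gap_critical_point:
  assumes "0 < C"
  obtains \<epsilon> where "0 < \<epsilon>" "\<epsilon> < (b - a) / 2"
    and "\<forall>v g. martin_pair v g \<and> 0 < v (of_real mid) \<and>
       (\<forall>w. norm w = l * (- mid) \<longrightarrow> v w \<le> C * v (of_real mid)) \<longrightarrow>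
       (\<exists>x\<in>{a + \<epsilon>..b - \<epsilon>}. g (of_real x) = 0)"
proof -
  \<comment> \<open>The first two terms are the lengths of the adjacent bands, so that slits of
    length \<open>\<rho>\<close> lie in \<open>E\<close>. The ball about \<open>a\<close> stays
    inside \<open>norm w \<le> l * (- mid)\<close>, where \<open>v\<close> is bounded, by the first
    term, and the ball about \<open>b\<close> by the third.\<close>
  define \<rho> where "\<rho> = Min {a - l * b, a / l - b, (l - 1) * (- mid)}"
  have \<rho>: "\<rho> \<le> a - l * b" "\<rho> \<le> a / l - b" "\<rho> \<le> (l - 1) * (- mid)"
    by (auto simp: \<rho>_def)
  have "0 < a / l - b" "0 < (l - 1) * (- mid)"
    using l lb mid(3) by (simp_all add: field_simps mult_pos_neg)
  with lb have \<rho>0: "0 < \<rho>" by (simp add: \<rho>_def)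
  \<comment> \<open>The first entry makes \<open>2 * C\<close> times the fourth root of
    \<open>\<epsilon> / \<rho>\<close> less than 1, which is the barrier's bound relative to
    \<open>v (of_real mid)\<close>.\<close>
  define \<epsilon> where "\<epsilon> = Min {\<rho> * (1 / (2 * C)) ^ 4, \<rho>, (b - a) / 2} / 2"
  have \<epsilon>: "0 < \<epsilon>" "\<epsilon> < \<rho> * (1 / (2 * C)) ^ 4" "\<epsilon> < \<rho>" "\<epsilon> < (b - a) / 2"
  proof -
    have "0 < Min {\<rho> * (1 / (2 * C)) ^ 4, \<rho>, (b - a) / 2}"
      using \<rho>0 ab \<open>0 < C\<close> by simp
    moreover have "Min {\<rho> * (1 / (2 * C)) ^ 4, \<rho>, (b - a) / 2} \<le> \<rho> * (1 / (2 * C)) ^ 4"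
      "Min {\<rho> * (1 / (2 * C)) ^ 4, \<rho>, (b - a) / 2} \<le> \<rho>"
      "Min {\<rho> * (1 / (2 * C)) ^ 4, \<rho>, (b - a) / 2} \<le> (b - a) / 2"
      by (intro Min_le; simp)+
    ultimately show "0 < \<epsilon>" "\<epsilon> < \<rho> * (1 / (2 * C)) ^ 4" "\<epsilon> < \<rho>" "\<epsilon> < (b - a) / 2"
      unfolding \<epsilon>_def by linarith+
  qed
  show ?thesis
  proof (rule that[OF \<epsilon>(1,4)], intro allI impI, elim conjE)
    fix v g assume mp: "martin_pair v g" and pos: "0 < v (of_real mid)"
      and le': "\<forall>w. norm w = l * (- mid) \<longrightarrow> v w \<le> C * v (of_real mid)"
    have le: "v w \<le> C * v (of_real mid)" if "norm w = l * (- mid)" for w using le' that by blast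
    note v = martin_pairD[OF mp]
    define B where "B = C * v (of_real mid)"
    have B: "v w \<le> B" if "norm w \<le> l * (- mid)" for w
      unfolding B_def by (rule martin_pair_le_sphere[OF mp le that])
    have B0: "0 \<le> B" using pos \<open>0 < C\<close> by (simp add: B_def)
    have small: "v (of_real t) < v (of_real mid)" if t: "a < t" "t < b" "t < a + \<epsilon> \<or> b - \<epsilon> < t" for t
    proof -
      have lmid: "\<rho> \<le> l * (- mid) - (- mid)" using \<rho>(3) by (simp add: algebra_simps)
      have lb': "l * (- b) \<le> l * (- mid)" using l mid by simp
      \<comment> \<open>\<open>s\<close> is the end of the gap near \<open>t\<close>, and
        \<open>d\<close> orients the slit of \<open>E\<close> that leaves \<open>s\<close> away from
        the gap.\<close>
      obtain s d where sd: "d = 1 \<or> d = -1" "\<bar>t - s\<bar> < \<epsilon>" "\<bar>s\<bar> + \<rho> \<le> l * (- mid)"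
        "\<And>x. 0 \<le> x \<Longrightarrow> x < \<rho> \<Longrightarrow> of_real (s - d * x) \<in> E"
      proof (cases "t < a + \<epsilon>")
        case True
        show ?thesis
        proof (rule that[of 1 a])
          show "\<bar>a\<bar> + \<rho> \<le> l * (- mid)" using \<rho>(1) lb' ab b0 by simp
          show "of_real (a - 1 * x) \<in> E" if "0 \<le> x" "x < \<rho>" for x
            using band_left[of "a - x"] that \<rho>(1) by simp
        qed (use True t in auto)
      next
        case False
        show ?thesis
        proof (rule that[of "-1" b])
          show "\<bar>b\<bar> + \<rho> \<le> l * (- mid)" using lmid mid(2) b0 by simp
          show "of_real (b - (- 1) * x) \<in> E" if "0 \<le> x" "x < \<rho>" for x
            using band_right[of "b + x"] that \<rho>(2) by simp
        qed (use False t in auto)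
      qed
      have dist: "dist (of_real s :: complex) (of_real t) = \<bar>t - s\<bar>"
        by (simp add: dist_norm norm_of_real abs_minus_commute flip: of_real_diff)
      have "v (of_real t) \<le> 2 * B * sqrt (sqrt (dist (of_real s :: complex) (of_real t) / \<rho>))"
      proof (rule slit_barrier[OF \<rho>0 sd(1) B0 v(5)])
        show "v w \<le> B" if "w \<in> cball (of_real s) \<rho>" for w
        proof (rule B)
          have "norm w \<le> norm (of_real s :: complex) + dist (of_real s) w"
            by (metis dist_0_norm dist_triangle2 dist_commute)
          then show "norm w \<le> l * (- mid)" using that sd(3) by simp
        qed
        show "v (of_real (s - d * x)) = 0" if "0 \<le> x" "x < \<rho>" for x
          using v(4) sd(4)[OF that] by blast
        show "of_real t \<in> ball (of_real s :: complex) \<rho>" using dist sd(2) \<epsilon>(3) by simp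
      qed (rule martin_pair_subharmonic[OF mp])
      also have "\<dots> = v (of_real mid) * (2 * C * sqrt (sqrt (\<bar>t - s\<bar> / \<rho>)))"
        by (simp add: dist B_def dist_real_def abs_minus_commute)
      also have "\<dots> < v (of_real mid) * 1"
      proof (intro mult_strict_left_mono pos sqrt_sqrt_less)
        show "\<bar>t - s\<bar> / \<rho> < (1 / (2 * C)) ^ 4"
          using sd(2) \<epsilon>(2) \<rho>0 by (simp add: divide_less_eq mult.commute)
      qed (use \<open>0 < C\<close> \<rho>0 in auto)
      finally show ?thesis by simp
    qed
    have "continuous_on {a + \<epsilon>..b - \<epsilon>} (\<lambda>t. v (of_real t))"
      by (intro continuous_on_compose2[OF v(5)] continuous_intros) auto
    moreover have "mid \<in> {a + \<epsilon>..b - \<epsilon>}" using \<epsilon>(4) by (auto simp: mid_def field_simps)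
    ultimately obtain x where x: "x \<in> {a + \<epsilon>..b - \<epsilon>}"
      "\<And>t. t \<in> {a + \<epsilon>..b - \<epsilon>} \<Longrightarrow> v (of_real t) \<le> v (of_real x)"
      using continuous_attains_sup[of "{a + \<epsilon>..b - \<epsilon>}" "\<lambda>t. v (of_real t)"] by auto
    have xab: "a < x" "x < b" using x(1) \<epsilon>(1) by auto
    have max: "v (of_real t) \<le> v (of_real x)" if "a < t" "t < b" for t
    proof (cases "t \<in> {a + \<epsilon>..b - \<epsilon>}")
      case False
      then have "v (of_real t) < v (of_real mid)" using small[of t] that by auto
      then show ?thesis using x(2)[OF \<open>mid \<in> {a + \<epsilon>..b - \<epsilon>}\<close>] by simp
    qed (rule x(2))
    have D: "(v has_derivative (\<lambda>h. Re (g (of_real x) * h))) (at (of_real x))"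
      by (rule v(2)) (rule gap_notin[OF xab])
    have "((\<lambda>t. v (of_real t)) has_derivative (\<lambda>h. Re (g (of_real x) * of_real h))) (at x)"
    proof -
      have "(complex_of_real has_derivative complex_of_real) (at x)"
        by (auto intro!: derivative_eq_intros)
      from has_derivative_compose[OF this, of v "\<lambda>h. Re (g (of_real x) * h)"] D show ?thesis by blast
    qed
    then have "((\<lambda>t. v (of_real t)) has_real_derivative Re (g (of_real x))) (at x)"
      by (simp add: has_field_derivative_def)
    then have "Re (g (of_real x)) = 0"
      by (rule DERIV_local_max[of _ _ _ "min (x - a) (b - x)"]) (use xab max in \<open>auto simp: abs_if split: if_splits\<close>)
    moreover have "Im (g (of_real x)) = 0"
    proof -
      \<comment> \<open>Differentiating \<open>v (cnj z) = v z\<close> at a real point shows the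
        derivative to be invariant under conjugation of its argument, so its value at
        \<open>\<i>\<close> is 0.\<close>
      have "((\<lambda>z. v (cnj z)) has_derivative (\<lambda>h. Re (g (of_real x) * cnj h))) (at (of_real x))"
        by (rule has_derivative_compose[of cnj]) (use D in \<open>auto intro: bounded_linear_imp_has_derivative bounded_linear_cnj\<close>)
      then have "(v has_derivative (\<lambda>h. Re (g (of_real x) * cnj h))) (at (of_real x))"
        using v(6) by simp
      from has_derivative_unique[OF this D] have "Re (g (of_real x) * cnj \<i>) = Re (g (of_real x) * \<i>)"
        by (rule fun_cong)
      then show ?thesis by simp
    qed
    ultimately have "g (of_real x) = 0" by (simp add: complex_eq_iff)
    then show "\<exists>x\<in>{a + \<epsilon>..b - \<epsilon>}. g (of_real x) = 0" using x(1) by blast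
  qed
qed

end

section \<open>No mass at infinity\<close>

text \<open>The Poisson integral of \<open>\<mu>\<close> at \<open>\<i> * y\<close> is
  \<open>y\<close> times this integral, so mass on the real line contributes only
  \<open>o(y)\<close> along the imaginary axis. The kernel at \<open>y = 1\<close>
  dominates.\<close>

lemma poisson_integral_tendsto_zero:
  fixes \<mu> :: "real measure"
  assumes "sets \<mu> = sets borel" and "integrable \<mu> (\<lambda>t. 1 / (t\<^sup>2 + 1))"
  shows "((\<lambda>y::real. LINT t|\<mu>. 1 / (t\<^sup>2 + y\<^sup>2)) \<longlongrightarrow> 0) at_top"
proof -
  have meas: "(\<lambda>t. 1 / (t\<^sup>2 + y\<^sup>2)) \<in> borel_measurable \<mu>" for y :: real
    unfolding measurable_cong_sets[OF assms(1) refl] by measurable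
  have "((\<lambda>y::real. LINT t|\<mu>. 1 / (t\<^sup>2 + y\<^sup>2)) \<longlongrightarrow> (LINT t|\<mu>. 0)) at_top"
  proof (rule integral_dominated_convergence_at_top[where w = "\<lambda>t. 1 / (t\<^sup>2 + 1)"])
    show "AE t in \<mu>. ((\<lambda>y::real. 1 / (t\<^sup>2 + y\<^sup>2)) \<longlongrightarrow> 0) at_top"
    proof (rule AE_I2)
      fix t :: real
      have "filterlim (\<lambda>y::real. t\<^sup>2 + y\<^sup>2) at_top at_top"
        by (intro filterlim_tendsto_add_at_top[OF tendsto_const] filterlim_pow_at_top filterlim_ident) simp
      then show "((\<lambda>y::real. 1 / (t\<^sup>2 + y\<^sup>2)) \<longlongrightarrow> 0) at_top"
        by (intro tendsto_divide_0[OF tendsto_const] filterlim_at_top_imp_at_infinity)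
    qed
    have "1 / (t\<^sup>2 + y\<^sup>2) \<le> 1 / (t\<^sup>2 + 1)" if "1 \<le> y" for t y :: real
      using that one_le_power[of y 2] by (intro divide_left_mono) (auto intro!: mult_pos_pos add_nonneg_pos)
    then show "\<forall>\<^sub>F y in at_top. AE t in \<mu>. norm (1 / (t\<^sup>2 + y\<^sup>2)) \<le> 1 / (t\<^sup>2 + 1)"
      by (intro eventually_mono[OF eventually_ge_at_top[of "1::real"]] AE_I2) simp
  qed (use assms(2) meas in auto)
  then show ?thesis by simp
qed

context homogeneous_gaps
begin

text \<open>The chain length comes from \<open>K\<close> alone, and scaling by \<open>l ^ n\<close>
  preserves \<open>E\<close>, so it carries the discs about \<open>K\<close> to discs off
  \<open>E\<close>. Hence \<open>C\<close> does not depend on \<open>n\<close>.\<close>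

lemma harnack_on_compact:
  assumes p: "disc_lifting p (- E)" and K: "compact K" "connected K" "K \<subseteq> - E"
  obtains C where "0 < C"
    and "\<And>n z w w'. w \<in> K \<Longrightarrow> w' \<in> K \<Longrightarrow> z \<in> upper_half_plane \<Longrightarrow> p z = of_real (l ^ n) * w \<Longrightarrow>
      \<exists>z'\<in>upper_half_plane. p z' = of_real (l ^ n) * w' \<and>
        (\<forall>Q. Q holomorphic_on upper_half_plane \<and> (\<forall>x\<in>upper_half_plane. 0 \<le> Re (Q x)) \<longrightarrow>
          Re (Q z') \<le> C * Re (Q z) \<and> Re (Q z) \<le> C * Re (Q z'))"
proof -
  obtain e where e: "0 < e" "(\<Union>x\<in>K. ball x e) \<subseteq> - E"
    by (rule compact_subset_open_imp_ball_epsilon_subset[OF K(1) open_gap_complement K(3)]) (rule that)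
  define r where "r = e / 5"
  have r: "0 < r" using e(1) by (simp add: r_def)
  obtain N where N: "\<And>w w'. w \<in> K \<Longrightarrow> w' \<in> K \<Longrightarrow>
    \<exists>n\<le>N. (w, w') \<in> {(x, y). x \<in> K \<and> y \<in> K \<and> dist x y < r} ^^ n"
    by (rule compact_connected_chain[OF K(1,2) r]) (rule that)
  show ?thesis
  proof (rule that[of "2 ^ N"])
    fix n z w w'
    assume w: "w \<in> K" "w' \<in> K" and z: "z \<in> upper_half_plane" "p z = of_real (l ^ n) * w"
    have l0: "0 < l ^ n" using l by simp
    have balls: "ball (of_real (l ^ n) * x) (l ^ n * (5 * r)) \<subseteq> - E" if "x \<in> K" for x
    proof
      fix y assume y: "y \<in> ball (of_real (l ^ n) * x) (l ^ n * (5 * r))"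
      define y' where "y' = y / of_real (l ^ n)"
      have yy: "y = of_real (l ^ n) * y'" using l by (simp add: y'_def)
      have "dist (of_real (l ^ n) * x) (of_real (l ^ n) * y') = l ^ n * dist x y'"
        using l by (simp add: dist_norm norm_mult norm_power flip: right_diff_distrib)
      then have "dist x y' < e" using y yy l0 by (simp add: r_def)
      then have "y' \<in> (\<Union>x\<in>K. ball x e)" using that by auto
      then have "y' \<in> - E" using e(2) by blast
      then show "y \<in> - E" using yy gap_set_scale by simp
    qed
    obtain k where k: "k \<le> N" "(w, w') \<in> {(x, y). x \<in> K \<and> y \<in> K \<and> dist x y < r} ^^ k"
      using N[OF w] by blast
    obtain z' where z': "z' \<in> upper_half_plane" "p z' = of_real (l ^ n) * w'"
      "\<forall>Q. Q holomorphic_on upper_half_plane \<and> (\<forall>x\<in>upper_half_plane. 0 \<le> Re (Q x)) \<longrightarrow>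
          Re (Q z') \<le> 2 ^ k * Re (Q z) \<and> Re (Q z) \<le> 2 ^ k * Re (Q z')"
      by (rule disc_lifting_harnack_chain[OF p l0 r balls z k(2)]) (assumption, rule that)
    have "Re (Q z') \<le> 2 ^ N * Re (Q z) \<and> Re (Q z) \<le> 2 ^ N * Re (Q z')"
      if Q: "Q holomorphic_on upper_half_plane" "\<forall>x\<in>upper_half_plane. 0 \<le> Re (Q x)" for Q
    proof -
      have pw: "(2::real) ^ k \<le> 2 ^ N" using k(1) by simp
      have "Re (Q z') \<le> 2 ^ k * Re (Q z)" "Re (Q z) \<le> 2 ^ k * Re (Q z')" using z'(3) Q by auto
      moreover have "2 ^ k * Re (Q z) \<le> 2 ^ N * Re (Q z)" "2 ^ k * Re (Q z') \<le> 2 ^ N * Re (Q z')"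
        using pw Q(2) z(1) z'(1) by (auto intro!: mult_right_mono)
      ultimately show ?thesis by linarith
    qed
    then show "\<exists>z'\<in>upper_half_plane. p z' = of_real (l ^ n) * w' \<and>
        (\<forall>Q. Q holomorphic_on upper_half_plane \<and> (\<forall>x\<in>upper_half_plane. 0 \<le> Re (Q x)) \<longrightarrow>
          Re (Q z') \<le> 2 ^ N * Re (Q z) \<and> Re (Q z) \<le> 2 ^ N * Re (Q z'))"
      using z'(1,2) by (intro bexI[of _ z']) auto
  qed simp
qed

text \<open>The clash: at a critical point of \<open>P\<close> the remainder \<open>Q\<close> has
  derivative of modulus \<open>c\<close>, whereas the gradient bound allows at most
  \<open>4 * Re (Q z) / Im z\<close>, which the Harnack comparison makes at most
  \<open>c / 2\<close>.\<close>

lemma no_mass_at_infinity: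
  assumes p: "disc_lifting p (- E)" and M: "symmetric_martin_function M E"
    and rep: "half_plane_representation (M \<circ> p) c \<mu>"
  shows "c = 0"
proof (rule ccontr)
  assume "c \<noteq> 0"
  have "0 \<le> c" and sets: "sets \<mu> = sets borel"
    and int: "\<And>\<xi> \<eta>. 0 < \<eta> \<Longrightarrow> integrable \<mu> (\<lambda>t. \<eta> / ((\<xi> - t)\<^sup>2 + \<eta>\<^sup>2))"
    and rep': "\<And>\<xi> \<eta>. 0 < \<eta> \<Longrightarrow>
      M (p (Complex \<xi> \<eta>)) = c * \<eta> + (LINT t|\<mu>. \<eta> / ((\<xi> - t)\<^sup>2 + \<eta>\<^sup>2))"
    using rep by (auto simp: half_plane_representation_def)
  then have c: "0 < c" using \<open>c \<noteq> 0\<close> by simp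
  define v where "v = (\<lambda>z. if z \<in> E then 0 else M z)"
  obtain g where mp: "martin_pair v g"
    by (rule symmetric_martin_pair[OF M]) (rule that, simp add: v_def)
  note v = martin_pairD[OF mp]
  have pE: "p z \<in> - E" if "z \<in> upper_half_plane" for z
    using p that by (auto simp: disc_lifting_def)
  have vp: "v (p z) = M (p z)" if "z \<in> upper_half_plane" for z
    using pE[OF that] by (simp add: v_def)
  have v2: "(v has_derivative (\<lambda>h. Re (g z * h))) (at z)" if "z \<in> - E" for z
    using v(2) that by simp
  obtain P where P: "P holomorphic_on upper_half_plane"
    "\<And>z. z \<in> upper_half_plane \<Longrightarrow> v (p z) = Re (P z)"
    "\<And>z. z \<in> upper_half_plane \<Longrightarrow> (P has_field_derivative g (p z) * deriv p z) (at z)"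
    by (rule harmonic_compose_disc_lifting[OF p v(1) v2]) (assumption, rule that)
  have P0: "\<forall>x\<in>upper_half_plane. 0 \<le> Re (P x)" using v(3) P(2) by metis
  \<comment> \<open>Removes the mass at infinity: \<open>Re (\<i> * c * z)\<close> is
    \<open>- c * Im z\<close>, so \<open>Re Q\<close> is the Poisson integral of
    \<open>\<mu>\<close> alone.\<close>
  define Q where "Q z = P z + \<i> * of_real c * z" for z
  have holQ: "Q holomorphic_on upper_half_plane"
    unfolding Q_def by (intro holomorphic_intros P(1))
  have ReQ: "Re (Q z) = (LINT t|\<mu>. Im z / ((Re z - t)\<^sup>2 + (Im z)\<^sup>2))" if "z \<in> upper_half_plane" for z
    using rep'[of "Im z" "Re z"] that P(2)[OF that] vp[OF that]
    by (simp add: Q_def upper_half_plane_def)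
  have Q0: "0 \<le> Re (Q z)" if "z \<in> upper_half_plane" for z
    unfolding ReQ[OF that] using that
    by (intro Bochner_Integration.integral_nonneg) (simp add: upper_half_plane_def)
  have iy: "\<i> * of_real y \<in> upper_half_plane" if "0 < y" for y
    using that by (simp add: upper_half_plane_def)
  have big: "c * y \<le> v (p (\<i> * of_real y))" if "0 < y" for y
    using Q0[OF iy[OF that]] P(2)[OF iy[OF that]] by (simp add: Q_def)

  have smallQ: "\<exists>Y>0. \<forall>y\<ge>Y. Re (Q (\<i> * of_real y)) \<le> e * y" if "0 < e" for e
  proof -
    have "((\<lambda>y::real. LINT t|\<mu>. 1 / (t\<^sup>2 + y\<^sup>2)) \<longlongrightarrow> 0) at_top"
      using int[of 1 0] by (intro poisson_integral_tendsto_zero sets) simp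
    then have "\<forall>\<^sub>F y in at_top. (LINT t|\<mu>. 1 / (t\<^sup>2 + y\<^sup>2)) < e"
      using \<open>0 < e\<close> by (rule order_tendstoD)
    then obtain Y where Y: "\<And>y. Y \<le> y \<Longrightarrow> (LINT t|\<mu>. 1 / (t\<^sup>2 + y\<^sup>2)) < e"
      by (auto simp: eventually_at_top_linorder)
    have "Re (Q (\<i> * of_real y)) \<le> e * y" if "max Y 1 \<le> y" for y
    proof -
      have y: "0 < y" "Y \<le> y" using that by auto
      have "Re (Q (\<i> * of_real y)) = (LINT t|\<mu>. y * (1 / (t\<^sup>2 + y\<^sup>2)))"
        unfolding ReQ[OF iy[OF y(1)]] by simp
      also have "\<dots> = y * (LINT t|\<mu>. 1 / (t\<^sup>2 + y\<^sup>2))" by (rule integral_mult_right_zero)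
      also have "\<dots> \<le> y * e" using Y[OF y(2)] y(1) by simp
      finally show ?thesis by (simp add: mult.commute)
    qed
    then show ?thesis by (intro exI[of _ "max Y 1"]) auto
  qed

  define R where "R = - mid"
  have R: "0 < R" "R \<le> l * R" using mid l by (auto simp: R_def)
  \<comment> \<open>The path \<open>p (\<i> * y)\<close> is caught on a multiple of the inner
    circle; the outer circle carries the bound required by \<open>gap_critical_point\<close>. The
    segment on the positive axis connects them off \<open>E\<close>.\<close>
  define K0 where "K0 = sphere 0 R \<union> (closed_segment (of_real R) (of_real (l * R)) \<union> sphere (0::complex) (l * R))"
  have conn_sphere: "connected (sphere (0::complex) r)" for r by (rule connected_sphere) simp
  have "connected K0"
    unfolding K0_def
  proof (intro connected_Un conn_sphere connected_segment)
    have "of_real (l * R) \<in> closed_segment (of_real R) (of_real (l * R)) \<inter> sphere (0::complex) (l * R)"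
      using R by (auto simp: norm_mult)
    then show "closed_segment (of_real R) (of_real (l * R)) \<inter> sphere (0::complex) (l * R) \<noteq> {}" by blast
    have "of_real R \<in> sphere 0 R \<inter> (closed_segment (of_real R) (of_real (l * R)) \<union> sphere (0::complex) (l * R))"
      using R by auto
    then show "sphere 0 R \<inter> (closed_segment (of_real R) (of_real (l * R)) \<union> sphere (0::complex) (l * R)) \<noteq> {}"
      by blast
  qed
  have "compact K0" by (simp add: K0_def compact_Un)
  have sph: "w \<in> - E" if "norm w = R \<or> norm w = l * R" for w
    using sphere_notin[of w 0] sphere_notin[of w 1] that by (auto simp: R_def)
  have "K0 \<subseteq> - E"
  proof
    fix w assume "w \<in> K0"
    then consider "norm w = R \<or> norm w = l * R" | "w \<in> closed_segment (of_real R) (of_real (l * R))"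
      by (auto simp: K0_def)
    then show "w \<in> - E"
    proof cases
      case 2
      then obtain t where "w = of_real t" "t \<in> closed_segment R (l * R)"
        using closed_segment_of_real[of R "l * R"] by auto
      then have "0 < Re w" using R by (auto simp: closed_segment_eq_real_ivl)
      then show ?thesis by (simp add: gap_set_iff)
    qed (rule sph)
  qed
  have midK0: "of_real mid \<in> K0" using mid by (simp add: K0_def R_def)
  obtain C where C: "0 < C"
    "\<And>n z w w'. w \<in> K0 \<Longrightarrow> w' \<in> K0 \<Longrightarrow> z \<in> upper_half_plane \<Longrightarrow> p z = of_real (l ^ n) * w \<Longrightarrow>
      \<exists>z'\<in>upper_half_plane. p z' = of_real (l ^ n) * w' \<and>
        (\<forall>Q. Q holomorphic_on upper_half_plane \<and> (\<forall>x\<in>upper_half_plane. 0 \<le> Re (Q x)) \<longrightarrow>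
          Re (Q z') \<le> C * Re (Q z) \<and> Re (Q z) \<le> C * Re (Q z'))"
    by (rule harnack_on_compact[OF p \<open>compact K0\<close> \<open>connected K0\<close> \<open>K0 \<subseteq> - E\<close>]) (rule that)
  have vC: "v (of_real (l ^ n) * w) \<le> C * v (of_real (l ^ n) * w')" if w: "w \<in> K0" "w' \<in> K0" for n w w'
  proof -
    have "of_real (l ^ n) * w \<in> - E" using w \<open>K0 \<subseteq> - E\<close> gap_set_scale by blast
    then obtain z where z: "z \<in> upper_half_plane" "p z = of_real (l ^ n) * w"
      using p unfolding disc_lifting_def by (metis imageE)
    from C(2)[OF w z] obtain z' where z': "z' \<in> upper_half_plane" "p z' = of_real (l ^ n) * w'"
      "Re (P z) \<le> C * Re (P z')" using P(1) P0 by blast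
    then show ?thesis using P(2)[OF z(1)] P(2)[OF z'(1)] z(2) by simp
  qed
  obtain \<epsilon> where \<epsilon>: "0 < \<epsilon>" "\<epsilon> < (b - a) / 2"
    "\<forall>v g. martin_pair v g \<and> 0 < v (of_real mid) \<and>
       (\<forall>w. norm w = l * (- mid) \<longrightarrow> v w \<le> C * v (of_real mid)) \<longrightarrow>
       (\<exists>x\<in>{a + \<epsilon>..b - \<epsilon>}. g (of_real x) = 0)"
    by (rule gap_critical_point[OF C(1)]) (rule that)
  define J :: "complex set" where "J = of_real ` {a + \<epsilon>..b - \<epsilon>}"
  have contJ: "continuous_on {a + \<epsilon>..b - \<epsilon>} (of_real :: real \<Rightarrow> complex)" by (intro continuous_intros)
  have J: "compact J" "connected J" unfolding J_def
    by (auto intro!: compact_continuous_image connected_continuous_image contJ)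
  have "mid \<in> {a + \<epsilon>..b - \<epsilon>}" using \<epsilon>(2) by (auto simp: mid_def field_simps)
  then have midJ: "of_real mid \<in> J" by (auto simp: J_def)
  have JE: "J \<subseteq> - E" using \<epsilon>(1) gap_notin by (auto simp: J_def)
  \<comment> \<open>Two rounds are forced: the constant \<open>C\<close> of \<open>K0\<close>
    determines \<open>\<epsilon>\<close>, this determines the interval \<open>J\<close> holding the
    critical points, and only then can the constant \<open>D\<close> be obtained.\<close>
  define K where "K = K0 \<union> J"
  have K: "compact K" "connected K" "K \<subseteq> - E"
    using J \<open>compact K0\<close> \<open>connected K0\<close> \<open>K0 \<subseteq> - E\<close> JE midJ midK0
    by (auto simp: K_def intro!: compact_Un connected_Un)
  obtain D where D: "0 < D"
    "\<And>n z w w'. w \<in> K \<Longrightarrow> w' \<in> K \<Longrightarrow> z \<in> upper_half_plane \<Longrightarrow> p z = of_real (l ^ n) * w \<Longrightarrow>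
      \<exists>z'\<in>upper_half_plane. p z' = of_real (l ^ n) * w' \<and>
        (\<forall>Q. Q holomorphic_on upper_half_plane \<and> (\<forall>x\<in>upper_half_plane. 0 \<le> Re (Q x)) \<longrightarrow>
          Re (Q z') \<le> D * Re (Q z) \<and> Re (Q z) \<le> D * Re (Q z'))"
    by (rule harnack_on_compact[OF p K]) (rule that)

  \<comment> \<open>One factor \<open>D\<close> is lost in comparing \<open>Re Q\<close>, another in
    comparing heights, and 4 in \<open>harnack_deriv\<close>; the remaining 2 leaves
    \<open>c / 2\<close>.\<close>
  define e where "e = c / (8 * D * D)"
  have e: "0 < e" using c D(1) by (simp add: e_def)
  obtain Y where Y: "0 < Y" "\<And>y. Y \<le> y \<Longrightarrow> Re (Q (\<i> * of_real y)) \<le> e * y"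
    using smallQ[OF e] by blast
  have contp: "continuous_on {Y..y} (\<lambda>y. norm (p (\<i> * of_real y)))" for y
  proof -
    have "continuous_on upper_half_plane p"
      using p by (auto simp: disc_lifting_def intro: holomorphic_on_imp_continuous_on)
    moreover have "continuous_on {Y..y} (\<lambda>y. \<i> * complex_of_real y)"
      by (intro continuous_intros)
    moreover have "(\<lambda>y. \<i> * complex_of_real y) ` {Y..y} \<subseteq> upper_half_plane"
      using Y(1) iy by auto
    ultimately have "continuous_on {Y..y} (\<lambda>y. p (\<i> * complex_of_real y))"
      by (rule continuous_on_compose2)
    then show ?thesis by (rule continuous_on_norm)
  qed
  obtain n where "norm (p (\<i> * of_real Y)) / R < l ^ n"
    using real_arch_pow[OF l] by blast
  then have n: "norm (p (\<i> * of_real Y)) \<le> l ^ n * R" using R(1) by (simp add: divide_less_eq)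
  have "continuous_on (cball 0 (l ^ n * R)) v" using v(5) continuous_on_subset by blast
  then have "bounded (v ` cball 0 (l ^ n * R))"
    by (intro compact_imp_bounded compact_continuous_image) auto
  then obtain V where "\<forall>x\<in>v ` cball 0 (l ^ n * R). norm x \<le> V"
    unfolding bounded_iff by blast
  then have V: "v w \<le> V" if "norm w \<le> l ^ n * R" for w
  proof -
    have "norm (v w) \<le> V" using \<open>\<forall>x\<in>v ` cball 0 (l ^ n * R). norm x \<le> V\<close> that by simp
    then show ?thesis by simp
  qed
  \<comment> \<open>At this height \<open>v (p (\<i> * y1))\<close> exceeds the maximum
    \<open>V\<close> on the disc containing \<open>p (\<i> * Y)\<close>, so the path has left the
    disc and crossed its boundary circle.\<close>
  define y1 where "y1 = max Y (V / c + 1)"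
  have y1: "Y \<le> y1" "0 < y1" using Y(1) by (auto simp: y1_def)
  have "V < c * y1"
  proof -
    have "V / c < y1" by (simp add: y1_def)
    then show ?thesis using c by (simp add: divide_less_eq mult.commute)
  qed
  then have "l ^ n * R \<le> norm (p (\<i> * of_real y1))"
    using V[of "p (\<i> * of_real y1)"] big[OF y1(2)] by linarith
  then obtain y where y: "Y \<le> y" "norm (p (\<i> * of_real y)) = l ^ n * R"
    using IVT'[of "\<lambda>y. norm (p (\<i> * of_real y))", OF n _ y1(1) contp] by auto
  have y0: "0 < y" using y(1) Y(1) by simp
  define w where "w = p (\<i> * of_real y) / of_real (l ^ n)"
  have w: "p (\<i> * of_real y) = of_real (l ^ n) * w" using l by (simp add: w_def)
  have nw: "norm w = R" using y(2) l by (simp add: w_def norm_divide norm_power)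
  then have wK: "w \<in> K0" "w \<in> K" by (auto simp: K0_def K_def)
  have "0 < v (of_real (l ^ n) * w)" using big[OF y0] mult_pos_pos[OF c y0] unfolding w by linarith
  then have vmid: "0 < v (of_real (l ^ n) * of_real mid)"
    using vC[OF wK(1) midK0, of n] C(1) by (meson less_le_trans zero_less_mult_pos)
  have "\<exists>x\<in>{a + \<epsilon>..b - \<epsilon>}. of_real (l ^ n) * g (of_real (l ^ n) * of_real x) = 0"
  proof (rule \<epsilon>(3)[rule_format, of "\<lambda>w. v (of_real (l ^ n) * w)"
        "\<lambda>w. of_real (l ^ n) * g (of_real (l ^ n) * w)"], intro conjI allI impI)
    show "v (of_real (l ^ n) * w) \<le> C * v (of_real (l ^ n) * of_real mid)"
      if "norm w = l * (- mid)" for w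
      by (rule vC[OF _ midK0]) (use that in \<open>simp add: K0_def R_def\<close>)
  qed (rule martin_pair_scale[OF mp], rule vmid)
  then obtain x where x: "of_real x \<in> K" "g (of_real (l ^ n) * of_real x) = 0"
    using l by (auto simp: K_def J_def)
  obtain z where z: "z \<in> upper_half_plane" "p z = of_real (l ^ n) * of_real x"
    "\<forall>Q. Q holomorphic_on upper_half_plane \<and> (\<forall>x\<in>upper_half_plane. 0 \<le> Re (Q x)) \<longrightarrow>
      Re (Q z) \<le> D * Re (Q (\<i> * of_real y)) \<and> Re (Q (\<i> * of_real y)) \<le> D * Re (Q z)"
    using D(2)[OF wK(2) x(1) iy[OF y0] w] by blast
  have "Re (Q z) \<le> D * Re (Q (\<i> * of_real y))"
    using z(3) holQ Q0 by blast
  also have "\<dots> \<le> D * (e * y)" using Y(2)[OF y(1)] D(1) by simp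
  finally have Qz: "Re (Q z) \<le> D * (e * y)" .
  \<comment> \<open>The Harnack comparison applied to the height itself, the real part of
    \<open>- \<i> * z\<close>: the critical point cannot lie much lower than
    \<open>\<i> * y\<close>.\<close>
  have "(\<lambda>z. - \<i> * z) holomorphic_on upper_half_plane \<and> (\<forall>x\<in>upper_half_plane. 0 \<le> Re (- \<i> * x))"
    by (auto simp: upper_half_plane_def intro!: holomorphic_intros)
  with z(3) have "Re (- \<i> * (\<i> * of_real y)) \<le> D * Re (- \<i> * z)" by blast
  then have yz: "y \<le> D * Im z" by simp
  have Imz: "0 < Im z" using z(1) by (simp add: upper_half_plane_def)
  have "(P has_field_derivative 0) (at z)" using P(3)[OF z(1)] z(2) x(2) by simp
  then have Q': "(Q has_field_derivative \<i> * of_real c) (at z)"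
    unfolding Q_def by (auto intro!: derivative_eq_intros)
  have "ball z (Im z) \<subseteq> upper_half_plane"
  proof
    fix w assume "w \<in> ball z (Im z)"
    then have "\<bar>Im (z - w)\<bar> < Im z" using abs_Im_le_cmod[of "z - w"] by (simp add: dist_norm)
    then show "w \<in> upper_half_plane" by (simp add: upper_half_plane_def)
  qed
  then have "norm (\<i> * of_real c) \<le> 4 * Re (Q z) / Im z"
    by (intro harnack_deriv[OF _ _ Imz Q'] holomorphic_on_subset[OF holQ] Q0) auto
  then have "c * Im z \<le> 4 * Re (Q z)" using c Imz by (simp add: norm_mult field_simps)
  also have "\<dots> \<le> 4 * (D * (e * y))" using Qz by simp
  also have "\<dots> \<le> 4 * (D * (e * (D * Im z)))"
    using yz D(1) e by (intro mult_left_mono) auto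
  also have "\<dots> = (c / 2) * Im z" using D(1) by (simp add: e_def)
  finally show False using c Imz by simp
qed

end

section \<open>Singularity\<close>

lemma integrable_kernel:
  fixes \<nu> :: "real measure"
  assumes "finite_measure \<nu>" and sets: "sets \<nu> = sets borel" and f: "continuous_on UNIV f"
    and B: "\<And>t. norm (f t) \<le> B"
  shows "integrable \<nu> (f :: real \<Rightarrow> complex)"
proof -
  interpret finite_measure \<nu> by fact
  show ?thesis
  proof (rule integrable_const_bound)
    show "f \<in> borel_measurable \<nu>"
      unfolding measurable_cong_sets[OF sets refl] using f by (rule borel_measurable_continuous_onI)
  qed (use B in auto)
qed

text \<open>\<open>- \<i> / (t - z)\<close> is holomorphic in \<open>z\<close> with the Poisson
  kernel as real part. Differentiation under the integral is done by hand: the error of the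
  difference quotient has an explicit kernel bounded by \<open>2 / \<eta>^3\<close> times
  \<open>norm (w - z)\<close>.\<close>

lemma cauchy_transform:
  fixes \<nu> :: "real measure"
  assumes fin: "finite_measure \<nu>" and sets: "sets \<nu> = sets borel"
  defines "F \<equiv> \<lambda>z. (LINT t|\<nu>. - \<i> / (of_real t - z))"
  shows "F holomorphic_on upper_half_plane"
    and "\<And>z. z \<in> upper_half_plane \<Longrightarrow> Re (F z) = (LINT t|\<nu>. Im z / ((Re z - t)\<^sup>2 + (Im z)\<^sup>2))"
proof -
  interpret finite_measure \<nu> by fact
  have low: "Im z \<le> norm (of_real t - z)" for z and t :: real
    using abs_Im_le_cmod[of "of_real t - z"] by simp
  have ne: "of_real t - z \<noteq> 0" if "z \<in> upper_half_plane" for z and t :: real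
    using that by (auto simp: upper_half_plane_def complex_eq_iff)
  have int1: "integrable \<nu> (\<lambda>t. - \<i> / (of_real t - z))" if z: "z \<in> upper_half_plane" for z
  proof (rule integrable_kernel[OF fin sets])
    show "continuous_on UNIV (\<lambda>t::real. - \<i> / (of_real t - z))"
      by (intro continuous_intros) (use ne[OF z] in auto)
    show "norm (- \<i> / (of_real t - z)) \<le> 1 / Im z" for t :: real
      using low[of z t] z by (simp add: norm_divide upper_half_plane_def frac_le)
  qed
  show "Re (F z) = (LINT t|\<nu>. Im z / ((Re z - t)\<^sup>2 + (Im z)\<^sup>2))" if z: "z \<in> upper_half_plane" for z
  proof -
    have "Re (- \<i> / (of_real t - z)) = Im z / ((Re z - t)\<^sup>2 + (Im z)\<^sup>2)" for t :: real
      by (simp add: Re_divide power2_commute)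
    then show ?thesis unfolding F_def using integral_Re[OF int1[OF z]] by simp
  qed
  have "\<exists>D. (F has_field_derivative D) (at z)" if z: "z \<in> upper_half_plane" for z
  proof -
    define \<eta> where "\<eta> = Im z"
    have \<eta>: "0 < \<eta>" using z by (simp add: \<eta>_def upper_half_plane_def)
    have int2: "integrable \<nu> (\<lambda>t. - \<i> / (of_real t - z)\<^sup>2)"
    proof (rule integrable_kernel[OF fin sets])
      show "continuous_on UNIV (\<lambda>t::real. - \<i> / (of_real t - z)\<^sup>2)"
        by (intro continuous_intros) (use ne[OF z] in auto)
      show "norm (- \<i> / (of_real t - z)\<^sup>2) \<le> 1 / \<eta>\<^sup>2" for t :: real
      proof -
        have "\<eta>\<^sup>2 \<le> (norm (of_real t - z))\<^sup>2" using low[of z t] \<eta> by (intro power_mono) (auto simp: \<eta>_def)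
        then show ?thesis using \<eta> by (simp add: norm_divide norm_power frac_le)
      qed
    qed
    define D where "D = (LINT t|\<nu>. - \<i> / (of_real t - z)\<^sup>2)"
    define c where "c = 2 / \<eta> ^ 3 * measure \<nu> (space \<nu>)"
    have bound: "norm ((F w - F z) / (w - z) - D) \<le> norm (w - z) * c" if w: "w \<in> ball z (\<eta> / 2)" "w \<noteq> z" for w
    proof -
      have "\<bar>Im (z - w)\<bar> < \<eta> / 2"
        using abs_Im_le_cmod[of "z - w"] w(1) by (simp add: dist_norm)
      then have Imw: "\<eta> / 2 < Im w" unfolding \<eta>_def by (simp add: abs_if split: if_splits)
      then have wH: "w \<in> upper_half_plane" using \<eta> by (simp add: upper_half_plane_def)
      have "(F w - F z) / (w - z) - D = (LINT t|\<nu>. - \<i> * (w - z) / ((of_real t - w) * (of_real t - z)\<^sup>2))"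
      proof -
        have "(- \<i> / (of_real t - w) - - \<i> / (of_real t - z)) / (w - z) - - \<i> / (of_real t - z)\<^sup>2
            = - \<i> * (w - z) / ((of_real t - w) * (of_real t - z)\<^sup>2)" for t :: real
          using ne[OF z, of t] ne[OF wH, of t] w(2)
          by (simp add: divide_simps) (simp add: power2_eq_square algebra_simps)
        moreover have "(F w - F z) / (w - z) - D =
          (LINT t|\<nu>. (- \<i> / (of_real t - w) - - \<i> / (of_real t - z)) / (w - z) - - \<i> / (of_real t - z)\<^sup>2)"
          unfolding F_def D_def
          by (subst Bochner_Integration.integral_diff[OF integrable_divide_zero int2])
             (use Bochner_Integration.integrable_diff[OF int1[OF wH] int1[OF z]]
                Bochner_Integration.integral_diff[OF int1[OF wH] int1[OF z]] in simp_all)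
        ultimately show ?thesis by simp
      qed
      also have "norm \<dots> \<le> (LINT t|\<nu>. norm (w - z) * (2 / \<eta> ^ 3))"
      proof -
        have nb: "norm (- \<i> * (w - z) / ((of_real t - w) * (of_real t - z)\<^sup>2)) \<le> norm (w - z) * (2 / \<eta> ^ 3)"
          for t :: real
        proof -
          have "\<eta> / 2 * \<eta>\<^sup>2 \<le> norm (of_real t - w) * (norm (of_real t - z))\<^sup>2"
            using low[of z t] low[of w t] \<eta> Imw
            by (intro mult_mono power_mono) (auto simp: \<eta>_def)
          then have "norm (w - z) / (norm (of_real t - w) * (norm (of_real t - z))\<^sup>2) \<le> norm (w - z) / (\<eta> / 2 * \<eta>\<^sup>2)"
            using \<eta> by (intro frac_le) auto
          also have "\<dots> = norm (w - z) * (2 / \<eta> ^ 3)" by (simp add: power2_eq_square power3_eq_cube)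
          finally show ?thesis by (simp add: norm_divide norm_mult norm_power)
        qed
        have "integrable \<nu> (\<lambda>t. - \<i> * (w - z) / ((of_real t - w) * (of_real t - z)\<^sup>2))"
          by (rule integrable_kernel[OF fin sets _ nb], intro continuous_intros)
             (use ne[OF z] ne[OF wH] in auto)
        then show ?thesis
          by (intro order_trans[OF integral_norm_bound integral_mono]) (use nb in auto)
      qed
      also have "\<dots> = norm (w - z) * c" by (simp add: c_def)
      finally show ?thesis .
    qed
    have "((\<lambda>w. (F w - F z) / (w - z) - D) \<longlongrightarrow> 0) (at z)"
    proof (rule Lim_null_comparison)
      have "eventually (\<lambda>w. w \<in> ball z (\<eta> / 2)) (at z)"
        by (rule eventually_at_in_open') (use \<eta> in auto)
      moreover have "eventually (\<lambda>w. w \<noteq> z) (at z)" by (simp add: eventually_neq_at_within)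
      ultimately show "eventually (\<lambda>w. norm ((F w - F z) / (w - z) - D) \<le> norm (w - z) * c) (at z)"
        by eventually_elim (rule bound)
      show "((\<lambda>w. norm (w - z) * c) \<longlongrightarrow> 0) (at z)" by (auto intro!: tendsto_eq_intros)
    qed
    then have "(F has_field_derivative D) (at z)"
      unfolding has_field_derivative_iff by (rule LIM_zero_cancel)
    then show ?thesis by blast
  qed
  then show "F holomorphic_on upper_half_plane"
    by (simp add: holomorphic_on_open[OF open_upper_half_plane])
qed

text \<open>For the fibre supremum \<open>H\<close>, continuity off \<open>E\<close> comes from
  Harnack's inequality: all branches share the bound \<open>B\<close> and hence a Lipschitz
  constant. At \<open>E\<close> it comes from squeezing between 0 and \<open>v\<close>.
  Subharmonicity off \<open>E\<close> takes one branch through a nearly maximal fibre point.\<close>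

lemma bounded_minorant_zero:
  assumes p: "disc_lifting p (- E)" and E: "closed E" "e \<in> E"
    and v: "continuous_on UNIV v" "\<And>w. 0 \<le> v w" "\<And>w. w \<in> E \<Longrightarrow> v w = 0"
    and F: "F holomorphic_on upper_half_plane"
    and F0: "\<And>z. z \<in> upper_half_plane \<Longrightarrow> 0 \<le> Re (F z)"
    and FB: "\<And>z. z \<in> upper_half_plane \<Longrightarrow> Re (F z) \<le> B"
    and Fv: "\<And>z. z \<in> upper_half_plane \<Longrightarrow> Re (F z) \<le> v (p z)"
    and z: "z \<in> upper_half_plane"
  shows "Re (F z) = 0"
proof -
  define H where "H w = (if w \<in> E then 0 else (SUP z\<in>{z \<in> upper_half_plane. p z = w}. Re (F z)))" for w
  have pE: "p z \<in> - E" if "z \<in> upper_half_plane" for z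
    using p that by (auto simp: disc_lifting_def)
  have fib: "\<exists>z\<in>upper_half_plane. p z = w" if "w \<notin> E" for w
  proof -
    have "w \<in> p ` upper_half_plane" using p that by (simp add: disc_lifting_def)
    then show ?thesis by blast
  qed
  have bdd: "bdd_above ((\<lambda>z. Re (F z)) ` {z \<in> upper_half_plane. p z = w})" for w
    using FB by (intro bdd_aboveI[of _ B]) auto
  have up: "Re (F z) \<le> H (p z)" if "z \<in> upper_half_plane" for z
    using pE[OF that] that by (auto simp: H_def intro!: cSUP_upper bdd)
  have least: "H w \<le> c" if "w \<notin> E" "\<And>z. z \<in> upper_half_plane \<Longrightarrow> p z = w \<Longrightarrow> Re (F z) \<le> c" for w c
  proof -
    have "{z \<in> upper_half_plane. p z = w} \<noteq> {}" using fib[OF that(1)] by blast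
    then show ?thesis using that by (auto simp: H_def intro!: cSUP_least)
  qed
  have B0: "0 \<le> B" using F0[OF z] FB[OF z] by simp
  have H0: "0 \<le> H w" for w
  proof (cases "w \<in> E")
    case False
    then obtain z where "z \<in> upper_half_plane" "p z = w" using fib by blast
    then show ?thesis using F0 up by force
  qed (simp add: H_def)
  have HB: "H w \<le> B" for w
    by (cases "w \<in> E") (use least[of w B] FB B0 in \<open>auto simp: H_def\<close>)
  have Hv: "H w \<le> v w" for w
    by (cases "w \<in> E") (use least[of w "v w"] Fv v(2) in \<open>auto simp: H_def\<close>)
  have FF: "Re (F z) \<le> H w" if "z \<in> upper_half_plane" "p z = w" for z w
    using up that by blast
  have comp: "H w \<le> H w' + 4 * B * dist w w' / r"
    if r: "0 < r" "ball w r \<subseteq> - E" "dist w w' \<le> r / 2" for w w' r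
  proof (rule least)
    show "w \<notin> E" using r(1,2) by (metis ComplD centre_in_ball subsetD)
    fix z assume z: "z \<in> upper_half_plane" "p z = w"
    obtain \<sigma> where \<sigma>: "\<sigma> holomorphic_on ball w r" "\<sigma> w = z"
      "\<And>x. x \<in> ball w r \<Longrightarrow> \<sigma> x \<in> upper_half_plane"
      "\<And>x. x \<in> ball w r \<Longrightarrow> p (\<sigma> x) = x"
      by (rule disc_liftingE[OF p z r(2)]) (rule that)
    have hol: "(\<lambda>x. F (\<sigma> x)) holomorphic_on ball w r"
      by (rule holomorphic_on_comp[OF \<sigma>(1) F \<sigma>(3)])
    have w': "w' \<in> ball w r" using r by simp
    have "norm (F (\<sigma> w') - F (\<sigma> w)) \<le> 4 * (dist w w' / r) * Re (F (\<sigma> w))"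
      by (rule harnack_ball_diff[OF hol _ r(1,3)]) (use F0 \<sigma>(3) in blast)
    also have "\<dots> \<le> 4 * (dist w w' / r) * B"
      using r(1) FB[OF z(1)] \<sigma>(2) by (intro mult_left_mono) auto
    finally have "Re (F z) - Re (F (\<sigma> w')) \<le> 4 * (dist w w' / r) * B"
      using abs_Re_le_cmod[of "F (\<sigma> w') - F (\<sigma> w)"] \<sigma>(2) by simp
    moreover have "Re (F (\<sigma> w')) \<le> H w'" by (rule FF[OF \<sigma>(3)[OF w'] \<sigma>(4)[OF w']])
    ultimately show "Re (F z) \<le> H w' + 4 * B * dist w w' / r" by (simp add: mult_ac)
  qed
  have "isCont H w" for w
  proof (cases "w \<in> E")
    case True
    then have Hw: "H w = 0" by (simp add: H_def)
    have "(v \<longlongrightarrow> v w) (at w)"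
      using v(1) by (simp add: continuous_on_eq_continuous_at isCont_def)
    then have v0: "(v \<longlongrightarrow> 0) (at w)" using v(3)[OF True] by simp
    have "(H \<longlongrightarrow> 0) (at w)"
      by (rule tendsto_sandwich[OF _ _ tendsto_const v0]) (simp_all add: H0 Hv)
    then show ?thesis using Hw by (simp add: isCont_def)
  next
    case False
    then obtain r where r: "0 < r" "ball w r \<subseteq> - E"
      using E(1) by (metis ComplI open_Compl openE)
    have le: "norm (H x - H w) \<le> 8 * B / r * dist w x" if x: "x \<in> ball w (r / 4)" for x
    proof -
      \<comment> \<open>The reverse estimate needs a ball about \<open>x\<close>; radius
        \<open>r / 2\<close> still avoids \<open>E\<close> and merely doubles the constant.\<close>
      have sub: "ball x (r / 2) \<subseteq> - E"
      proof
        fix y assume "y \<in> ball x (r / 2)"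
        then have "dist w y < r" using x dist_triangle[of w y x] r(1) by simp
        then show "y \<in> - E" using r(2) by auto
      qed
      have "H w \<le> H x + 4 * B * dist w x / r" by (rule comp[OF r]) (use x r(1) in auto)
      moreover have "H x \<le> H w + 4 * B * dist x w / (r / 2)"
        by (rule comp[OF _ sub]) (use x r(1) in \<open>auto simp: dist_commute\<close>)
      moreover have "4 * B * dist w x / r \<le> 8 * B * dist w x / r"
        using B0 r(1) by (intro divide_right_mono mult_right_mono) auto
      ultimately show ?thesis by (simp add: abs_le_iff dist_commute)
    qed
    have "((\<lambda>x. H x - H w) \<longlongrightarrow> 0) (at w)"
    proof (rule Lim_null_comparison)
      have "eventually (\<lambda>x. x \<in> ball w (r / 4)) (at w)"
        by (rule eventually_at_in_open') (use r(1) in auto)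
      then show "eventually (\<lambda>x. norm (H x - H w) \<le> 8 * B / r * dist w x) (at w)"
        by eventually_elim (rule le)
      show "((\<lambda>x. 8 * B / r * dist w x) \<longlongrightarrow> 0) (at w)"
        by (rule tendsto_eq_rhs[OF tendsto_mult[OF tendsto_const tendsto_dist[OF tendsto_const tendsto_ident_at]]])
           simp
    qed
    then show ?thesis unfolding isCont_def by (rule LIM_zero_cancel)
  qed
  then have contH: "continuous_on UNIV H" by (simp add: continuous_on_eq_continuous_at)
  have subH: "subharmonic_at H w" for w
  proof (cases "w \<in> E")
    case True
    then show ?thesis using H0 by (intro subharmonic_at_zero) (auto simp: H_def)
  next
    case False
    then obtain r where r: "0 < r" "ball w r \<subseteq> - E"
      using E(1) by (metis ComplI open_Compl openE)
    show ?thesis unfolding subharmonic_at_def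
    proof (intro exI[of _ r] conjI allI impI r(1))
      fix d :: real assume "0 < d"
      have "\<exists>z\<in>upper_half_plane. p z = w \<and> H w - d \<le> Re (F z)"
      proof (rule ccontr)
        assume neg: "\<not> ?thesis"
        have "H w \<le> H w - d"
        proof (rule least[OF False])
          fix z assume "z \<in> upper_half_plane" "p z = w"
          then show "Re (F z) \<le> H w - d" using neg by force
        qed
        then show False using \<open>0 < d\<close> by simp
      qed
      then obtain z where z: "z \<in> upper_half_plane" "p z = w" "H w - d \<le> Re (F z)" by blast
      obtain \<sigma> where \<sigma>: "\<sigma> holomorphic_on ball w r" "\<sigma> w = z"
        "\<And>x. x \<in> ball w r \<Longrightarrow> \<sigma> x \<in> upper_half_plane"
        "\<And>x. x \<in> ball w r \<Longrightarrow> p (\<sigma> x) = x"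
        by (rule disc_liftingE[OF p z(1,2) r(2)]) (rule that)
      show "\<exists>F. F holomorphic_on ball w r \<and> (\<forall>x\<in>ball w r. Re (F x) \<le> H x) \<and> H w - d \<le> Re (F w)"
      proof (intro exI[of _ "\<lambda>x. F (\<sigma> x)"] conjI ballI)
        show "(\<lambda>x. F (\<sigma> x)) holomorphic_on ball w r"
          by (rule holomorphic_on_comp[OF \<sigma>(1) F \<sigma>(3)])
        show "Re (F (\<sigma> x)) \<le> H x" if "x \<in> ball w r" for x
          by (rule FF[OF \<sigma>(3)[OF that] \<sigma>(4)[OF that]])
        show "H w - d \<le> Re (F (\<sigma> w))" using z(3) \<sigma>(2) by simp
      qed
    qed
  qed
  have "H (p z) = H e" by (rule subharmonic_liouville[OF contH subH HB])
  also have "H e = 0" using E(2) by (simp add: H_def)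
  finally show ?thesis using up[OF z] F0[OF z] by simp
qed

lemma poisson_kernel_integral_le_pi:
  assumes "0 < \<eta>" "0 \<le> k"
  shows "(LINT t|lborel. \<eta> / ((\<xi> - t)\<^sup>2 + \<eta>\<^sup>2) * indicator {-k..k} t) \<le> pi"
proof -
  have pos: "0 < (\<xi> - t)\<^sup>2 + \<eta>\<^sup>2" for t using assms(1) by (simp add: add_nonneg_pos)
  have "(LINT t|lborel. \<eta> / ((\<xi> - t)\<^sup>2 + \<eta>\<^sup>2) * indicator {-k..k} t)
     = arctan ((k - \<xi>) / \<eta>) - arctan ((- k - \<xi>) / \<eta>)"
  proof (rule integral_FTC_Icc_real)
    show "((\<lambda>t. arctan ((t - \<xi>) / \<eta>)) has_real_derivative \<eta> / ((\<xi> - t)\<^sup>2 + \<eta>\<^sup>2)) (at t)" for t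
    proof -
      have "((\<lambda>t. arctan ((t - \<xi>) / \<eta>)) has_real_derivative (1 / \<eta>) * inverse (1 + ((t - \<xi>) / \<eta>)\<^sup>2)) (at t)"
        using assms(1) by (auto intro!: derivative_eq_intros)
      also have "(1 / \<eta>) * inverse (1 + ((t - \<xi>) / \<eta>)\<^sup>2) = \<eta> / ((\<xi> - t)\<^sup>2 + \<eta>\<^sup>2)"
      proof -
        have "1 + ((t - \<xi>) / \<eta>)\<^sup>2 = ((\<xi> - t)\<^sup>2 + \<eta>\<^sup>2) / \<eta>\<^sup>2"
          using assms(1) by (simp add: power_divide field_simps power2_commute)
        then show ?thesis using assms(1) pos[of t] by (simp add: field_simps power2_eq_square)
      qed
      finally show ?thesis .
    qed
    show "isCont (\<lambda>t. \<eta> / ((\<xi> - t)\<^sup>2 + \<eta>\<^sup>2)) t" for t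
      using pos[of t] by (intro continuous_intros) auto
  qed (use assms in simp)
  also have "\<dots> \<le> pi"
    using arctan_bounded[of "(k - \<xi>) / \<eta>"] arctan_bounded[of "(- k - \<xi>) / \<eta>"] by linarith
  finally show ?thesis .
qed

text \<open>If \<open>\<mu>\<close> dominates \<open>\<epsilon>\<close> times Lebesgue measure on a
  bounded set \<open>A\<close>, the Poisson integral of that multiple is a minorant bounded by
  \<open>\<epsilon> * pi\<close>, so it vanishes and \<open>A\<close> is null. Hahn decompositions
  supply such sets; off their union \<open>\<mu>\<close> lies below arbitrarily small multiples of
  Lebesgue measure.\<close>

lemma half_plane_representation_singular:
  assumes p: "disc_lifting p (- E)" and E: "closed E" "e \<in> E"
    and v: "continuous_on UNIV v" "\<And>w. 0 \<le> v w" "\<And>w. w \<in> E \<Longrightarrow> v w = 0"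
    and rep: "half_plane_representation (v \<circ> p) c \<mu>"
  shows "mutually_singular \<mu> lborel"
proof -
  have c: "0 \<le> c" and sets: "sets \<mu> = sets borel"
    and int: "\<And>\<xi> \<eta>. 0 < \<eta> \<Longrightarrow> integrable \<mu> (\<lambda>t. \<eta> / ((\<xi> - t)\<^sup>2 + \<eta>\<^sup>2))"
    and rep': "\<And>\<xi> \<eta>. 0 < \<eta> \<Longrightarrow>
      v (p (Complex \<xi> \<eta>)) = c * \<eta> + (LINT t|\<mu>. \<eta> / ((\<xi> - t)\<^sup>2 + \<eta>\<^sup>2))"
    using rep by (auto simp: half_plane_representation_def)
  have null: "emeasure lborel A = 0"
    if A: "A \<in> sets borel" "A \<subseteq> {-k..k}" and \<epsilon>: "0 < \<epsilon>"
      and le: "\<And>X. X \<in> sets borel \<Longrightarrow> X \<subseteq> A \<Longrightarrow> ennreal \<epsilon> * emeasure lborel X \<le> emeasure \<mu> X"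
    for A k \<epsilon>
  proof -
    have k: "0 \<le> k" if "A \<noteq> {}" using that A(2) by fastforce
    define \<nu> where "\<nu> = density lborel (\<lambda>t. ennreal (\<epsilon> * indicator A t))"
    have sets\<nu>: "sets \<nu> = sets borel" by (simp add: \<nu>_def)
    have em\<nu>: "emeasure \<nu> X = ennreal \<epsilon> * emeasure lborel (A \<inter> X)" if "X \<in> sets borel" for X
    proof -
      have "emeasure \<nu> X = (\<integral>\<^sup>+t. ennreal (\<epsilon> * indicator A t) * indicator X t \<partial>lborel)"
        unfolding \<nu>_def using A(1) that by (intro emeasure_density) auto
      also have "\<dots> = (\<integral>\<^sup>+t. ennreal \<epsilon> * indicator (A \<inter> X) t \<partial>lborel)"
        by (intro nn_integral_cong) (auto simp: indicator_def)
      also have "\<dots> = ennreal \<epsilon> * emeasure lborel (A \<inter> X)"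
        using A(1) that by (intro nn_integral_cmult_indicator) auto
      finally show ?thesis .
    qed
    have "emeasure lborel A \<le> emeasure lborel {-k..k}" using A by (intro emeasure_mono) auto
    also have "\<dots> < \<infinity>" by (simp add: emeasure_lborel_Icc_eq)
    finally have finA: "emeasure lborel A < \<infinity>" .
    have fin: "finite_measure \<nu>"
    proof (rule finite_measureI)
      show "emeasure \<nu> (space \<nu>) \<noteq> \<infinity>"
        using em\<nu>[of UNIV] finA by (simp add: \<nu>_def ennreal_mult_eq_top_iff)
    qed
    have "\<nu> \<le> \<mu>"
    proof (subst le_measure)
      show "\<forall>X\<in>sets \<nu>. emeasure \<nu> X \<le> emeasure \<mu> X"
      proof
        fix X assume "X \<in> sets \<nu>"
        then have X: "X \<in> sets borel" by (simp add: sets\<nu>)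
        have "emeasure \<nu> X \<le> emeasure \<mu> (A \<inter> X)" unfolding em\<nu>[OF X] by (rule le) (use A X in auto)
        also have "\<dots> \<le> emeasure \<mu> X" using X sets by (intro emeasure_mono) auto
        finally show "emeasure \<nu> X \<le> emeasure \<mu> X" .
      qed
    qed (simp add: sets sets\<nu>)
    define F where "F z = (LINT t|\<nu>. - \<i> / (of_real t - z))" for z
    have F: "F holomorphic_on upper_half_plane"
      "\<And>z. z \<in> upper_half_plane \<Longrightarrow> Re (F z) = (LINT t|\<nu>. Im z / ((Re z - t)\<^sup>2 + (Im z)\<^sup>2))"
      using cauchy_transform[OF fin sets\<nu>] unfolding F_def by blast+
    have kernel: "(\<lambda>t. \<eta> / ((\<xi> - t)\<^sup>2 + \<eta>\<^sup>2)) \<in> borel_measurable N" if "sets N = sets borel"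
      for N :: "real measure" and \<xi> \<eta>
      unfolding measurable_cong_sets[OF that refl] by measurable
    have nonneg: "0 \<le> \<eta> / ((\<xi> - t)\<^sup>2 + \<eta>\<^sup>2)" if "0 < \<eta>" for \<xi> \<eta> t :: real
      using that by simp
    have le\<mu>: "(LINT t|\<nu>. \<eta> / ((\<xi> - t)\<^sup>2 + \<eta>\<^sup>2)) \<le> (LINT t|\<mu>. \<eta> / ((\<xi> - t)\<^sup>2 + \<eta>\<^sup>2))"
      if "0 < \<eta>" for \<xi> \<eta>
    proof -
      have "(\<integral>\<^sup>+t. ennreal (\<eta> / ((\<xi> - t)\<^sup>2 + \<eta>\<^sup>2)) \<partial>\<mu>) < \<infinity>"
        using int[OF that, of \<xi>] that by (simp add: integrable_iff_bounded)
      moreover have "(\<integral>\<^sup>+t. ennreal (\<eta> / ((\<xi> - t)\<^sup>2 + \<eta>\<^sup>2)) \<partial>\<nu>) \<le> (\<integral>\<^sup>+t. ennreal (\<eta> / ((\<xi> - t)\<^sup>2 + \<eta>\<^sup>2)) \<partial>\<mu>)"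
        by (rule nn_integral_mono_measure) (simp_all add: sets sets\<nu> \<open>\<nu> \<le> \<mu>\<close>)
      ultimately show ?thesis
        using nonneg[OF that, of \<xi>] kernel[OF sets] kernel[OF sets\<nu>]
        by (simp add: integral_eq_nn_integral enn2real_mono)
    qed
    have le_pi: "(LINT t|\<nu>. \<eta> / ((\<xi> - t)\<^sup>2 + \<eta>\<^sup>2)) \<le> \<epsilon> * pi" if \<eta>: "0 < \<eta>" and "A \<noteq> {}" for \<xi> \<eta>
    proof -
      have "(LINT t|\<nu>. \<eta> / ((\<xi> - t)\<^sup>2 + \<eta>\<^sup>2)) = (LINT t|lborel. \<epsilon> * indicator A t * (\<eta> / ((\<xi> - t)\<^sup>2 + \<eta>\<^sup>2)))"
        unfolding \<nu>_def using A(1) \<epsilon> by (subst integral_density) auto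
      also have "\<dots> \<le> (LINT t|lborel. \<epsilon> * (\<eta> / ((\<xi> - t)\<^sup>2 + \<eta>\<^sup>2) * indicator {-k..k} t))"
      proof (rule integral_mono')
        have "isCont (\<lambda>t. \<eta> / ((\<xi> - t)\<^sup>2 + \<eta>\<^sup>2)) t" for t
          using \<eta> by (intro continuous_intros) (simp add: sum_power2_eq_zero_iff)
        then have "integrable lborel (\<lambda>t. \<eta> / ((\<xi> - t)\<^sup>2 + \<eta>\<^sup>2) * indicator {-k..k} t)"
          using borel_integrable_atLeastAtMost[of "-k" k "\<lambda>t. \<eta> / ((\<xi> - t)\<^sup>2 + \<eta>\<^sup>2)"]
          by (simp add: mult.commute indicator_def if_distrib cong: if_cong)
        then show "integrable lborel (\<lambda>t. \<epsilon> * (\<eta> / ((\<xi> - t)\<^sup>2 + \<eta>\<^sup>2) * indicator {-k..k} t))"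
          by (rule integrable_mult_right)
      qed (use A(2) \<epsilon> \<eta> in \<open>auto simp: indicator_def\<close>)
      also have "\<dots> = \<epsilon> * (LINT t|lborel. \<eta> / ((\<xi> - t)\<^sup>2 + \<eta>\<^sup>2) * indicator {-k..k} t)"
        by (rule integral_mult_right_zero)
      also have "\<dots> \<le> \<epsilon> * pi"
        using poisson_kernel_integral_le_pi[OF \<eta> k[OF \<open>A \<noteq> {}\<close>]] \<epsilon> by simp
      finally show ?thesis .
    qed
    show ?thesis
    proof (cases "A = {}")
      case False
      have "\<i> \<in> upper_half_plane" by (simp add: upper_half_plane_def)
      have "Re (F \<i>) = 0"
      proof (rule bounded_minorant_zero[OF p E v F(1)])
        fix z assume z: "z \<in> upper_half_plane"
        then have Imz: "0 < Im z" by (simp add: upper_half_plane_def)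
        show "0 \<le> Re (F z)" unfolding F(2)[OF z] using Imz by (intro Bochner_Integration.integral_nonneg) simp
        show "Re (F z) \<le> \<epsilon> * pi" unfolding F(2)[OF z] by (rule le_pi[OF Imz False])
        have "v (p z) = c * Im z + (LINT t|\<mu>. Im z / ((Re z - t)\<^sup>2 + (Im z)\<^sup>2))"
          using rep'[OF Imz, of "Re z"] by simp
        then show "Re (F z) \<le> v (p z)"
          unfolding F(2)[OF z] using le\<mu>[OF Imz, of "Re z"] mult_nonneg_nonneg[OF c, of "Im z"] Imz by linarith
      qed (simp_all add: v \<open>\<i> \<in> upper_half_plane\<close>)
      then have "(LINT t|\<nu>. 1 / (t\<^sup>2 + 1)) = 0"
        unfolding F(2)[OF \<open>\<i> \<in> upper_half_plane\<close>] by simp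
      moreover have "integrable \<nu> (\<lambda>t. 1 / (t\<^sup>2 + 1))"
      proof -
        interpret finite_measure \<nu> by (rule fin)
        show ?thesis
        proof (rule integrable_const_bound[of _ 1])
          show "(\<lambda>t. 1 / (t\<^sup>2 + 1)) \<in> borel_measurable \<nu>"
            unfolding measurable_cong_sets[OF sets\<nu> refl] by measurable
        qed (auto simp: divide_le_eq add_nonneg_pos)
      qed
      ultimately have "AE t in \<nu>. 1 / (t\<^sup>2 + 1) = 0"
        by (subst (asm) integral_nonneg_eq_0_iff_AE) auto
      moreover have "1 / (t\<^sup>2 + 1) \<noteq> 0" for t :: real
        by (simp add: add_nonneg_eq_0_iff)
      ultimately have "AE t in \<nu>. False" by simp
      then have "emeasure \<nu> (space \<nu>) = 0" 
        using AE_iff_measurable[of "space \<nu>" \<nu> "\<lambda>_. False"] by simp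
      then have "ennreal \<epsilon> * emeasure lborel A = 0" using em\<nu>[of UNIV] by (simp add: \<nu>_def)
      then show ?thesis using \<epsilon> by simp
    qed simp
  qed
  \<comment> \<open>Finiteness on bounded intervals, for the Hahn decomposition: the kernel at
    \<open>\<i>\<close> is integrable and bounded below on each interval.\<close>
  have fin\<mu>: "emeasure \<mu> {-real m..real m} \<noteq> top" for m
  proof -
    have "integrable \<mu> (\<lambda>t. 1 / (t\<^sup>2 + 1))" using int[of 1 0] by simp
    then have "(\<integral>\<^sup>+t. ennreal (1 / (t\<^sup>2 + 1)) \<partial>\<mu>) < \<infinity>"
      by (simp add: integrable_iff_bounded)
    then have "ennreal ((real m)\<^sup>2 + 1) * (\<integral>\<^sup>+t. ennreal (1 / (t\<^sup>2 + 1)) \<partial>\<mu>) < \<infinity>"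
      by (simp add: ennreal_mult_less_top)
    moreover have "emeasure \<mu> {-real m..real m} \<le> ennreal ((real m)\<^sup>2 + 1) * (\<integral>\<^sup>+t. ennreal (1 / (t\<^sup>2 + 1)) \<partial>\<mu>)"
    proof -
      have "emeasure \<mu> {-real m..real m} = (\<integral>\<^sup>+t. indicator {-real m..real m} t \<partial>\<mu>)"
        by (simp add: sets)
      also have "\<dots> \<le> (\<integral>\<^sup>+t. ennreal ((real m)\<^sup>2 + 1) * ennreal (1 / (t\<^sup>2 + 1)) \<partial>\<mu>)"
      proof (rule nn_integral_mono)
        fix t
        have "1 \<le> ennreal ((real m)\<^sup>2 + 1) * ennreal (1 / (t\<^sup>2 + 1))" if "t \<in> {-real m..real m}"
        proof -
          have "t\<^sup>2 \<le> (real m)\<^sup>2" using that by (intro abs_le_square_iff[THEN iffD1]) auto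
          then have "1 \<le> ((real m)\<^sup>2 + 1) * (1 / (t\<^sup>2 + 1))" by (simp add: add_nonneg_pos)
          then have "1 \<le> ennreal (((real m)\<^sup>2 + 1) * (1 / (t\<^sup>2 + 1)))"
            using ennreal_leI by fastforce
          also have "\<dots> = ennreal ((real m)\<^sup>2 + 1) * ennreal (1 / (t\<^sup>2 + 1))"
            by (rule ennreal_mult) auto
          finally show ?thesis .
        qed
        then show "indicator {-real m..real m} t \<le> ennreal ((real m)\<^sup>2 + 1) * ennreal (1 / (t\<^sup>2 + 1))"
          by (auto simp: indicator_def)
      qed
      also have "\<dots> = ennreal ((real m)\<^sup>2 + 1) * (\<integral>\<^sup>+t. ennreal (1 / (t\<^sup>2 + 1)) \<partial>\<mu>)"
        by (rule nn_integral_cmult) (unfold measurable_cong_sets[OF sets refl], measurable)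
      finally show ?thesis .
    qed
    ultimately show ?thesis by (metis infinity_ennreal_def le_less_trans less_irrefl)
  qed
  \<comment> \<open>One index drives both limits: the multiple of Lebesgue measure shrinks while the
    interval \<open>[-m, m]\<close> of the decomposition grows.\<close>
  define N :: "nat \<Rightarrow> real measure"
    where "N m = density lborel (\<lambda>_. ennreal (1 / real (Suc m)))" for m
  have emN: "emeasure (N m) X = ennreal (1 / real (Suc m)) * emeasure lborel X" if "X \<in> sets borel" for m X
    using that by (simp add: N_def emeasure_density_const)
  have "\<exists>Y\<in>sets \<mu>. Y \<subseteq> {-real m..real m} \<and> (\<forall>X\<in>sets \<mu>. X \<subseteq> Y \<longrightarrow> emeasure (N m) X \<le> emeasure \<mu> X) \<and>
      (\<forall>X\<in>sets \<mu>. X \<subseteq> {-real m..real m} \<longrightarrow> X \<inter> Y = {} \<longrightarrow> emeasure \<mu> X \<le> emeasure (N m) X)" for m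
    by (rule unsigned_Hahn_decomposition)
       (use sets fin\<mu> in \<open>auto simp: N_def emeasure_density_const ennreal_mult_eq_top_iff\<close>)
  then obtain Y where Y: "\<And>m. Y m \<in> sets borel" "\<And>m. Y m \<subseteq> {-real m..real m}"
    "\<And>m X. X \<in> sets borel \<Longrightarrow> X \<subseteq> Y m \<Longrightarrow> emeasure (N m) X \<le> emeasure \<mu> X"
    "\<And>m X. X \<in> sets borel \<Longrightarrow> X \<subseteq> {-real m..real m} \<Longrightarrow> X \<inter> Y m = {} \<Longrightarrow> emeasure \<mu> X \<le> emeasure (N m) X"
    unfolding sets by metis
  have Ynull: "Y m \<in> null_sets lborel" for m
  proof -
    have "emeasure lborel (Y m) = 0"
    proof (rule null[OF Y(1,2)])
      show "0 < 1 / real (Suc m)" by simp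
      show "ennreal (1 / real (Suc m)) * emeasure lborel X \<le> emeasure \<mu> X"
        if "X \<in> sets borel" "X \<subseteq> Y m" for X
        using Y(3)[OF that] emN[OF that(1)] by simp
    qed
    then show ?thesis using Y(1) by (simp add: null_sets_def)
  qed
  define Z where "Z = UNIV - (\<Union>m. Y m)"
  have Z: "Z \<in> sets borel" using Y(1) by (auto simp: Z_def)
  have "emeasure \<mu> (Z \<inter> {-real k..real k}) = 0" for k
  proof -
    define X where "X = Z \<inter> {-real k..real k}"
    have X: "X \<in> sets borel" using Z by (simp add: X_def)
    have "emeasure lborel X \<le> emeasure lborel {-real k..real k}"
      using X by (intro emeasure_mono) (auto simp: X_def)
    also have "\<dots> = ennreal (2 * real k)" by simp
    finally have leX: "emeasure lborel X \<le> ennreal (2 * real k)" .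
    have bound: "emeasure \<mu> X \<le> ennreal (2 * real k / real (Suc m))" if "k \<le> m" for m
    proof -
      have "emeasure \<mu> X \<le> emeasure (N m) X"
        by (rule Y(4)[OF X]) (use that in \<open>auto simp: X_def Z_def\<close>)
      also have "\<dots> \<le> ennreal (1 / real (Suc m)) * ennreal (2 * real k)"
        unfolding emN[OF X] by (intro mult_left_mono leX) simp
      also have "\<dots> = ennreal (2 * real k / real (Suc m))"
        by (simp flip: ennreal_mult)
      finally show ?thesis .
    qed
    have "(\<lambda>m. 2 * real k / real (Suc m)) \<longlonglongrightarrow> 0"
      by (intro LIMSEQ_Suc lim_const_over_n)
    then have "(\<lambda>m. ennreal (2 * real k / real (Suc m))) \<longlonglongrightarrow> ennreal 0"
      by (rule tendsto_ennrealI)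
    then have "emeasure \<mu> X \<le> ennreal 0"
      by (rule LIMSEQ_le_const) (use bound in blast)
    then show ?thesis by (simp add: X_def)
  qed
  then have "Z \<inter> {-real k..real k} \<in> null_sets \<mu>" for k
    using Z sets by (simp add: null_sets_def)
  then have "(\<Union>k. Z \<inter> {-real k..real k}) \<in> null_sets \<mu>" by (rule null_sets_UN)
  moreover have "(\<Union>k. Z \<inter> {-real k..real k}) = Z"
  proof -
    have "\<exists>k. t \<in> {-real k..real k}" for t
    proof -
      obtain k :: nat where "\<bar>t\<bar> \<le> real k" using real_arch_simple by blast
      then show ?thesis by (intro exI[of _ k]) auto
    qed
    then show ?thesis by blast
  qed
  ultimately have "emeasure \<mu> Z = 0" by (simp add: null_sets_def)
  moreover have "emeasure lborel (space lborel - Z) = 0"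
  proof -
    have "(\<Union>m. Y m) \<in> null_sets lborel" using Ynull by (rule null_sets_UN)
    moreover have "space lborel - Z = (\<Union>m. Y m)" by (auto simp: Z_def)
    ultimately show ?thesis by (simp add: null_sets_def)
  qed
  ultimately show ?thesis
    unfolding mutually_singular_def using Z sets by auto
qed

section \<open>Existence of the Poisson representation\<close>

text \<open>Cauchy's formula at \<open>w\<close> is added to an integral that vanishes because its
  pole, the reflected point \<open>1 / cnj w\<close>, is outside the circle. On the circle the two
  kernels add up to the real Poisson kernel, so real parts can be taken.\<close>

lemma poisson_formula_disc:
  assumes g: "g holomorphic_on ball 0 R" and R: "1 < R" and w: "norm w < 1"
  shows "((\<lambda>\<theta>. Re (g (cis \<theta>)) * Re ((cis \<theta> + w) / (cis \<theta> - w))) has_integral 2 * pi * Re (g w)) {0..2 * pi}"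
proof -
  have "((\<lambda>\<zeta>. g \<zeta> / (\<zeta> - w)) has_contour_integral 2 * of_real pi * \<i> * g w) (circlepath 0 1)"
  proof (rule Cauchy_integral_circlepath_simple)
    show "g holomorphic_on cball 0 1" using g R by (rule_tac holomorphic_on_subset) auto
  qed (use w in auto)
  moreover have "((\<lambda>\<zeta>. g \<zeta> * (cnj w / (1 - cnj w * \<zeta>))) has_contour_integral 0) (circlepath 0 1)"
  proof -
    \<comment> \<open>A radius beyond 1 but short of the reflected pole, so that the second
      integrand is holomorphic on a convex neighbourhood of the circle.\<close>
    obtain S where S: "1 < S" "S \<le> R" "S * norm w < 1"
    proof (cases "w = 0")
      case True
      then show ?thesis using that[of R] R by simp
    next
      case False
      then have "1 < 1 / norm w" using w by simp
      then obtain S where "1 < S" "S < min R (1 / norm w)" using R dense[of 1 "min R (1 / norm w)"] by auto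
      then show ?thesis using that[of S] False by (simp add: field_simps)
    qed
    have ne: "1 - cnj w * \<zeta> \<noteq> 0" if "\<zeta> \<in> ball 0 S" for \<zeta>
    proof
      assume "1 - cnj w * \<zeta> = 0"
      then have "norm (cnj w * \<zeta>) = 1" by simp
      moreover have "norm \<zeta> * norm w \<le> S * norm w" using that by (intro mult_right_mono) auto
      ultimately show False using S(3) by (simp add: norm_mult mult.commute)
    qed
    show ?thesis
    proof (rule Cauchy_theorem_convex_simple)
      show "(\<lambda>\<zeta>. g \<zeta> * (cnj w / (1 - cnj w * \<zeta>))) holomorphic_on ball 0 S"
        using ne S(2) by (intro holomorphic_intros holomorphic_on_subset[OF g]) auto
      show "path_image (circlepath 0 1) \<subseteq> ball 0 S" using S(1) by auto
    qed auto
  qed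
  ultimately have "((\<lambda>\<zeta>. g \<zeta> / (\<zeta> - w) + g \<zeta> * (cnj w / (1 - cnj w * \<zeta>)))
      has_contour_integral 2 * of_real pi * \<i> * g w + 0) (circlepath 0 1)"
    by (rule has_contour_integral_add)
  then have "((\<lambda>t. (g (cis t) / (cis t - w) + g (cis t) * (cnj w / (1 - cnj w * cis t))) * \<i> * cis t)
      has_integral 2 * of_real pi * \<i> * g w) {0..2 * pi}"
    unfolding circlepath_def by (subst (asm) has_contour_integral_part_circlepath_iff) auto
  moreover have "(g (cis t) / (cis t - w) + g (cis t) * (cnj w / (1 - cnj w * cis t))) * \<i> * cis t
      = \<i> * (g (cis t) * of_real (Re ((cis t + w) / (cis t - w))))" for t
  proof -
    define e where "e = cis t"
    have e: "e * cnj e = 1" "e \<noteq> 0" by (simp_all add: e_def cis_cnj cis_mult)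
    have ew: "e - w \<noteq> 0" using w by (auto simp: e_def)
    then have ewc: "cnj e - cnj w \<noteq> 0" by (metis complex_cnj_diff complex_cnj_zero_iff)
    have "1 - cnj w * e = e * (cnj e - cnj w)" using e(1) by (simp add: algebra_simps)
    then have k1: "cnj w / (1 - cnj w * e) * e = cnj (w / (e - w))"
      using e(2) ewc by simp
    have k2: "e / (e - w) = 1 + w / (e - w)" using ew by (simp add: field_simps)
    have k3: "(e + w) / (e - w) = 1 + 2 * (w / (e - w))" using ew by (simp add: field_simps)
    have "e / (e - w) + cnj w / (1 - cnj w * e) * e = of_real (Re ((e + w) / (e - w)))"
    proof -
      have "1 + x + cnj x = of_real (Re (1 + 2 * x))" for x by (simp add: complex_eq_iff)
      then show ?thesis unfolding k1 k2 k3 .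
    qed
    then have "g e * (e / (e - w) + cnj w / (1 - cnj w * e) * e) = g e * of_real (Re ((e + w) / (e - w)))"
      by simp
    then have "(g e / (e - w) + g e * (cnj w / (1 - cnj w * e))) * e = g e * of_real (Re ((e + w) / (e - w)))"
      by (simp add: algebra_simps)
    then show ?thesis unfolding e_def[symmetric] by (simp add: mult_ac)
  qed
  ultimately have "((\<lambda>t. \<i> * (g (cis t) * of_real (Re ((cis t + w) / (cis t - w)))))
      has_integral 2 * of_real pi * \<i> * g w) {0..2 * pi}" by (simp only:)
  from has_integral_linear[OF this bounded_linear_Im] show ?thesis
    by (simp add: o_def)
qed

lemma disc_kernel:
  assumes w: "norm w < 1"
  shows "isCont (\<lambda>\<theta>. Re ((cis \<theta> + w) / (cis \<theta> - w))) \<theta>"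
    and "norm (Re ((cis \<theta> + w) / (cis \<theta> - w))) \<le> 2 / (1 - norm w)"
proof -
  have ne: "cis \<theta> - w \<noteq> 0" for \<theta> using w by auto
  have "continuous_on UNIV (\<lambda>\<theta>. Re ((cis \<theta> + w) / (cis \<theta> - w)))"
    using ne by (intro continuous_intros) auto
  then show "isCont (\<lambda>\<theta>. Re ((cis \<theta> + w) / (cis \<theta> - w))) \<theta>"
    by (simp add: continuous_on_eq_continuous_at)
  have "1 - norm w \<le> norm (cis \<theta> - w)" using norm_triangle_ineq2[of "cis \<theta>" w] by simp
  moreover have "norm (cis \<theta> + w) \<le> 2" using norm_triangle_ineq[of "cis \<theta>" w] w by simp
  ultimately have "norm ((cis \<theta> + w) / (cis \<theta> - w)) \<le> 2 / (1 - norm w)"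
    unfolding norm_divide using w by (intro frac_le) auto
  then show "norm (Re ((cis \<theta> + w) / (cis \<theta> - w))) \<le> 2 / (1 - norm w)"
    using abs_Re_le_cmod order_trans by fastforce
qed

text \<open>Normalised by \<open>Re (f 0)\<close>, the values of \<open>Re f\<close> on smaller
  circles are probability densities, by Poisson's formula at 0. Angles are kept on the real line so
  that Helly's theorem applies; the Poisson kernel is a bounded continuous test function
  there.\<close>

lemma herglotz_disc:
  assumes f: "f holomorphic_on ball 0 1" and pos: "\<And>w. norm w < 1 \<Longrightarrow> 0 \<le> Re (f w)"
    and m: "0 < Re (f 0)"
  obtains \<nu> where "real_distribution \<nu>"
    and "\<And>w. norm w < 1 \<Longrightarrow> Re (f w) = Re (f 0) * (LINT \<theta>|\<nu>. Re ((cis \<theta> + w) / (cis \<theta> - w)))"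
proof -
  define m where "m = Re (f 0)"
  have m0: "0 < m" using m by (simp add: m_def)
  define r :: "nat \<Rightarrow> real" where "r n = 1 - 1 / real (n + 2)" for n
  have r: "0 < r n" "r n < 1" for n by (simp_all add: r_def field_simps)
  have rlim: "r \<longlonglongrightarrow> 1"
  proof -
    have "(\<lambda>n. 1 / real (n + 2)) \<longlonglongrightarrow> 0" by (rule LIMSEQ_ignore_initial_segment[OF lim_1_over_n])
    then have "(\<lambda>n. 1 - 1 / real (n + 2)) \<longlonglongrightarrow> 1 - 0" by (intro tendsto_intros)
    then show ?thesis by (simp add: r_def[abs_def])
  qed
  define d where "d n \<theta> = Re (f (of_real (r n) * cis \<theta>)) / (2 * pi * m) * indicator {0..2 * pi} \<theta>" for n \<theta>
  have inball: "of_real (r n) * cis \<theta> \<in> ball 0 1" for n \<theta> using r[of n] by (simp add: norm_mult)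
  have d0: "0 \<le> d n \<theta>" for n \<theta>
    using pos inball m0 by (simp add: d_def indicator_def)
  have formula: "((\<lambda>\<theta>. Re (f (of_real (r n) * cis \<theta>)) * Re ((cis \<theta> + w) / (cis \<theta> - w)))
      has_integral 2 * pi * Re (f (of_real (r n) * w))) {0..2 * pi}" if "norm w < 1" for n w
  proof (rule poisson_formula_disc[of "\<lambda>w. f (of_real (r n) * w)" "1 / r n", OF _ _ that])
    show "(\<lambda>w. f (of_real (r n) * w)) holomorphic_on ball 0 (1 / r n)"
      by (rule holomorphic_on_comp[OF _ f])
         (use r[of n] in \<open>auto intro!: holomorphic_intros simp: norm_mult field_simps\<close>)
  qed (use r[of n] in \<open>simp add: field_simps\<close>)
  have contf: "continuous_on UNIV (\<lambda>\<theta>. Re (f (of_real (r n) * cis \<theta>)))" for n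
  proof -
    have "continuous_on UNIV (\<lambda>\<theta>. of_real (r n) * cis \<theta>)"
      by (intro continuous_intros)
    then have "continuous_on UNIV (\<lambda>\<theta>. f (of_real (r n) * cis \<theta>))"
      by (rule continuous_on_compose2[OF holomorphic_on_imp_continuous_on[OF f]]) (use inball in auto)
    then show ?thesis by (rule continuous_on_Re)
  qed
  have dmeas: "d n \<in> borel_measurable borel" for n
    unfolding d_def[abs_def]
    by (intro borel_measurable_times borel_measurable_divide borel_measurable_const
          borel_measurable_continuous_onI[OF contf] borel_measurable_indicator) simp
  have integ: "integrable lborel (\<lambda>\<theta>. d n \<theta> * k \<theta>)"
      "(LINT \<theta>|lborel. d n \<theta> * k \<theta>) =
        integral {0..2 * pi} (\<lambda>\<theta>. Re (f (of_real (r n) * cis \<theta>)) * k \<theta>) / (2 * pi * m)"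
    if k: "continuous_on UNIV k" for n and k :: "real \<Rightarrow> real"
  proof -
    define F where "F \<theta> = Re (f (of_real (r n) * cis \<theta>)) * k \<theta>" for \<theta>
    have "continuous_on UNIV F" unfolding F_def by (intro continuous_on_mult contf k)
    then have F: "set_integrable lborel {0..2 * pi} F"
      using borel_integrable_atLeastAtMost' continuous_on_subset by blast
    have eq: "d n \<theta> * k \<theta> = (indicator {0..2 * pi} \<theta> *\<^sub>R F \<theta>) / (2 * pi * m)" for \<theta>
      by (simp add: d_def F_def)
    show "integrable lborel (\<lambda>\<theta>. d n \<theta> * k \<theta>)"
      unfolding eq using F unfolding set_integrable_def by (rule integrable_divide_zero)
    show "(LINT \<theta>|lborel. d n \<theta> * k \<theta>) =
        integral {0..2 * pi} (\<lambda>\<theta>. Re (f (of_real (r n) * cis \<theta>)) * k \<theta>) / (2 * pi * m)"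
      unfolding eq F_def[symmetric] using set_borel_integral_eq_integral(2)[OF F]
      by (simp add: set_lebesgue_integral_def)
  qed
  define \<nu> where "\<nu> n = density lborel (\<lambda>\<theta>. ennreal (d n \<theta>))" for n
  have total: "(\<integral>\<^sup>+\<theta>. ennreal (d n \<theta>) \<partial>lborel) = 1" for n
  proof -
    have "(\<integral>\<^sup>+\<theta>. ennreal (d n \<theta>) \<partial>lborel) = ennreal (LINT \<theta>|lborel. d n \<theta>)"
      using integ(1)[of "\<lambda>_. 1" n] d0 by (intro nn_integral_eq_integral) auto
    also have "(LINT \<theta>|lborel. d n \<theta>) = 1"
      using integ(2)[of "\<lambda>_. 1" n] integral_unique[OF formula[of 0 n]] m0
      by (simp add: m_def)
    finally show ?thesis by simp
  qed
  have dist: "real_distribution (\<nu> n)" for n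
  proof -
    have "prob_space (\<nu> n)"
      by (rule prob_spaceI) (use dmeas total in \<open>simp add: \<nu>_def emeasure_density cong: nn_integral_cong\<close>)
    then show ?thesis
      by (simp add: real_distribution_def real_distribution_axioms_def \<nu>_def)
  qed
  have LINT: "(LINT \<theta>|\<nu> n. Re ((cis \<theta> + w) / (cis \<theta> - w))) = Re (f (of_real (r n) * w)) / m"
    if w: "norm w < 1" for n w
  proof -
    have cont: "continuous_on UNIV (\<lambda>\<theta>. Re ((cis \<theta> + w) / (cis \<theta> - w)))"
      using disc_kernel(1)[OF w] by (simp add: continuous_on_eq_continuous_at)
    have "(LINT \<theta>|\<nu> n. Re ((cis \<theta> + w) / (cis \<theta> - w))) = (LINT \<theta>|lborel. d n \<theta> * Re ((cis \<theta> + w) / (cis \<theta> - w)))"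
      unfolding \<nu>_def using dmeas d0 borel_measurable_continuous_onI[OF cont]
      by (subst integral_density) auto
    also have "\<dots> = 2 * pi * Re (f (of_real (r n) * w)) / (2 * pi * m)"
      unfolding integ(2)[OF cont] integral_unique[OF formula[OF w]] ..
    finally show ?thesis by simp
  qed
  have "tight \<nu>"
    unfolding tight_def
  proof (intro conjI allI impI)
    fix \<epsilon> :: real assume "0 < \<epsilon>"
    \<comment> \<open>Since \<open>2 * pi < 7\<close>, this half-open interval, of the shape used in
      \<open>tight\<close>, contains all of \<open>[0, 2 * pi]\<close>.\<close>
    have "measure (\<nu> n) {-1<..7} = 1" for n
    proof -
      interpret real_distribution "\<nu> n" by (rule dist)
      have "d n \<theta> = 0" if "\<theta> \<notin> {-1<..7}" for \<theta>
        using that pi_less_4 pi_gt_zero pi_approx by (auto simp: d_def indicator_def)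
      then have "(\<integral>\<^sup>+\<theta>. ennreal (d n \<theta>) * indicator {-1<..7} \<theta> \<partial>lborel) = (\<integral>\<^sup>+\<theta>. ennreal (d n \<theta>) \<partial>lborel)"
        by (intro nn_integral_cong) (auto simp: indicator_def)
      then have "emeasure (\<nu> n) {-1<..7} = 1"
        unfolding \<nu>_def using dmeas total by (simp add: emeasure_density)
      then show ?thesis by (simp add: measure_def)
    qed
    then show "\<exists>a b. a < b \<and> (\<forall>n. 1 - \<epsilon> < measure (\<nu> n) {a<..b})"
      using \<open>0 < \<epsilon>\<close> by (intro exI[of _ "-1"] exI[of _ 7]) simp
  qed (rule dist)
  then obtain s N where s: "strict_mono (s :: nat \<Rightarrow> nat)" "real_distribution N" "weak_conv_m (\<nu> \<circ> id \<circ> s) N"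
    using tight_imp_convergent_subsubsequence[of \<nu> id] by (auto simp: strict_mono_id)
  show ?thesis
  proof (rule that[OF s(2)])
    fix w :: complex assume w: "norm w < 1"
    have "(\<lambda>n. LINT \<theta>|(\<nu> \<circ> id \<circ> s) n. Re ((cis \<theta> + w) / (cis \<theta> - w)))
        \<longlonglongrightarrow> (LINT \<theta>|N. Re ((cis \<theta> + w) / (cis \<theta> - w)))"
      by (rule weak_conv_imp_integral_bdd_continuous_conv[OF _ s(2,3) disc_kernel[OF w]])
         (simp add: dist)
    then have lim1: "(\<lambda>n. Re (f (of_real (r (s n)) * w)) / m) \<longlonglongrightarrow> (LINT \<theta>|N. Re ((cis \<theta> + w) / (cis \<theta> - w)))"
      using LINT[OF w] by simp
    have "(\<lambda>n. of_real (r (s n)) * w) \<longlonglongrightarrow> of_real 1 * w"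
      using LIMSEQ_subseq_LIMSEQ[OF rlim s(1)] by (intro tendsto_intros) (simp add: o_def)
    moreover have "isCont f w"
      using holomorphic_on_imp_continuous_on[OF f] w by (simp add: continuous_on_eq_continuous_at)
    ultimately have "(\<lambda>n. f (of_real (r (s n)) * w)) \<longlonglongrightarrow> f w"
      using isCont_tendsto_compose[of w f "\<lambda>n. of_real (r (s n)) * w" sequentially] by simp
    then have lim2: "(\<lambda>n. Re (f (of_real (r (s n)) * w)) / m) \<longlonglongrightarrow> Re (f w) / m"
      using m0 by (intro tendsto_intros) auto
    have "Re (f w) / m = (LINT \<theta>|N. Re ((cis \<theta> + w) / (cis \<theta> - w)))"
      by (rule LIMSEQ_unique[OF lim2 lim1])
    then show "Re (f w) = Re (f 0) * (LINT \<theta>|N. Re ((cis \<theta> + w) / (cis \<theta> - w)))"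
      using m0 by (simp add: m_def field_simps)
  qed
qed

text \<open>Under the Cayley transform the circle point \<open>cis \<theta>\<close> corresponds to \<open>t = - cot (\<theta> / 2)\<close>,
  with \<open>cis \<theta> = 1\<close> corresponding to \<open>\<infinity>\<close>.\<close>

lemma disc_kernel_cayley:
  assumes z: "0 < Im z"
  defines "w \<equiv> (z - \<i>) / (z + \<i>)"
  shows "norm w < 1"
    and "cos \<theta> = 1 \<Longrightarrow> Re ((cis \<theta> + w) / (cis \<theta> - w)) = Im z"
    and "cos \<theta> \<noteq> 1 \<Longrightarrow> t = - sin \<theta> / (1 - cos \<theta>) \<Longrightarrow>
      Re ((cis \<theta> + w) / (cis \<theta> - w)) = (1 + t\<^sup>2) * (Im z / ((Re z - t)\<^sup>2 + (Im z)\<^sup>2))"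
proof -
  have zi: "z + \<i> \<noteq> 0" using z by (auto simp: complex_eq_iff)
  have "(norm (z - \<i>))\<^sup>2 < (norm (z + \<i>))\<^sup>2"
    unfolding cmod_power2 using z by (simp add: power2_eq_square algebra_simps)
  then have "norm (z - \<i>) < norm (z + \<i>)" using power2_less_imp_less norm_ge_zero by blast
  then show "norm w < 1" using zi by (simp add: w_def norm_divide)
  show "Re ((cis \<theta> + w) / (cis \<theta> - w)) = Im z" if "cos \<theta> = 1"
  proof -
    have "sin \<theta> = 0" using sin_cos_squared_add[of \<theta>] that by simp
    then have "cis \<theta> = 1" using that by (simp add: complex_eq_iff)
    moreover have "(1 + w) / (1 - w) = - \<i> * z"
    proof -
      have "1 + w = 2 * z / (z + \<i>)" "1 - w = 2 * \<i> / (z + \<i>)"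
        using zi by (simp_all add: w_def field_simps)
      then show ?thesis using zi by (simp add: divide_i)
    qed
    ultimately show ?thesis by simp
  qed
  show "Re ((cis \<theta> + w) / (cis \<theta> - w)) = (1 + t\<^sup>2) * (Im z / ((Re z - t)\<^sup>2 + (Im z)\<^sup>2))"
    if c: "cos \<theta> \<noteq> 1" and t: "t = - sin \<theta> / (1 - cos \<theta>)"
  proof -
    have c': "1 - cos \<theta> \<noteq> 0" using c by simp
    have t1: "t * (1 - cos \<theta>) = - sin \<theta>" using c' by (simp add: t)
    have "t * sin \<theta> * (1 - cos \<theta>) = - (1 + cos \<theta>) * (1 - cos \<theta>)"
    proof -
      have "t * sin \<theta> * (1 - cos \<theta>) = (t * (1 - cos \<theta>)) * sin \<theta>" by (simp add: mult_ac)
      also have "\<dots> = - (sin \<theta>)\<^sup>2" unfolding t1 by (simp add: power2_eq_square)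
      also have "\<dots> = - (1 + cos \<theta>) * (1 - cos \<theta>)"
        unfolding sin_squared_eq by (simp add: algebra_simps power2_eq_square)
      finally show ?thesis .
    qed
    then have t2: "t * sin \<theta> = - (1 + cos \<theta>)" using c' by simp
    have ti: "of_real t + \<i> \<noteq> 0" by (simp add: complex_eq_iff)
    have "cis \<theta> * (of_real t + \<i>) = of_real t - \<i>"
      using t1 t2 by (simp add: complex_eq_iff algebra_simps)
    then have e: "cis \<theta> = (of_real t - \<i>) / (of_real t + \<i>)" using ti by (simp add: field_simps)
    have tz: "of_real t - z \<noteq> 0" using z by (auto simp: complex_eq_iff)
    have n1: "cis \<theta> + w = 2 * (1 + of_real t * z) / ((of_real t + \<i>) * (z + \<i>))"
      unfolding e w_def using ti zi by (simp add: divide_simps) (simp add: algebra_simps)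
    have n2: "cis \<theta> - w = 2 * \<i> * (of_real t - z) / ((of_real t + \<i>) * (z + \<i>))"
      unfolding e w_def using ti zi by (simp add: divide_simps) (simp add: algebra_simps)
    have "(cis \<theta> + w) / (cis \<theta> - w) = - \<i> * ((1 + of_real t * z) / (of_real t - z))"
      unfolding n1 n2 using ti zi tz by (simp add: divide_simps)
    moreover have "Re (- \<i> * x) = Im x" for x by simp
    ultimately have "Re ((cis \<theta> + w) / (cis \<theta> - w)) = Im ((1 + of_real t * z) / (of_real t - z))" by metis
    also have "\<dots> = (1 + t\<^sup>2) * (Im z / ((Re z - t)\<^sup>2 + (Im z)\<^sup>2))"
      by (simp add: Im_divide power2_commute) (simp add: power2_eq_square algebra_simps)
    finally show ?thesis .
  qed
qed

text \<open>The Herglotz measure on angles is transported to the line: the mass of angles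
  representing the circle point 1 becomes \<open>c\<close>, the rest is pushed forward with the
  density that turns one kernel into the other.\<close>

lemma poisson_representation_exists:
  assumes P: "P holomorphic_on upper_half_plane"
    and pos: "\<And>z. z \<in> upper_half_plane \<Longrightarrow> 0 \<le> Re (P z)"
    and u: "\<And>z. z \<in> upper_half_plane \<Longrightarrow> u z = Re (P z)"
  shows "\<exists>c \<mu>. half_plane_representation u c \<mu>"
proof (cases "Re (P \<i>) = 0")
  case True
  have iH: "\<i> \<in> upper_half_plane" by (simp add: upper_half_plane_def)
  \<comment> \<open>A nonnegative harmonic function vanishing at one point is zero. The case is
    split off because \<open>herglotz_disc\<close> normalises by the value at the centre.\<close>
  have "(\<lambda>z. exp (- P z)) constant_on upper_half_plane"
  proof (rule maximum_modulus_principle)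
    show "(\<lambda>z. exp (- P z)) holomorphic_on upper_half_plane" by (intro holomorphic_intros P)
    show "norm (exp (- P z)) \<le> norm (exp (- P \<i>))" if "z \<in> upper_half_plane" for z
      using pos[OF that] True by simp
  qed (use iH open_upper_half_plane convex_upper_half_plane in \<open>auto intro: convex_connected\<close>)
  then obtain k where k: "\<And>z. z \<in> upper_half_plane \<Longrightarrow> exp (- P z) = k"
    unfolding constant_on_def by blast
  have "Re (P z) = 0" if "z \<in> upper_half_plane" for z
  proof -
    have "norm (exp (- P z)) = norm (exp (- P \<i>))" using k[OF that] k[OF iH] by simp
    then show ?thesis using True by simp
  qed
  then have "half_plane_representation u 0 (null_measure borel)"
    using u by (simp add: half_plane_representation_def upper_half_plane_def)
  then show ?thesis by blast
next
  case False
  have iH: "\<i> \<in> upper_half_plane" by (simp add: upper_half_plane_def)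
  define C :: "complex \<Rightarrow> complex" where "C w = \<i> * (1 + w) / (1 - w)" for w
  define f where "f w = P (C w)" for w
  have ne1: "1 - w \<noteq> 0" if "norm w < 1" for w :: complex using that by auto
  have CH: "C w \<in> upper_half_plane" if "norm w < 1" for w
  proof -
    have "Im (C w) = (1 - (norm w)\<^sup>2) / (norm (1 - w))\<^sup>2"
      unfolding C_def Im_divide cmod_power2 by (simp add: power2_eq_square algebra_simps)
    moreover have "(norm w)\<^sup>2 < 1" using abs_square_less_1[of "norm w"] that by simp
    ultimately show ?thesis using ne1[OF that] by (simp add: upper_half_plane_def)
  qed
  have "f holomorphic_on ball 0 1"
    unfolding f_def by (rule holomorphic_on_comp[OF _ P])
      (use CH in \<open>auto simp: C_def[abs_def] intro!: holomorphic_intros\<close>)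
  moreover have f0: "f 0 = P \<i>" by (simp add: f_def C_def)
  moreover have "0 \<le> Re (f w)" if "norm w < 1" for w using pos CH[OF that] by (simp add: f_def)
  moreover have "0 < Re (f 0)" using False pos[OF iH] f0 by simp
  ultimately obtain \<nu> where \<nu>: "real_distribution \<nu>"
    "\<And>w. norm w < 1 \<Longrightarrow> Re (f w) = Re (f 0) * (LINT \<theta>|\<nu>. Re ((cis \<theta> + w) / (cis \<theta> - w)))"
    using herglotz_disc[of f thesis] by blast
  interpret \<nu>: real_distribution \<nu> by (rule \<nu>(1))
  define m where "m = Re (f 0)"
  have m: "0 < m" using \<open>0 < Re (f 0)\<close> by (simp add: m_def)
  define T where "T \<theta> = - sin \<theta> / (1 - cos \<theta>)" for \<theta> :: real
  \<comment> \<open>A set rather than the angle 0, because the measure lives on the line, where both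
    0 and \<open>2 * pi\<close> represent the point at infinity.\<close>
  define S where "S = {\<theta>::real. cos \<theta> = 1}"
  have Tm: "T \<in> borel_measurable \<nu>" unfolding T_def by measurable
  have Sm: "S \<in> sets \<nu>" unfolding S_def \<nu>.events_eq_borel by measurable
  \<comment> \<open>\<open>1 + t^2\<close> is the quotient of the disc and half-plane kernels. On
    \<open>S\<close> the map \<open>T\<close> has the default value \<open>0 / 0 = 0\<close>, made
    harmless by the indicator.\<close>
  define D where "D \<theta> = indicator (- S) \<theta> * (m * (1 + (T \<theta>)\<^sup>2))" for \<theta>
  have D0: "0 \<le> D \<theta>" for \<theta> using m by (simp add: D_def indicator_def)
  have Dm: "D \<in> borel_measurable \<nu>" unfolding D_def using Tm Sm by measurable
  define \<mu> where "\<mu> = distr (density \<nu> (\<lambda>\<theta>. ennreal (D \<theta>))) borel T"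
  define c where "c = m * measure \<nu> S"
  have "half_plane_representation u c \<mu>"
    unfolding half_plane_representation_def
  proof (intro conjI allI impI)
    show "0 \<le> c" using m by (simp add: c_def)
    show "sets \<mu> = sets borel" by (simp add: \<mu>_def)
    fix \<xi> \<eta> :: real assume \<eta>: "0 < \<eta>"
    define z where "z = Complex \<xi> \<eta>"
    have z: "0 < Im z" "z \<in> upper_half_plane" using \<eta> by (simp_all add: z_def upper_half_plane_def)
    define w where "w = (z - \<i>) / (z + \<i>)"
    have w: "norm w < 1" unfolding w_def by (rule disc_kernel_cayley(1)[OF z(1)])
    have zi: "z + \<i> \<noteq> 0" using z(1) by (auto simp: complex_eq_iff)
    have "C w = z"
    proof -
      have "1 + w = 2 * z / (z + \<i>)" "1 - w = 2 * \<i> / (z + \<i>)"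
        using zi by (simp_all add: w_def field_simps)
      then show ?thesis using zi by (simp add: C_def)
    qed
    define k where "k \<theta> = Re ((cis \<theta> + w) / (cis \<theta> - w))" for \<theta>
    have uz: "u z = m * (LINT \<theta>|\<nu>. k \<theta>)"
      using \<nu>(2)[OF w] u[OF z(2)] \<open>C w = z\<close> by (simp add: f_def m_def k_def)
    have kS: "k \<theta> = \<eta>" if "\<theta> \<in> S" for \<theta>
      using disc_kernel_cayley(2)[OF z(1), of \<theta>] that by (simp add: S_def k_def w_def z_def)
    have kT: "D \<theta> * (\<eta> / ((\<xi> - T \<theta>)\<^sup>2 + \<eta>\<^sup>2)) = m * (indicator (- S) \<theta> * k \<theta>)" for \<theta>
      using disc_kernel_cayley(3)[OF z(1), of \<theta> "T \<theta>"]
      by (auto simp: S_def k_def w_def z_def D_def T_def indicator_def)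
    have km: "k \<in> borel_measurable \<nu>"
      unfolding k_def using disc_kernel(1)[OF w]
      by (auto simp: \<nu>.events_eq_borel measurable_cong_sets[OF \<nu>.events_eq_borel refl]
          intro!: borel_measurable_continuous_onI continuous_at_imp_continuous_on)
    have kint: "integrable \<nu> k"
      by (rule \<nu>.integrable_const_bound[OF _ km]) (use disc_kernel(2)[OF w] in \<open>auto simp: k_def\<close>)
    have int1: "integrable \<nu> (\<lambda>\<theta>. indicator (- S) \<theta> * k \<theta>)"
      using integrable_mult_indicator[OF _ kint, of "- S"] sets.compl_sets[OF Sm]
      by (simp add: Compl_eq_Diff_UNIV)
    have int2: "integrable \<nu> (\<lambda>\<theta>. indicator S \<theta> * k \<theta>)"
      using integrable_mult_indicator[OF Sm kint] by simp
    have gm: "(\<lambda>t. \<eta> / ((\<xi> - t)\<^sup>2 + \<eta>\<^sup>2)) \<in> borel_measurable borel" by measurable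
    have gTm: "(\<lambda>\<theta>. \<eta> / ((\<xi> - T \<theta>)\<^sup>2 + \<eta>\<^sup>2)) \<in> borel_measurable \<nu>" using Tm by measurable
    have Tm': "T \<in> measurable (density \<nu> (\<lambda>\<theta>. ennreal (D \<theta>))) borel" using Tm by simp
    show "integrable \<mu> (\<lambda>t. \<eta> / ((\<xi> - t)\<^sup>2 + \<eta>\<^sup>2))"
    proof -
      have "integrable \<nu> (\<lambda>\<theta>. D \<theta> * (\<eta> / ((\<xi> - T \<theta>)\<^sup>2 + \<eta>\<^sup>2)))"
        unfolding kT using int1 by (rule integrable_mult_right)
      then show ?thesis
        unfolding \<mu>_def integrable_distr_eq[OF Tm' gm]
        using gTm Dm D0 by (simp add: integrable_density)
    qed
    have "(LINT t|\<mu>. \<eta> / ((\<xi> - t)\<^sup>2 + \<eta>\<^sup>2)) = (LINT \<theta>|\<nu>. D \<theta> * (\<eta> / ((\<xi> - T \<theta>)\<^sup>2 + \<eta>\<^sup>2)))"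
      unfolding \<mu>_def integral_distr[OF Tm' gm] using gTm Dm D0 by (simp add: integral_density)
    also have "\<dots> = m * (LINT \<theta>|\<nu>. indicator (- S) \<theta> * k \<theta>)"
      unfolding kT by (rule integral_mult_right_zero)
    finally have I1: "(LINT t|\<mu>. \<eta> / ((\<xi> - t)\<^sup>2 + \<eta>\<^sup>2)) = m * (LINT \<theta>|\<nu>. indicator (- S) \<theta> * k \<theta>)" .
    have I2: "(LINT \<theta>|\<nu>. indicator S \<theta> * k \<theta>) = measure \<nu> S * \<eta>"
    proof -
      have "(LINT \<theta>|\<nu>. indicator S \<theta> * k \<theta>) = (LINT \<theta>|\<nu>. indicator S \<theta> * \<eta>)"
        by (rule Bochner_Integration.integral_cong) (auto simp: kS indicator_def)
      then show ?thesis using Sm by simp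
    qed
    have "(LINT \<theta>|\<nu>. k \<theta>) = (LINT \<theta>|\<nu>. indicator S \<theta> * k \<theta> + indicator (- S) \<theta> * k \<theta>)"
      by (rule Bochner_Integration.integral_cong) (auto simp: indicator_def)
    also have "\<dots> = measure \<nu> S * \<eta> + (LINT \<theta>|\<nu>. indicator (- S) \<theta> * k \<theta>)"
      by (simp add: Bochner_Integration.integral_add[OF int2 int1] I2)
    finally show "u (Complex \<xi> \<eta>) = c * \<eta> + (LINT t|\<mu>. \<eta> / ((\<xi> - t)\<^sup>2 + \<eta>\<^sup>2))"
      unfolding z_def[symmetric] uz I1 c_def by (simp add: algebra_simps)
  qed
  then show ?thesis by blast
qed

section \<open>The representing measure\<close>

context homogeneous_gaps
begin

lemma martin_representation_exists:
  assumes p: "disc_lifting p (- E)" and M: "symmetric_martin_function M E"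
  shows "\<exists>c \<mu>. half_plane_representation (M \<circ> p) c \<mu>"
proof -
  obtain g where g: "g holomorphic_on - E"
    "\<And>z. z \<in> - E \<Longrightarrow> (M has_derivative (\<lambda>h. Re (g z * h))) (at z)"
    by (rule harmonic_holomorphic_gradient[of M "- E"])
       (use M in \<open>simp add: symmetric_martin_function_def\<close>, rule that)
  obtain P where P: "P holomorphic_on upper_half_plane"
    "\<And>z. z \<in> upper_half_plane \<Longrightarrow> M (p z) = Re (P z)"
    "\<And>z. z \<in> upper_half_plane \<Longrightarrow> (P has_field_derivative g (p z) * deriv p z) (at z)"
    by (rule harmonic_compose_disc_lifting[OF p g]) (assumption, rule that)
  have "p z \<in> - E" if "z \<in> upper_half_plane" for z
    using p that by (auto simp: disc_lifting_def)
  then have "0 \<le> Re (P z)" if "z \<in> upper_half_plane" for z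
    using P(2)[OF that] M that unfolding symmetric_martin_function_def by metis
  then show ?thesis
    by (rule poisson_representation_exists[OF P(1)]) (simp_all add: P(2))
qed

lemma martin_representation_singular:
  assumes p: "disc_lifting p (- E)" and M: "symmetric_martin_function M E"
    and rep: "half_plane_representation (M \<circ> p) c \<mu>"
  shows "mutually_singular \<mu> lborel"
proof -
  define v where "v = (\<lambda>z. if z \<in> E then 0 else M z)"
  obtain g where "martin_pair v g"
    by (rule symmetric_martin_pair[OF M]) (rule that, simp add: v_def)
  note v = martin_pairD[OF this]
  have "v (p z) = M (p z)" if "z \<in> upper_half_plane" for z
    using p that by (auto simp: v_def disc_lifting_def)
  then have rep': "half_plane_representation (v \<circ> p) c \<mu>"
    using rep by (auto simp: half_plane_representation_def upper_half_plane_def)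
  have "l powi n * b < 0" for n using b0 l by (intro mult_pos_neg) auto
  then have "0 \<in> E" by (auto simp: gap_set_iff dest: order.asym)
  show ?thesis
    by (rule half_plane_representation_singular[OF p closed_gap_set \<open>0 \<in> E\<close> v(5,3,4) rep'])
qed

text \<open>A second representation, for the inverted covering \<open>q\<close>, has no mass at
  infinity, so \<open>M (q (\<i> * y))\<close> is \<open>o(y)\<close>, whereas an atom at
  \<open>t\<close> forces it to be at least \<open>y * measure \<mu> {t}\<close>. The two measures
  are compared only through these values.\<close>

lemma martin_representation_no_atom:
  assumes p: "disc_lifting p (- E)" and M: "symmetric_martin_function M E"
    and rep: "half_plane_representation (M \<circ> p) c \<mu>"
  shows "emeasure \<mu> {t} = 0"
proof -
  define q where "q z = p (of_real t - 1 / z)" for z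
  have q: "disc_lifting q (- E)"
    unfolding q_def by (rule disc_lifting_inversion[OF p])
  obtain c' \<mu>' where rep': "half_plane_representation (M \<circ> q) c' \<mu>'"
    using martin_representation_exists[OF q M] by blast
  have "c' = 0" by (rule no_mass_at_infinity[OF q M rep'])
  have \<mu>: "0 \<le> c" "sets \<mu> = sets borel"
    "\<And>\<xi> \<eta>. 0 < \<eta> \<Longrightarrow> integrable \<mu> (\<lambda>s. \<eta> / ((\<xi> - s)\<^sup>2 + \<eta>\<^sup>2))"
    "\<And>\<xi> \<eta>. 0 < \<eta> \<Longrightarrow> M (p (Complex \<xi> \<eta>)) = c * \<eta> + (LINT s|\<mu>. \<eta> / ((\<xi> - s)\<^sup>2 + \<eta>\<^sup>2))"
    using rep by (auto simp: half_plane_representation_def)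
  have \<mu>': "sets \<mu>' = sets borel"
    "\<And>\<xi> \<eta>. 0 < \<eta> \<Longrightarrow> integrable \<mu>' (\<lambda>s. \<eta> / ((\<xi> - s)\<^sup>2 + \<eta>\<^sup>2))"
    "\<And>\<xi> \<eta>. 0 < \<eta> \<Longrightarrow> M (q (Complex \<xi> \<eta>)) = (LINT s|\<mu>'. \<eta> / ((\<xi> - s)\<^sup>2 + \<eta>\<^sup>2))"
    using rep' \<open>c' = 0\<close> by (auto simp: half_plane_representation_def)
  have ind: "integrable \<mu> (indicator {t} :: real \<Rightarrow> real)"
  proof (rule Bochner_Integration.integrable_bound[OF \<mu>(3)[of 1 t]])
    show "(indicator {t} :: real \<Rightarrow> real) \<in> borel_measurable \<mu>" using \<mu>(2) by simp
  qed (auto simp: indicator_def)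
  have le: "measure \<mu> {t} \<le> (LINT s|\<mu>'. 1 / (s\<^sup>2 + y\<^sup>2))" if y: "0 < y" for y
  proof -
    have "measure \<mu> {t} * y = (LINT s|\<mu>. indicator {t} s * y)"
      using \<mu>(2) by simp
    \<comment> \<open>At \<open>s = t\<close> and height \<open>1 / y\<close> the Poisson kernel
      equals \<open>y\<close>.\<close>
    also have "\<dots> \<le> (LINT s|\<mu>. (1 / y) / ((t - s)\<^sup>2 + (1 / y)\<^sup>2))"
    proof (rule integral_mono)
      show "integrable \<mu> (\<lambda>s. indicator {t} s * y)" using ind by simp
      show "integrable \<mu> (\<lambda>s. (1 / y) / ((t - s)\<^sup>2 + (1 / y)\<^sup>2))" using \<mu>(3)[of "1 / y" t] y by simp
      show "indicator {t} s * y \<le> (1 / y) / ((t - s)\<^sup>2 + (1 / y)\<^sup>2)" for s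
        using y by (auto simp: indicator_def power2_eq_square)
    qed
    also have "\<dots> \<le> M (p (Complex t (1 / y)))" using \<mu>(1,4) y by simp
    also have "Complex t (1 / y) = of_real t - 1 / Complex 0 y"
      using y by (simp add: complex_eq_iff Re_divide Im_divide power2_eq_square)
    also have "M (p (of_real t - 1 / Complex 0 y)) = (LINT s|\<mu>'. y * (1 / (s\<^sup>2 + y\<^sup>2)))"
      using \<mu>'(3)[OF y, of 0] by (simp add: q_def)
    also have "\<dots> = y * (LINT s|\<mu>'. 1 / (s\<^sup>2 + y\<^sup>2))" by (rule integral_mult_right_zero)
    finally show ?thesis using y by (simp add: mult.commute)
  qed
  have "((\<lambda>y::real. LINT s|\<mu>'. 1 / (s\<^sup>2 + y\<^sup>2)) \<longlongrightarrow> 0) at_top"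
    using \<mu>'(2)[of 1 0] by (intro poisson_integral_tendsto_zero \<mu>'(1)) simp
  then have "measure \<mu> {t} \<le> 0"
    by (rule tendsto_lowerbound) (auto intro: eventually_mono[OF eventually_gt_at_top[of 0]] le)
  then have "measure \<mu> {t} = 0" by (simp add: measure_le_0_iff)
  moreover have "emeasure \<mu> {t} \<noteq> \<infinity>"
    using ind \<mu>(2) by (auto simp: integrable_indicator_iff)
  ultimately show ?thesis by (simp add: measure_def enn2real_eq_0_iff)
qed

end

text \<open>The existence clause keeps the assertion about all representations from holding
  vacuously.\<close>

theorem mainTheorem6:
  fixes l a\<^sub>1 b\<^sub>1 :: real and E \<Omega> :: "complex set"
    and M :: "complex \<Rightarrow> real" and \<pi> :: "complex \<Rightarrow> complex"
  assumes "1 < l" and "a\<^sub>1 < b\<^sub>1" and "b\<^sub>1 < 0" and "l * b\<^sub>1 < a\<^sub>1"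
    and "E = gap_set l a\<^sub>1 b\<^sub>1" and "\<Omega> = - E"
    and "symmetric_martin_function M E"
    and "universal_covering upper_half_plane \<pi> \<Omega>"
  shows "(\<exists>b \<mu>. half_plane_representation (M \<circ> \<pi>) b \<mu>) \<and>
         (\<forall>b \<mu>. half_plane_representation (M \<circ> \<pi>) b \<mu> \<longrightarrow>
            mutually_singular \<mu> lborel \<and>
            (\<forall>x. emeasure (boundary_measure b \<mu>) {x} = 0))"
proof -
  interpret homogeneous_gaps l a\<^sub>1 b\<^sub>1
    using assms(1-4) by unfold_locales
  have M: "symmetric_martin_function M (gap_set l a\<^sub>1 b\<^sub>1)" using assms(5,7) by simp
  have p: "disc_lifting \<pi> (- gap_set l a\<^sub>1 b\<^sub>1)"
    using covering_disc_lifting[OF assms(8)] assms(5,6) by simp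
  have "emeasure (boundary_measure b \<mu>) {x} = 0"
    if rep: "half_plane_representation (M \<circ> \<pi>) b \<mu>" for b \<mu> x
  proof -
    have sets: "sets \<mu> = sets borel" using rep by (simp add: half_plane_representation_def)
    show ?thesis
    proof (cases x)
      case None
      then show ?thesis
        using emeasure_boundary_measure_singleton(1)[OF sets, of b] no_mass_at_infinity[OF p M rep] by simp
    next
      case (Some t)
      then show ?thesis
        using emeasure_boundary_measure_singleton(2)[OF sets, of b t]
          martin_representation_no_atom[OF p M rep, of t] by simp
    qed
  qed
  then show ?thesis
    using martin_representation_exists[OF p M] martin_representation_singular[OF p M] by blast
qed

end
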